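(* Let $M$ be a complete pointed metric space with base point $0$. Suppose that $M$ satisfies at least one of the following conditions: (a) For every compact set $K\subset M$ with $0\in K$ and every subset $\Gamma\subset\mathcal{F}(K)$: if $\Gamma$ is a (V$^*$)-set with respect to $\mathcal{F}(\overline{U})$ for every open set $U\supset K$, then $\Gamma$ is also a (V$^*$)-set with respect to $\mathcal{F}(L)$ for some compact $L\supset K$. (b) For every compact $K\subset M$ with $0\in K$ and every WUC series $\sum_n f_n$ in $\mathrm{Lip}_0(K)$ there exists a WUC series $\sum_n g_n$ in $\mathrm{Lip}_0(M)$ such that $g_n|_K=f_n$ for all $n$. (c) For every compact $K\subset M$, every Lipschitz mapping $\varphi:K\to\ell_1$ can be extended to a Lipschitz mapping $\Phi:M\to\ell_1$ with $\Phi|_K=\varphi$. (d) For every compact $K\subset M$ with $0\in K$ there exists a bounded linear extension operator $E:\mathrm{Lip}_0(K)\to\mathrm{Lip}_0(M)$ such that $E(f)|_K=f$ for all $f\in\mathrm{Lip}_0(K)$. (e) Every compact subset of $M$ is contained in a compact Lipschitz retract of $M$. Then property (V$^*$) is compactly determined for $\mathcal{F}(M)$; that is, if $\mathcal{F}(K\cup\{0\})$ has property (V$^*$) for every compact $K\subset M$, then $\mathcal{F}(M)$ has property (V$^*$).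
   Context: For a pointed metric space $(M,d)$ with base point $0$, $\mathrm{Lip}_0(M)$ is the real Banach space of Lipschitz functions $f:M\to\mathbb{R}$ with $f(0)=0$, normed by the best Lipschitz constant $\mathrm{Lip}(f)$. For $x\in M$, $\delta(x)\in \mathrm{Lip}_0(M)^*$ is the evaluation $f\mapsto f(x)$. The Lipschitz-free space is $\mathcal{F}(M)=\overline{\mathrm{span}}\,\{\delta(x):x\in M\}\subset\mathrm{Lip}_0(M)^*$ (norm closure). For closed $N\subset M$ with $0\in N$, $\mathcal{F}(N)$ is the Lipschitz-free space over $N$ with base point $0$; it is identified isometrically with the subspace $\overline{\mathrm{span}}\,\delta(N)$ of $\mathcal{F}(M)$. A series $\sum_n y_n$ in a Banach space $Y$ is weakly unconditionally Cauchy (WUC) if $\sum_n|\langle y^*,y_n\rangle|<\infty$ for every $y^*\in Y^*$. A subset $\Gamma$ of a Banach space $X$ is a (V$^*$)-set (with respect to $X$) if $\lim_{n\to\infty}\sup_{x\in\Gamma}|\langle x_n^*,x\rangle|=0$ for every WUC series $\sum_n x_n^*$ in $X^*$. $X$ has property (V$^*$) if every (V$^*$)-set with respect to $X$ is relatively weakly compact (its weak closure is weakly compact). A subset $L\subset M$ is a Lipschitz retract of $M$ if there is a Lipschitz map $\pi:M\to L$ with $\pi(x)=x$ for all $x\in L$. *)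

theory Defs
  imports "HOL-Analysis.Analysis" "HOL-Library.Function_Algebras"
begin

section \<open>Normed spaces with explicit carrier\<close>

text \<open>
  The spaces over the subsets of a metric space, and their iterated duals, cannot be types of
  their own. All of them are linear subspaces of function types with the pointwise operations,
  paired with a norm that is only meaningful on the carrier.
\<close>

instantiation "fun" :: (type, real_vector) real_vector
begin

definition scaleR_fun :: "real \<Rightarrow> ('a \<Rightarrow> 'b) \<Rightarrow> 'a \<Rightarrow> 'b"
  where "scaleR_fun r f = (\<lambda>x. r *\<^sub>R f x)"

instance
  by standard (simp_all add: scaleR_fun_def fun_eq_iff scaleR_add_right scaleR_add_left)

end

lemma scaleR_fun_apply [simp]: "(r *\<^sub>R f) x = r *\<^sub>R f x"
  by (simp add: scaleR_fun_def)

record 'v nspace =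
  vecs :: "'v set"
  nrm :: "'v \<Rightarrow> real"

definition real_nspace :: "real nspace"
  where "real_nspace = \<lparr>vecs = UNIV, nrm = (\<lambda>x. \<bar>x\<bar>)\<rparr>"

definition ell1 :: "(nat \<Rightarrow> real) nspace"
  where "ell1 = \<lparr>vecs = {a. summable (\<lambda>n. \<bar>a n\<bar>)}, nrm = (\<lambda>a. \<Sum>n. \<bar>a n\<bar>)\<rparr>"

definition bounded_linear_between ::
  "'v::real_vector nspace \<Rightarrow> 'w::real_vector nspace \<Rightarrow> ('v \<Rightarrow> 'w) \<Rightarrow> bool"
  where "bounded_linear_between X Y T \<longleftrightarrow>
    T ` vecs X \<subseteq> vecs Y \<and>
    (\<forall>x\<in>vecs X. \<forall>y\<in>vecs X. T (x + y) = T x + T y) \<and>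
    (\<forall>c. \<forall>x\<in>vecs X. T (c *\<^sub>R x) = c *\<^sub>R T x) \<and>
    (\<exists>C. \<forall>x\<in>vecs X. nrm Y (T x) \<le> C * nrm X x)"

text \<open>A functional on \<open>X\<close> is represented by the function that vanishes outside the carrier of
  \<open>X\<close>; this makes the representation unique and closed under the pointwise operations.\<close>

definition dual :: "'v::real_vector nspace \<Rightarrow> ('v \<Rightarrow> real) nspace"
  where "dual X =
    \<lparr>vecs = {\<phi>. bounded_linear_between X real_nspace \<phi> \<and> (\<forall>x. x \<notin> vecs X \<longrightarrow> \<phi> x = 0)},
     nrm = (\<lambda>\<phi>. SUP x\<in>{x \<in> vecs X. nrm X x \<le> 1}. \<bar>\<phi> x\<bar>)\<rparr>"

definition norm_closure :: "'v::real_vector nspace \<Rightarrow> 'v set \<Rightarrow> 'v set"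
  where "norm_closure X S = {x \<in> vecs X. \<forall>e>0. \<exists>y\<in>S. nrm X (x - y) < e}"

definition weak_topology :: "'v::real_vector nspace \<Rightarrow> 'v topology"
  where "weak_topology X = topology_generated_by
    {{x \<in> vecs X. \<phi> x \<in> U} | \<phi> U. \<phi> \<in> vecs (dual X) \<and> open U}"

definition relatively_weakly_compact :: "'v::real_vector nspace \<Rightarrow> 'v set \<Rightarrow> bool"
  where "relatively_weakly_compact X \<Gamma> \<longleftrightarrow>
    compactin (weak_topology X) (weak_topology X closure_of \<Gamma>)"

section \<open>WUC series and property (V*)\<close>

definition WUC :: "'v::real_vector nspace \<Rightarrow> (nat \<Rightarrow> 'v) \<Rightarrow> bool"
  where "WUC Y y \<longleftrightarrow> range y \<subseteq> vecs Y \<and> (\<forall>\<phi>\<in>vecs (dual Y). summable (\<lambda>n. \<bar>\<phi> (y n)\<bar>))"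

text \<open>The supremum is taken in \<open>[0, \<infinity>]\<close>: it is \<open>0\<close> for empty and \<open>\<infinity>\<close> for unbounded families.\<close>

definition Vstar_set :: "'v::real_vector nspace \<Rightarrow> 'v set \<Rightarrow> bool"
  where "Vstar_set X \<Gamma> \<longleftrightarrow> \<Gamma> \<subseteq> vecs X \<and>
    (\<forall>\<phi>. WUC (dual X) \<phi> \<longrightarrow> (\<lambda>n. SUP x\<in>\<Gamma>. ennreal \<bar>\<phi> n x\<bar>) \<longlonglongrightarrow> 0)"

definition property_Vstar :: "'v::real_vector nspace \<Rightarrow> bool"
  where "property_Vstar X \<longleftrightarrow> (\<forall>\<Gamma>. Vstar_set X \<Gamma> \<longrightarrow> relatively_weakly_compact X \<Gamma>)"

section \<open>Lipschitz spaces and Lipschitz-free spaces\<close>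

text \<open>Throughout, \<open>z\<close> is the base point and \<open>N\<close> a subset of the metric space containing \<open>z\<close>.
  A function on \<open>N\<close> is represented by its extension by zero; the Lipschitz condition only concerns
  points of \<open>N\<close>.\<close>

definition zero_off :: "'a set \<Rightarrow> ('a \<Rightarrow> real) \<Rightarrow> 'a \<Rightarrow> real"
  where "zero_off N f = (\<lambda>x. if x \<in> N then f x else 0)"

definition Lip0 :: "'a::metric_space \<Rightarrow> 'a set \<Rightarrow> ('a \<Rightarrow> real) nspace"
  where "Lip0 z N =
    \<lparr>vecs = {f. (\<exists>L. L-lipschitz_on N f) \<and> f z = 0 \<and> (\<forall>x. x \<notin> N \<longrightarrow> f x = 0)},
     nrm = (\<lambda>f. Inf {L. L-lipschitz_on N f})\<rparr>"

definition evaluation :: "'a::metric_space \<Rightarrow> 'a set \<Rightarrow> 'a \<Rightarrow> ('a \<Rightarrow> real) \<Rightarrow> real"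
  where "evaluation z N x = (\<lambda>f. if f \<in> vecs (Lip0 z N) then f x else 0)"

definition free_space :: "'a::metric_space \<Rightarrow> 'a set \<Rightarrow> (('a \<Rightarrow> real) \<Rightarrow> real) nspace"
  where "free_space z N =
    \<lparr>vecs = norm_closure (dual (Lip0 z N)) (span (evaluation z N ` N)),
     nrm = nrm (dual (Lip0 z N))\<rparr>"

text \<open>For \<open>K \<subseteq> N\<close>, the canonical isometric embedding of the free space over \<open>K\<close> into the free space
  over \<open>N\<close>: the adjoint of the restriction \<open>Lip0 z N \<rightarrow> Lip0 z K\<close>. It sends the evaluation at a
  point of \<open>K\<close> to the evaluation at the same point, and its image is the closed span of the
  evaluations at points of \<open>K\<close>.\<close>

definition free_embedding ::
  "'a::metric_space \<Rightarrow> 'a set \<Rightarrow> 'a set \<Rightarrow> (('a \<Rightarrow> real) \<Rightarrow> real) \<Rightarrow> ('a \<Rightarrow> real) \<Rightarrow> real"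
  where "free_embedding z K N m = (\<lambda>f. if f \<in> vecs (Lip0 z N) then m (zero_off K f) else 0)"

section \<open>Lipschitz maps into the sequence space and Lipschitz retracts\<close>

definition lipschitz_into_ell1 :: "'a::metric_space set \<Rightarrow> ('a \<Rightarrow> nat \<Rightarrow> real) \<Rightarrow> bool"
  where "lipschitz_into_ell1 N \<phi> \<longleftrightarrow> \<phi> ` N \<subseteq> vecs ell1 \<and>
    (\<exists>C. \<forall>x\<in>N. \<forall>y\<in>N. nrm ell1 (\<phi> x - \<phi> y) \<le> C * dist x y)"

definition lipschitz_retract :: "'a::metric_space set \<Rightarrow> bool"
  where "lipschitz_retract L \<longleftrightarrow>
    (\<exists>\<pi> C. C-lipschitz_on UNIV \<pi> \<and> range \<pi> \<subseteq> L \<and> (\<forall>x\<in>L. \<pi> x = x))"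

end

theory Submission
  imports Defs
begin

text \<open>
  Elements of the free space \<open>F(N)\<close> are functions on \<open>Lip\<^sub>0(N)\<close>, and all bounded functionals on \<open>F(N)\<close> are
  evaluations at elements of \<open>Lip\<^sub>0(N)\<close>. So the weak topology of \<open>F(N)\<close> is the topology of pointwise
  convergence. Moreover a series of functions \<open>f n\<close> is weakly unconditionally Cauchy, in \<open>Lip\<^sub>0(N)\<close> or in the
  dual of \<open>F(N)\<close>, if and only if \<open>\<Sum>n. \<bar>f n x - f n y\<bar> \<le> C * dist x y\<close> for a constant \<open>C\<close>. These two facts
  (\<open>weak_topology_free_space\<close>, \<open>Vstar_set_free_space_iff\<close>) turn the theorem into one about Lipschitz functions.

  Let \<open>\<Gamma>\<close> be a (V*)-set in \<open>F(M)\<close>. A gliding hump argument (\<open>Vstar_set_almost_supported_near_finite\<close>) shows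
  that for every tolerance and every width there is a finite set such that all members of \<open>\<Gamma>\<close> are small on the
  functions vanishing near this set. Cutting off around such finite sets with rapidly decreasing widths and
  tolerances, one moves every \<open>\<gamma>\<close> by at most \<open>\<epsilon>\<close> to an element \<open>T \<gamma>\<close> that annihilates all functions vanishing on
  a compact set \<open>K\<close> (\<open>compact_reduction\<close>). By the Hahn-Banach theorem \<open>T \<gamma>\<close> belongs to \<open>F(K)\<close>. Since \<open>T\<close> is
  a uniform limit on \<open>\<Gamma>\<close> of adjoints of multiplications by functions whose supports shrink to \<open>K\<close>, the set of all
  \<open>T \<gamma>\<close> is a (V*)-set over the closure of every open \<open>U\<close> containing \<open>K\<close>.

  Condition (a) makes it a (V*)-set in \<open>F(L)\<close> for a compact \<open>L\<close>, hence relatively weakly compact since \<open>F(L)\<close> has property (V*). So \<open>\<Gamma>\<close> is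
  within every \<open>\<epsilon>\<close> of a relatively weakly compact set, which implies that it is relatively weakly compact
  itself (\<open>relatively_weakly_compact_if_approximable\<close>).

  The conditions (b) to (e) imply (a), already by testing with \<open>U = M\<close>: each of them allows to extend
  sequences of functions as above from compact subsets to \<open>M\<close>, that is, Lipschitz maps into \<open>\<ell>\<^sub>1\<close>; for (e) one
  composes with the retraction (\<open>Vstar_set_pushforward_if_extension\<close>).
\<close>

section \<open>The Hahn-Banach theorem for sublinear functionals\<close>

definition sublinear_on :: "'v::real_vector set \<Rightarrow> ('v \<Rightarrow> real) \<Rightarrow> bool"
  where "sublinear_on V q \<longleftrightarrow> (\<forall>x\<in>V. \<forall>y\<in>V. q (x + y) \<le> q x + q y) \<and>
    (\<forall>x\<in>V. \<forall>c\<ge>0. q (c *\<^sub>R x) = c * q x)"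

lemma sublinear_onD:
  assumes "sublinear_on V q"
  shows "\<And>x y. x \<in> V \<Longrightarrow> y \<in> V \<Longrightarrow> q (x + y) \<le> q x + q y"
    and "\<And>x c. x \<in> V \<Longrightarrow> 0 \<le> c \<Longrightarrow> q (c *\<^sub>R x) = c * q x"
  using assms by (auto simp: sublinear_on_def)

lemma sublinear_onI:
  assumes V: "subspace V"
    and add: "\<And>x y. x \<in> V \<Longrightarrow> y \<in> V \<Longrightarrow> q (x + y) \<le> q x + q y"
    and zero: "q 0 = 0"
    and pos: "\<And>x c. x \<in> V \<Longrightarrow> 0 < c \<Longrightarrow> q (c *\<^sub>R x) \<le> c * q x"
  shows "sublinear_on V q"
  unfolding sublinear_on_def
proof (intro conjI ballI allI impI add)
  fix x and c :: real assume x: "x \<in> V" and c: "0 \<le> c"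
  show "q (c *\<^sub>R x) = c * q x"
  proof (cases "c = 0")
    case False
    then have "q ((1 / c) *\<^sub>R (c *\<^sub>R x)) \<le> (1 / c) * q (c *\<^sub>R x)"
      using c by (intro pos subspace_scale[OF V x]) auto
    then have "c * q x \<le> q (c *\<^sub>R x)" using False c by (simp add: field_simps)
    then show ?thesis using pos[OF x] False c by (simp add: antisym)
  qed (simp add: zero)
qed

lemma sublinear_on_neg:
  assumes "subspace V" "sublinear_on V q" "x \<in> V"
  shows "- q (- x) \<le> q x"
proof -
  have "q (x + - x) \<le> q x + q (- x)"
    by (intro sublinear_onD(1)[OF assms(2)] assms subspace_neg)
  moreover have "q (0 *\<^sub>R x) = 0 * q x"
    using sublinear_onD(2)[OF assms(2,3), of 0] by simp
  ultimately show ?thesis by simp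
qed

text \<open>
  The new functional is \<open>q' x = inf {q (x + t u) - t q u | t \<ge> 0}\<close>. It lies below \<open>q\<close>, and
  it differs from \<open>q\<close> unless \<open>q\<close> is additive in the direction \<open>u\<close>. Hence a minimal sublinear functional is
  linear.
\<close>

lemma sublinear_on_improve:
  assumes V: "subspace V" and q: "sublinear_on V q" and u: "u \<in> V"
  obtains q' where "sublinear_on V q'" "\<And>x. x \<in> V \<Longrightarrow> q' x \<le> q x"
    "\<And>x. x \<in> V \<Longrightarrow> q' x \<le> q (x + u) - q u"
proof
  define g where "g x t = q (x + t *\<^sub>R u) - t * q u" for x t
  define q' where "q' x = (INF t\<in>{0..}. g x t)" for x
  have low: "- q (- x) \<le> g x t" if "x \<in> V" "0 \<le> t" for x t
  proof -
    have "q ((x + t *\<^sub>R u) + - x) \<le> q (x + t *\<^sub>R u) + q (- x)"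
      by (intro sublinear_onD(1)[OF q] subspace_neg subspace_add subspace_scale V u that)
    then show ?thesis using sublinear_onD(2)[OF q u that(2)] by (simp add: g_def)
  qed
  have bdd: "bdd_below (g x ` {0..})" if "x \<in> V" for x
    using low[OF that] by (intro bdd_belowI2[where m = "- q (- x)"]) simp
  have le: "q' x \<le> g x t" if "x \<in> V" "0 \<le> t" for x t
    unfolding q'_def using bdd that by (intro cINF_lower) auto
  show "q' x \<le> q x" if "x \<in> V" for x using le[OF that, of 0] by (simp add: g_def)
  show "q' x \<le> q (x + u) - q u" if "x \<in> V" for x using le[OF that, of 1] by (simp add: g_def)
  show "sublinear_on V q'"
  proof (rule sublinear_onI[OF V])
    fix x y assume x: "x \<in> V" and y: "y \<in> V"
    have "q' (x + y) \<le> g x s + g y t" if "0 \<le> s" "0 \<le> t" for s t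
    proof -
      have "q' (x + y) \<le> g (x + y) (s + t)" using that x y V by (intro le subspace_add) auto
      also have "q ((x + s *\<^sub>R u) + (y + t *\<^sub>R u)) \<le> q (x + s *\<^sub>R u) + q (y + t *\<^sub>R u)"
        by (intro sublinear_onD(1)[OF q] subspace_add subspace_scale V u x y)
      then have "g (x + y) (s + t) \<le> g x s + g y t" by (simp add: g_def algebra_simps)
      finally show ?thesis .
    qed
    then have "q' (x + y) - g x s \<le> q' y" if "0 \<le> s" for s
      unfolding q'_def[of y] using that by (intro cINF_greatest) (auto simp: algebra_simps)
    then have "q' (x + y) - q' y \<le> q' x"
      unfolding q'_def[of x] by (intro cINF_greatest) (auto simp: algebra_simps)
    then show "q' (x + y) \<le> q' x + q' y" by simp
  next
    have "g 0 t = 0" if "0 \<le> t" for t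
      using sublinear_onD(2)[OF q u that] by (simp add: g_def)
    then have "q' 0 = (INF t\<in>{0::real..}. 0)" unfolding q'_def by (intro INF_cong) auto
    then show "q' 0 = 0" by simp
  next
    fix x and c :: real assume x: "x \<in> V" and c: "0 < c"
    have "q' (c *\<^sub>R x) / c \<le> g x t" if "0 \<le> t" for t
    proof -
      have "q' (c *\<^sub>R x) \<le> g (c *\<^sub>R x) (c * t)"
        using that x c V by (intro le subspace_scale) auto
      also have "\<dots> = c * g x t"
        using sublinear_onD(2)[OF q, of "x + t *\<^sub>R u" c] V x u c
        by (simp add: g_def algebra_simps subspace_add subspace_scale)
      finally show ?thesis using c by (simp add: field_simps)
    qed
    then have "q' (c *\<^sub>R x) / c \<le> q' x" unfolding q'_def[of x] by (intro cINF_greatest) auto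
    then show "q' (c *\<^sub>R x) \<le> c * q' x" using c by (simp add: field_simps)
  qed
qed

text \<open>
  First \<open>p\<close> is lowered so that its value at \<open>- u\<close> becomes at most \<open>- p u\<close>. A minimal sublinear functional
  below the result exists by Zorn's lemma, since the pointwise infimum of a chain of sublinear functionals
  is sublinear. It is linear by minimality, and its value at \<open>u\<close> is then forced to be \<open>p u\<close>.
\<close>

theorem Hahn_Banach_sublinear:
  assumes V: "subspace V" and p: "sublinear_on V p" and u: "u \<in> V"
  obtains \<phi> where "\<And>x y. x \<in> V \<Longrightarrow> y \<in> V \<Longrightarrow> \<phi> (x + y) = \<phi> x + \<phi> y"
    "\<And>c x. x \<in> V \<Longrightarrow> \<phi> (c *\<^sub>R x) = c * \<phi> x"
    "\<And>x. x \<in> V \<Longrightarrow> \<phi> x \<le> p x" "\<phi> u = p u"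
proof -
  obtain p' where p': "sublinear_on V p'" and p'_le: "\<And>x. x \<in> V \<Longrightarrow> p' x \<le> p x"
    and p'_u: "\<And>x. x \<in> V \<Longrightarrow> p' x \<le> p (x + u) - p u"
    using sublinear_on_improve[OF V p u] by metis
  define A where "A = {q. sublinear_on V q \<and> (\<forall>x\<in>V. q x \<le> p' x) \<and> (\<forall>x. x \<notin> V \<longrightarrow> q x = 0)}"
  define P where "P q r \<longleftrightarrow> (\<forall>x. r x \<le> q x)" for q r :: "'a \<Rightarrow> real"
  have restrict: "(\<lambda>x. if x \<in> V then q x else 0) \<in> A"
    if "sublinear_on V q" "\<And>x. x \<in> V \<Longrightarrow> q x \<le> p' x" for q
    using that V by (auto simp: A_def sublinear_on_def subspace_add subspace_scale)
  have "\<exists>m\<in>A. \<forall>a\<in>A. P m a \<longrightarrow> a = m"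
  proof (rule predicate_Zorn)
    show "partial_order_on A (relation_of P A)"
      unfolding partial_order_on_def preorder_on_def refl_on_def trans_def antisym_def relation_of_def P_def
      by (auto intro: order_trans intro!: ext antisym)
    fix C assume C: "C \<in> Chains (relation_of P A)"
    then have CA: "C \<subseteq> A" by (auto simp: Chains_def relation_of_def)
    have total: "P q r \<or> P r q" if "q \<in> C" "r \<in> C" for q r
      using C that by (auto simp: Chains_def relation_of_def)
    show "\<exists>u\<in>A. \<forall>a\<in>C. P a u"
    proof (cases "C = {}")
      case True
      then show ?thesis using restrict[OF p'] by auto
    next
      case False
      define q where "q x = (INF r\<in>C. r x)" for x
      have bdd: "bdd_below ((\<lambda>r. r x) ` C)" if x: "x \<in> V" for x
      proof (intro bdd_belowI2)
        fix r assume "r \<in> C"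
        then have r: "sublinear_on V r" "r (- x) \<le> p' (- x)"
          using CA x V by (auto simp: A_def subspace_neg)
        show "- p' (- x) \<le> r x" using sublinear_on_neg[OF V r(1) x] r(2) by simp
      qed
      have le: "q x \<le> r x" if "x \<in> V" "r \<in> C" for x r
        unfolding q_def using bdd that by (intro cINF_lower)
      have sub: "sublinear_on V q"
      proof (rule sublinear_onI[OF V])
        fix x y assume x: "x \<in> V" and y: "y \<in> V"
        have *: "q (x + y) \<le> r x + s y" if rs: "r \<in> C" "s \<in> C" for r s
        proof -
          obtain t where t: "t \<in> C" "t x \<le> r x" "t y \<le> s y"
            using total[OF rs] rs unfolding P_def by (metis order_refl)
          have "q (x + y) \<le> t (x + y)" using V x y t by (intro le subspace_add)
          also have "\<dots> \<le> t x + t y" using t CA x y by (auto simp: A_def sublinear_on_def)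
          finally show ?thesis using t by simp
        qed
        have "q (x + y) - r x \<le> q y" if "r \<in> C" for r
          unfolding q_def[of y] using False *[OF that] by (intro cINF_greatest) (force simp: diff_le_eq add.commute)+
        then have "q (x + y) - q y \<le> q x"
          unfolding q_def[of x] using False by (intro cINF_greatest) (auto simp: algebra_simps)
        then show "q (x + y) \<le> q x + q y" by simp
      next
        have hom: "r (c *\<^sub>R x) = c * r x" if "r \<in> C" "x \<in> V" "0 \<le> c" for r x c
          using that CA by (auto simp: A_def sublinear_on_def)
        have "q 0 = (INF r\<in>C. (0::real))"
          unfolding q_def using hom[OF _ subspace_0[OF V], of _ 0] by (intro INF_cong) auto
        then show "q 0 = 0" using False by simp
        fix x and c :: real assume x: "x \<in> V" and c: "0 < c"
        have "q (c *\<^sub>R x) / c \<le> r x" if "r \<in> C" for r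
          using le[OF subspace_scale[OF V x] that, of c] hom[OF that x, of c] c by (simp add: field_simps)
        then have "q (c *\<^sub>R x) / c \<le> q x" unfolding q_def[of x] using False by (intro cINF_greatest) auto
        then show "q (c *\<^sub>R x) \<le> c * q x" using c by (simp add: field_simps)
      qed
      have "q x \<le> p' x" if x: "x \<in> V" for x
      proof -
        obtain r where "r \<in> C" using False by auto
        then show ?thesis using le[OF x] CA x unfolding A_def by force
      qed
      then have "(\<lambda>x. if x \<in> V then q x else 0) \<in> A" using sub by (rule restrict[rotated])
      moreover have "P r (\<lambda>x. if x \<in> V then q x else 0)" if "r \<in> C" for r
        using le that CA by (auto simp: P_def A_def)
      ultimately show ?thesis by blast
    qed
  qed
  then obtain \<phi> where \<phi>: "\<phi> \<in> A" and min: "\<And>a. a \<in> A \<Longrightarrow> P \<phi> a \<Longrightarrow> a = \<phi>" by blast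
  have sub: "sublinear_on V \<phi>" and le: "\<And>x. x \<in> V \<Longrightarrow> \<phi> x \<le> p' x" using \<phi> by (auto simp: A_def)
  have super: "\<phi> x + \<phi> y \<le> \<phi> (x + y)" if x: "x \<in> V" and y: "y \<in> V" for x y
  proof -
    obtain q where q: "sublinear_on V q" "\<And>x. x \<in> V \<Longrightarrow> q x \<le> \<phi> x"
      "\<And>x. x \<in> V \<Longrightarrow> q x \<le> \<phi> (x + y) - \<phi> y"
      using sublinear_on_improve[OF V sub y] by metis
    have "(\<lambda>x. if x \<in> V then q x else 0) = \<phi>"
      using q \<phi> by (intro min restrict) (auto simp: P_def A_def intro: order_trans)
    then have "q x = \<phi> x" using x by (metis (mono_tags))
    then show ?thesis using q(3)[OF x] by simp
  qed
  have add: "\<phi> (x + y) = \<phi> x + \<phi> y" if "x \<in> V" "y \<in> V" for x y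
    using super[OF that] sublinear_onD(1)[OF sub that] by simp
  have neg: "\<phi> (- x) = - \<phi> x" if "x \<in> V" for x
    using add[OF that subspace_neg[OF V that]] sublinear_onD(2)[OF sub that, of 0] by simp
  have hom: "\<phi> (c *\<^sub>R x) = c * \<phi> x" if x: "x \<in> V" for c x
  proof (cases "0 \<le> c")
    case True
    then show ?thesis using sublinear_onD(2)[OF sub x] by simp
  next
    case False
    then have "\<phi> ((- c) *\<^sub>R x) = - c * \<phi> x" using sublinear_onD(2)[OF sub x, of "- c"] by simp
    then show ?thesis using neg[of "c *\<^sub>R x"] subspace_scale[OF V x] by simp
  qed
  have "\<phi> (- u) \<le> p (- u + u) - p u"
    using le[of "- u"] p'_u[of "- u"] subspace_neg[OF V u] by simp
  moreover have "p 0 = 0" using sublinear_onD(2)[OF p u, of 0] by simp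
  ultimately have "p u \<le> \<phi> u" using neg[OF u] by simp
  moreover have le_p: "\<phi> x \<le> p x" if "x \<in> V" for x using le[OF that] p'_le[OF that] by simp
  ultimately have "\<phi> u = p u" using u by (simp add: antisym)
  with add hom le_p show ?thesis using that by blast
qed

section \<open>Weakly unconditionally Cauchy series\<close>

lemma dualD:
  assumes "\<phi> \<in> vecs (dual X)"
  shows "\<And>x y. x \<in> vecs X \<Longrightarrow> y \<in> vecs X \<Longrightarrow> \<phi> (x + y) = \<phi> x + \<phi> y"
    and "\<And>c x. x \<in> vecs X \<Longrightarrow> \<phi> (c *\<^sub>R x) = c * \<phi> x"
    and "\<And>x. x \<notin> vecs X \<Longrightarrow> \<phi> x = 0"
    and "\<exists>C. \<forall>x\<in>vecs X. \<bar>\<phi> x\<bar> \<le> C * nrm X x"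
  using assms by (auto simp: dual_def bounded_linear_between_def real_nspace_def)

lemma dualI:
  assumes "\<And>x y. x \<in> vecs X \<Longrightarrow> y \<in> vecs X \<Longrightarrow> \<phi> (x + y) = \<phi> x + \<phi> y"
    and "\<And>c x. x \<in> vecs X \<Longrightarrow> \<phi> (c *\<^sub>R x) = c * \<phi> x"
    and "\<And>x. x \<notin> vecs X \<Longrightarrow> \<phi> x = 0"
    and "\<And>x. x \<in> vecs X \<Longrightarrow> \<bar>\<phi> x\<bar> \<le> C * nrm X x"
  shows "\<phi> \<in> vecs (dual X)"
  using assms(1-3) exI[of "\<lambda>C. \<forall>x\<in>vecs X. \<bar>\<phi> x\<bar> \<le> C * nrm X x" C] assms(4)
  by (auto simp: dual_def bounded_linear_between_def real_nspace_def)

lemma subspace_dual: "subspace (vecs (dual X))"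
proof (rule subspaceI)
  show "0 \<in> vecs (dual X)" by (rule dualI[where C = 0]) auto
next
  fix \<phi> \<psi> assume \<phi>: "\<phi> \<in> vecs (dual X)" and \<psi>: "\<psi> \<in> vecs (dual X)"
  obtain C D where C: "\<And>x. x \<in> vecs X \<Longrightarrow> \<bar>\<phi> x\<bar> \<le> C * nrm X x"
    and D: "\<And>x. x \<in> vecs X \<Longrightarrow> \<bar>\<psi> x\<bar> \<le> D * nrm X x"
    using dualD(4)[OF \<phi>] dualD(4)[OF \<psi>] by blast
  show "\<phi> + \<psi> \<in> vecs (dual X)"
  proof (rule dualI)
    fix x assume x: "x \<in> vecs X"
    show "\<bar>(\<phi> + \<psi>) x\<bar> \<le> (C + D) * nrm X x"
      using C[OF x] D[OF x] unfolding plus_fun_apply distrib_right by linarith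
  qed (simp_all add: dualD[OF \<phi>] dualD[OF \<psi>] algebra_simps)
next
  fix \<phi> and c :: real assume \<phi>: "\<phi> \<in> vecs (dual X)"
  obtain C where C: "\<And>x. x \<in> vecs X \<Longrightarrow> \<bar>\<phi> x\<bar> \<le> C * nrm X x"
    using dualD(4)[OF \<phi>] by blast
  show "c *\<^sub>R \<phi> \<in> vecs (dual X)"
  proof (rule dualI)
    fix x assume x: "x \<in> vecs X"
    show "\<bar>(c *\<^sub>R \<phi>) x\<bar> \<le> (\<bar>c\<bar> * C) * nrm X x"
      using mult_left_mono[OF C[OF x], of "\<bar>c\<bar>"] by (simp add: abs_mult mult.assoc)
  qed (simp_all add: dualD[OF \<phi>] algebra_simps)
qed

lemma dual_nrm_upper:
  assumes nonneg: "\<And>x. x \<in> vecs X \<Longrightarrow> 0 \<le> nrm X x"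
    and \<phi>: "\<phi> \<in> vecs (dual X)" and x: "x \<in> vecs X" "nrm X x \<le> 1"
  shows "\<bar>\<phi> x\<bar> \<le> nrm (dual X) \<phi>"
proof -
  obtain C where C: "\<And>x. x \<in> vecs X \<Longrightarrow> \<bar>\<phi> x\<bar> \<le> C * nrm X x"
    using dualD(4)[OF \<phi>] by blast
  have "\<bar>\<phi> v\<bar> \<le> \<bar>C\<bar> * 1" if "v \<in> vecs X" "nrm X v \<le> 1" for v
  proof -
    have "C * nrm X v \<le> \<bar>C\<bar> * 1" using nonneg[OF that(1)] that(2) by (intro mult_mono) auto
    then show ?thesis using C[OF that(1)] by linarith
  qed
  then have "bdd_above ((\<lambda>v. \<bar>\<phi> v\<bar>) ` {v \<in> vecs X. nrm X v \<le> 1})"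
    by (intro bdd_aboveI2[where M = "\<bar>C\<bar> * 1"]) blast
  then show ?thesis unfolding dual_def using x by (auto intro!: cSUP_upper)
qed

lemma dual_nrm_least:
  assumes "x\<^sub>0 \<in> vecs X" "nrm X x\<^sub>0 \<le> 1"
    and "\<And>x. x \<in> vecs X \<Longrightarrow> nrm X x \<le> 1 \<Longrightarrow> \<bar>\<phi> x\<bar> \<le> c"
  shows "nrm (dual X) \<phi> \<le> c"
  using assms unfolding dual_def by (auto intro!: cSUP_least)

lemma linear_on_sum:
  fixes y :: "nat \<Rightarrow> 'v::real_vector" and T :: "'v \<Rightarrow> 'w::real_vector"
  assumes V: "subspace V"
    and add: "\<And>x y. x \<in> V \<Longrightarrow> y \<in> V \<Longrightarrow> T (x + y) = T x + T y"
    and scale: "\<And>c x. x \<in> V \<Longrightarrow> T (c *\<^sub>R x) = c *\<^sub>R T x"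
    and y: "\<And>n. y n \<in> V"
  shows "T (\<Sum>n<N. s n *\<^sub>R y n) = (\<Sum>n<N. s n *\<^sub>R T (y n))"
proof (induction N)
  case 0
  show ?case using scale[OF subspace_0[OF V], of 0] by simp
next
  case (Suc N)
  have "(\<Sum>n<N. s n *\<^sub>R y n) \<in> V" by (intro subspace_sum subspace_scale V y)
  then show ?case using Suc by (simp add: add scale subspace_scale V y)
qed

lemma WUC_if_signed_sums_bounded:
  assumes V: "subspace (vecs Y)" and y: "\<And>n. y n \<in> vecs Y"
    and nonneg: "\<And>v. v \<in> vecs Y \<Longrightarrow> 0 \<le> nrm Y v"
    and bound: "\<And>N s. (\<And>n. \<bar>s n\<bar> \<le> 1) \<Longrightarrow> nrm Y (\<Sum>n<N. s n *\<^sub>R y n) \<le> C"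
  shows "WUC Y y"
  unfolding WUC_def
proof (intro conjI ballI)
  show "range y \<subseteq> vecs Y" using y by auto
  fix \<phi> assume \<phi>: "\<phi> \<in> vecs (dual Y)"
  obtain D where D: "\<And>x. x \<in> vecs Y \<Longrightarrow> \<bar>\<phi> x\<bar> \<le> D * nrm Y x" using dualD(4)[OF \<phi>] by blast
  show "summable (\<lambda>n. \<bar>\<phi> (y n)\<bar>)"
  proof (rule summableI_nonneg_bounded)
    fix N
    define s where "s n = sgn (\<phi> (y n))" for n
    have S: "(\<Sum>n<N. s n *\<^sub>R y n) \<in> vecs Y"
      by (intro subspace_sum[OF V] subspace_scale[OF V] y)
    have s_le: "\<bar>s n\<bar> \<le> 1" for n unfolding s_def sgn_if by simp
    have "(\<Sum>n<N. \<bar>\<phi> (y n)\<bar>) = (\<Sum>n<N. s n *\<^sub>R \<phi> (y n))"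
      by (intro sum.cong) (simp_all add: s_def sgn_if)
    also have "\<dots> = \<phi> (\<Sum>n<N. s n *\<^sub>R y n)"
      by (rule linear_on_sum[OF V, symmetric]) (simp_all add: dualD[OF \<phi>] y)
    also have "\<dots> \<le> D * nrm Y (\<Sum>n<N. s n *\<^sub>R y n)"
      using D[OF S] by linarith
    also have "\<dots> \<le> \<bar>D\<bar> * nrm Y (\<Sum>n<N. s n *\<^sub>R y n)"
      using nonneg[OF S] by (rule mult_right_mono[rotated]) simp
    also have "\<dots> \<le> \<bar>D\<bar> * C"
      by (intro mult_left_mono bound) (auto simp: s_def abs_sgn_eq)
    finally show "(\<Sum>n<N. \<bar>\<phi> (y n)\<bar>) \<le> \<bar>D\<bar> * C" .
  qed simp
qed

text \<open>
  A uniform boundedness principle, by the gliding hump argument of Sokal. If the seminorms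
  \<open>\<phi> \<mapsto> \<Sum>n<N. \<bar>\<phi> (y n)\<bar>\<close> were not uniformly bounded on \<open>P\<close>, a series \<open>\<Sum>j. \<plusminus> (1/3)^j * p j\<close> with suitable
  members \<open>p j\<close> of \<open>P\<close> and suitable signs would converge to a bounded functional at which they are not
  bounded, which contradicts that the series is weakly unconditionally Cauchy.
\<close>

lemma WUC_uniformly_bounded:
  assumes WUC: "WUC Y y" and P: "P \<subseteq> vecs (dual Y)"
    and contr: "\<And>p v. p \<in> P \<Longrightarrow> v \<in> vecs Y \<Longrightarrow> \<bar>p v\<bar> \<le> nrm Y v"
  shows "\<exists>C. \<forall>p\<in>P. \<forall>N. (\<Sum>n<N. \<bar>p (y n)\<bar>) \<le> C"
proof (rule ccontr)
  assume "\<not> ?thesis"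
  then have unb: "\<exists>p\<in>P. \<exists>N. C < (\<Sum>n<N. \<bar>p (y n)\<bar>)" for C
    by (meson not_le_imp_less)
  have y: "y n \<in> vecs Y" for n using WUC by (auto simp: WUC_def)
  define q where "q p N = (\<Sum>n<N. \<bar>p (y n)\<bar>)" for p :: "'a \<Rightarrow> real" and N
  have bdd: "bdd_above ((\<lambda>p. q p N) ` P)" for N
    by (intro bdd_aboveI2[where M = "\<Sum>n<N. nrm Y (y n)"])
      (auto simp: q_def intro!: sum_mono contr y)
  define Q where "Q N = (SUP p\<in>P. q p N)" for N
  have q_le: "q p N \<le> Q N" if "p \<in> P" for p N
    unfolding Q_def using bdd that by (intro cSUP_upper)
  have "\<exists>N p. p \<in> P \<and> 4 ^ j < Q N \<and> 2/3 * Q N < q p N" for j :: nat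
  proof -
    obtain p N where pN: "p \<in> P" "4 ^ j < q p N" using unb[of "4 ^ j"] unfolding q_def by blast
    have Q: "4 ^ j < Q N" using q_le[OF pN(1), of N] pN(2) by simp
    moreover have "(0::real) < 4 ^ j" by simp
    ultimately have "2/3 * Q N < Q N" by linarith
    then have "\<exists>p\<in>P. 2/3 * Q N < q p N"
      unfolding Q_def using less_cSUP_iff[OF _ bdd] pN(1) by blast
    then show ?thesis using Q by blast
  qed
  \<comment> \<open>Being within the factor \<open>2/3\<close> of the supremum makes the \<open>j\<close>-th summand outweigh all later ones, whose
    coefficients add up to half of its own.\<close>
  then obtain N p where p: "\<And>j. p j \<in> P" and Q: "\<And>j::nat. 4 ^ j < Q (N j)"
    and pQ: "\<And>j. 2/3 * Q (N j) < q (p j) (N j)"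
    by metis
  define c where "c j = (1/3::real) ^ j" for j :: nat
  have c_pos: "0 < c j" for j by (simp add: c_def)
  \<comment> \<open>The signs are chosen one after the other. For each of them one choice works, because the sum of a
    seminorm at \<open>g + v\<close> and at \<open>g - v\<close> is at least twice its value at \<open>v\<close>.\<close>
  define \<Phi> where "\<Phi> = rec_nat (\<lambda>v. 0) (\<lambda>j g. if c j * q (p j) (N j) \<le> q (\<lambda>v. g v + c j * p j v) (N j)
    then (\<lambda>v. g v + c j * p j v) else (\<lambda>v. g v - c j * p j v))"
  define s where "s j = (if c j * q (p j) (N j) \<le> q (\<lambda>v. \<Phi> j v + c j * p j v) (N j) then 1 else (-1::real))"
    for j
  have \<Phi>_Suc: "\<Phi> (Suc j) v = \<Phi> j v + s j * c j * p j v" for j v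
    by (simp add: \<Phi>_def s_def)
  have \<Phi>_sum: "\<Phi> j v = (\<Sum>i<j. s i * c i * p i v)" for j v
  proof (induction j)
    case 0
    show ?case by (simp add: \<Phi>_def)
  next
    case (Suc j)
    then show ?case by (simp add: \<Phi>_Suc)
  qed
  have s_abs: "\<bar>s j\<bar> = 1" for j by (simp add: s_def)
  have grow: "c j * q (p j) (N j) \<le> q (\<Phi> (Suc j)) (N j)" for j
  proof (cases "c j * q (p j) (N j) \<le> q (\<lambda>v. \<Phi> j v + c j * p j v) (N j)")
    case True
    then show ?thesis by (simp add: \<Phi>_Suc[abs_def] s_def)
  next
    case False
    have "2 * (c j * q (p j) (N j)) = (\<Sum>n<N j. \<bar>2 * c j * p j (y n)\<bar>)"
      using c_pos[of j] by (simp add: q_def sum_distrib_left abs_mult mult.assoc)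
    also have "\<dots> \<le> (\<Sum>n<N j. \<bar>\<Phi> j (y n) + c j * p j (y n)\<bar> + \<bar>\<Phi> j (y n) - c j * p j (y n)\<bar>)"
      by (intro sum_mono) linarith
    also have "\<dots> = q (\<lambda>v. \<Phi> j v + c j * p j v) (N j) + q (\<lambda>v. \<Phi> j v - c j * p j v) (N j)"
      by (simp add: q_def sum.distrib)
    finally show ?thesis using False by (simp add: \<Phi>_Suc[abs_def] s_def)
  qed
  have c_summable: "summable c" and c_suminf: "suminf c = 3/2"
    unfolding c_def[abs_def] by (simp_all add: suminf_geometric)
  have term_le: "\<bar>s i * c i * p i v\<bar> \<le> c i * nrm Y v" if "v \<in> vecs Y" for i v
    using contr[OF p that, of i] c_pos[of i] s_abs[of i] by (simp add: abs_mult)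
  have summ: "summable (\<lambda>i. s i * c i * p i v)" for v
  proof (cases "v \<in> vecs Y")
    case True
    show ?thesis
      by (rule summable_comparison_test'[where g = "\<lambda>i. c i * nrm Y v" and N = 0])
        (use term_le[OF True] c_summable in \<open>auto intro: summable_mult2\<close>)
  next
    case False
    then have "p i v = 0" for i using P p dualD(3) by blast
    then show ?thesis by simp
  qed
  define F where "F v = (\<Sum>i. s i * c i * p i v)" for v
  have pD: "p i \<in> vecs (dual Y)" for i using P p by blast
  have F: "F \<in> vecs (dual Y)"
  proof (rule dualI)
    fix v w assume v: "v \<in> vecs Y" and w: "w \<in> vecs Y"
    show "F (v + w) = F v + F w"
      unfolding F_def by (subst suminf_add[OF summ summ]) (simp add: dualD(1)[OF pD v w] algebra_simps)
  next
    fix r v assume v: "v \<in> vecs Y"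
    show "F (r *\<^sub>R v) = r * F v"
      unfolding F_def by (subst suminf_mult[OF summ, symmetric]) (simp add: dualD(2)[OF pD v] algebra_simps)
  next
    fix v assume "v \<notin> vecs Y"
    then show "F v = 0" unfolding F_def by (simp add: dualD(3)[OF pD])
  next
    fix v assume v: "v \<in> vecs Y"
    have "\<bar>F v\<bar> \<le> (\<Sum>i. c i * nrm Y v)"
      unfolding F_def real_norm_def[symmetric]
      by (rule norm_suminf_le) (use term_le[OF v] c_summable in \<open>auto intro: summable_mult2\<close>)
    also have "\<dots> = 3/2 * nrm Y v" using suminf_mult2[OF c_summable] c_suminf by simp
    finally show "\<bar>F v\<bar> \<le> 3/2 * nrm Y v" .
  qed
  have tail: "q (\<lambda>v. F v - \<Phi> (Suc j) v) (N j) \<le> c j / 2 * Q (N j)" for j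
  proof -
    have c_shift: "summable (\<lambda>i. c (i + Suc j))"
      using c_summable by (rule summable_ignore_initial_segment)
    have sc: "summable (\<lambda>i. c (i + Suc j) * \<bar>p (i + Suc j) (y n)\<bar>)" for n
      by (rule summable_comparison_test'[where g = "\<lambda>i. c (i + Suc j) * nrm Y (y n)" and N = 0])
        (use contr[OF p y] c_pos summable_mult2[OF c_shift] in
          \<open>simp_all add: abs_mult less_imp_le mult_left_mono\<close>)
    have "\<bar>F (y n) - \<Phi> (Suc j) (y n)\<bar> \<le> (\<Sum>i. c (i + Suc j) * \<bar>p (i + Suc j) (y n)\<bar>)" for n
    proof -
      have "F (y n) - \<Phi> (Suc j) (y n) = (\<Sum>i. s (i + Suc j) * c (i + Suc j) * p (i + Suc j) (y n))"
        unfolding F_def \<Phi>_sum using suminf_minus_initial_segment[OF summ, of "Suc j"] by simp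
      also have "\<bar>\<dots>\<bar> \<le> (\<Sum>i. c (i + Suc j) * \<bar>p (i + Suc j) (y n)\<bar>)"
        unfolding real_norm_def[symmetric]
        by (rule norm_suminf_le[OF _ sc[unfolded real_norm_def[symmetric]]])
          (use s_abs c_pos in \<open>simp add: abs_mult less_imp_le\<close>)
      finally show ?thesis .
    qed
    then have "q (\<lambda>v. F v - \<Phi> (Suc j) v) (N j)
        \<le> (\<Sum>n<N j. \<Sum>i. c (i + Suc j) * \<bar>p (i + Suc j) (y n)\<bar>)"
      unfolding q_def by (rule sum_mono)
    also have "\<dots> = (\<Sum>i. \<Sum>n<N j. c (i + Suc j) * \<bar>p (i + Suc j) (y n)\<bar>)"
      by (rule suminf_sum[symmetric]) (rule sc)
    also have "\<dots> \<le> (\<Sum>i. c (i + Suc j) * Q (N j))"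
    proof (rule suminf_le)
      show "summable (\<lambda>i. \<Sum>n<N j. c (i + Suc j) * \<bar>p (i + Suc j) (y n)\<bar>)"
        by (rule summable_sum) (rule sc)
      show "summable (\<lambda>i. c (i + Suc j) * Q (N j))"
        using c_shift by (rule summable_mult2)
      show "(\<Sum>n<N j. c (i + Suc j) * \<bar>p (i + Suc j) (y n)\<bar>) \<le> c (i + Suc j) * Q (N j)" for i
        using q_le[OF p, of "i + Suc j" "N j"] c_pos[of "i + Suc j"]
        by (simp add: q_def sum_distrib_left[symmetric])
    qed
    also have "\<dots> = (\<Sum>i. c (Suc j) * (Q (N j) * c i))"
      by (intro suminf_cong) (simp add: c_def power_add)
    also have "\<dots> = c (Suc j) * (Q (N j) * (3/2))"
      using c_suminf c_summable by (simp add: suminf_mult summable_mult)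
    also have "\<dots> = c j / 2 * Q (N j)" by (simp add: c_def)
    finally show ?thesis .
  qed
  define B where "B = (\<Sum>n. \<bar>F (y n)\<bar>)"
  have B_ge: "(4/3) ^ j / 6 \<le> B" for j
  proof -
    have "c j * (2/3 * Q (N j)) \<le> c j * q (p j) (N j)"
      using pQ[of j] c_pos[of j] by simp
    also have "\<dots> \<le> q (\<Phi> (Suc j)) (N j)" by (rule grow)
    also have "\<dots> \<le> (\<Sum>n<N j. \<bar>F (y n)\<bar> + \<bar>F (y n) - \<Phi> (Suc j) (y n)\<bar>)"
      unfolding q_def by (intro sum_mono) linarith
    also have "\<dots> = q F (N j) + q (\<lambda>v. F v - \<Phi> (Suc j) v) (N j)"
      by (simp add: q_def sum.distrib)
    also have "\<dots> \<le> B + c j / 2 * Q (N j)"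
      using WUC F tail[of j] unfolding WUC_def q_def B_def
      by (intro add_mono sum_le_suminf) auto
    finally have "c j * Q (N j) / 6 \<le> B" by (simp add: algebra_simps)
    moreover have "c j * 4 ^ j \<le> c j * Q (N j)" using Q[of j] c_pos[of j] by simp
    moreover have "c j * 4 ^ j = (4/3) ^ j" by (simp add: c_def power_divide)
    ultimately show ?thesis by simp
  qed
  obtain j where "6 * B < (4/3) ^ j" using real_arch_pow[of "4/3" "6 * B"] by auto
  then show False using B_ge[of j] by simp
qed

section \<open>Lipschitz functions and the elements of free spaces\<close>

text \<open>
  The constant is carried along because every estimate below is of the form \<open>e * L\<close>; this avoids the norm of
  \<open>Lip0\<close>, which is an infimum.
\<close>

definition lip_fn :: "'a::metric_space \<Rightarrow> 'a set \<Rightarrow> real \<Rightarrow> ('a \<Rightarrow> real) \<Rightarrow> bool"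
  where "lip_fn z N L f \<longleftrightarrow> L-lipschitz_on N f \<and> f z = 0 \<and> (\<forall>x. x \<notin> N \<longrightarrow> f x = 0)"

lemma vecs_Lip0: "f \<in> vecs (Lip0 z N) \<longleftrightarrow> (\<exists>L. lip_fn z N L f)"
  by (auto simp: Lip0_def lip_fn_def)

lemma lip_fnI:
  assumes "0 \<le> L" "\<And>x y. x \<in> N \<Longrightarrow> y \<in> N \<Longrightarrow> \<bar>f x - f y\<bar> \<le> L * dist x y"
    "f z = 0" "\<And>x. x \<notin> N \<Longrightarrow> f x = 0"
  shows "lip_fn z N L f"
  using assms by (auto simp: lip_fn_def dist_real_def intro: lipschitz_onI)

lemma lip_fnD:
  assumes "lip_fn z N L f"
  shows "0 \<le> L" "\<And>x y. x \<in> N \<Longrightarrow> y \<in> N \<Longrightarrow> \<bar>f x - f y\<bar> \<le> L * dist x y"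
    "f z = 0" "\<And>x. x \<notin> N \<Longrightarrow> f x = 0" "f \<in> vecs (Lip0 z N)"
  using assms vecs_Lip0
  by (auto simp: lip_fn_def dist_real_def[symmetric] dest: lipschitz_onD lipschitz_on_nonneg)

lemma lip_fn_mono: "lip_fn z N L f \<Longrightarrow> L \<le> L' \<Longrightarrow> lip_fn z N L' f"
  by (auto simp: lip_fn_def intro: lipschitz_on_mono)

lemma lip_fn_bound:
  assumes "lip_fn z N L f" "z \<in> N"
  shows "\<bar>f x\<bar> \<le> L * dist x z"
  using lip_fnD[OF assms(1)] assms(2) by (cases "x \<in> N") (fastforce intro: mult_nonneg_nonneg)+

lemma lip_fn_add:
  assumes f: "lip_fn z N L f" and g: "lip_fn z N L' g"
  shows "lip_fn z N (L + L') (f + g)"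
proof (rule lip_fnI)
  fix x y assume xy: "x \<in> N" "y \<in> N"
  show "\<bar>(f + g) x - (f + g) y\<bar> \<le> (L + L') * dist x y"
    using lip_fnD(2)[OF f xy] lip_fnD(2)[OF g xy] unfolding plus_fun_apply distrib_right by linarith
qed (use lip_fnD[OF f] lip_fnD[OF g] in auto)

lemma lip_fn_scale:
  assumes f: "lip_fn z N L f"
  shows "lip_fn z N (\<bar>c\<bar> * L) (c *\<^sub>R f)"
proof (rule lip_fnI)
  fix x y assume xy: "x \<in> N" "y \<in> N"
  have "\<bar>(c *\<^sub>R f) x - (c *\<^sub>R f) y\<bar> = \<bar>c\<bar> * \<bar>f x - f y\<bar>"
    by (simp add: abs_mult[symmetric] algebra_simps)
  then show "\<bar>(c *\<^sub>R f) x - (c *\<^sub>R f) y\<bar> \<le> \<bar>c\<bar> * L * dist x y"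
    using mult_left_mono[OF lip_fnD(2)[OF f xy], of "\<bar>c\<bar>"] by (simp add: mult.assoc)
qed (use lip_fnD[OF f] in auto)

lemma lip_fn_zero: "lip_fn z N 0 0"
  by (rule lip_fnI) auto

lemma lip_fn_diff:
  assumes f: "lip_fn z N L f" and g: "lip_fn z N L' g"
  shows "lip_fn z N (L + L') (f - g)"
  using lip_fn_add[OF f lip_fn_scale[OF g, of "-1"]] by simp

lemma lip_fn_zero_off:
  assumes "lip_fn z N L f" "K \<subseteq> N"
  shows "lip_fn z K L (zero_off K f)"
  by (rule lip_fnI) (use lip_fnD[OF assms(1)] assms(2) in \<open>auto simp: zero_off_def\<close>)

lemma subspace_Lip0: "subspace (vecs (Lip0 z N))"
  using lip_fn_add lip_fn_scale lip_fn_zero unfolding subspace_def Ball_def vecs_Lip0 by blast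

lemma nrm_Lip0_le: "lip_fn z N L f \<Longrightarrow> nrm (Lip0 z N) f \<le> L"
  unfolding Lip0_def lip_fn_def
  by (auto intro!: cInf_lower bdd_belowI[where m = 0] dest: lipschitz_on_nonneg)

lemma lip_fn_nrm:
  assumes "f \<in> vecs (Lip0 z N)"
  shows "lip_fn z N (nrm (Lip0 z N) f) f"
proof -
  obtain L where L: "lip_fn z N L f" using assms vecs_Lip0 by blast
  define A where "A = {L. L-lipschitz_on N f}"
  have A: "A \<noteq> {}" using L by (auto simp: A_def lip_fn_def)
  have nrm: "nrm (Lip0 z N) f = Inf A" by (simp add: Lip0_def A_def)
  show ?thesis unfolding nrm
  proof (rule lip_fnI)
    show "0 \<le> Inf A" using A by (intro cInf_greatest) (auto simp: A_def dest: lipschitz_on_nonneg)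
    fix x y assume xy: "x \<in> N" "y \<in> N"
    show "\<bar>f x - f y\<bar> \<le> Inf A * dist x y"
    proof (cases "x = y")
      case False
      have "\<bar>f x - f y\<bar> / dist x y \<le> Inf A"
        using A False xy lipschitz_onD[of _ N f x y]
        by (intro cInf_greatest) (auto simp: A_def field_simps dist_real_def)
      then show ?thesis using False by (simp add: field_simps)
    qed simp
  qed (use lip_fnD[OF L] in auto)
qed

lemma nrm_Lip0_nonneg: "f \<in> vecs (Lip0 z N) \<Longrightarrow> 0 \<le> nrm (Lip0 z N) f"
  using lip_fnD(1)[OF lip_fn_nrm] .

lemma McShane_extension:
  assumes f: "lip_fn z N L f" and z: "z \<in> N"
  obtains g where "lip_fn z UNIV L g" "\<And>x. x \<in> N \<Longrightarrow> g x = f x"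
proof
  define g where "g x = (INF y\<in>N. f y + L * dist x y)" for x
  have L: "0 \<le> L" using lip_fnD(1)[OF f] .
  have low: "f z - L * dist x z \<le> f y + L * dist x y" if "y \<in> N" for x y
  proof -
    have "f z - f y \<le> L * dist z y" using lip_fnD(2)[OF f z that] by linarith
    also have "\<dots> \<le> L * (dist x z + dist x y)"
      using L by (intro mult_left_mono) (metis dist_commute dist_triangle2)
    finally show ?thesis by (simp add: algebra_simps)
  qed
  have bdd: "bdd_below ((\<lambda>y. f y + L * dist x y) ` N)" for x
    using low by (intro bdd_belowI2)
  have le: "g x \<le> f y + L * dist x y" if "y \<in> N" for x y
    unfolding g_def using bdd that by (intro cINF_lower)
  show g_eq: "g x = f x" if x: "x \<in> N" for x
  proof (rule antisym)
    show "g x \<le> f x" using le[OF x, of x] by simp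
    have "f x \<le> f y + L * dist x y" if "y \<in> N" for y
      using lip_fnD(2)[OF f x that] by linarith
    then show "f x \<le> g x" unfolding g_def using z by (intro cINF_greatest) auto
  qed
  have one: "g x - g y \<le> L * dist x y" for x y
  proof -
    have "g x - L * dist x y \<le> f w + L * dist y w" if "w \<in> N" for w
    proof -
      have "L * dist x w \<le> L * (dist x y + dist y w)"
        using L by (intro mult_left_mono dist_triangle)
      then show ?thesis using le[OF that, of x] by (simp add: algebra_simps)
    qed
    then have "g x - L * dist x y \<le> g y" unfolding g_def[of y] using z by (intro cINF_greatest) auto
    then show ?thesis by simp
  qed
  show "lip_fn z UNIV L g"
  proof (rule lip_fnI)
    show "\<bar>g x - g y\<bar> \<le> L * dist x y" for x y
      using one[of x y] one[of y x] by (simp add: dist_commute abs_le_iff)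
  qed (use L g_eq[OF z] lip_fnD(3)[OF f] in auto)
qed

text \<open>
  Finitely supported elements of the free space. A list of weighted points may mention a point repeatedly, so
  that sums and images of such elements are given by list operations.
\<close>

definition atoms :: "'a::metric_space \<Rightarrow> 'a set \<Rightarrow> ('a \<times> real) list \<Rightarrow> ('a \<Rightarrow> real) \<Rightarrow> real"
  where "atoms z N l = (\<lambda>f. if f \<in> vecs (Lip0 z N) then \<Sum>(x, a)\<leftarrow>l. a * f x else 0)"

lemma span_evaluation: "span (evaluation z N ` S) = {atoms z N l |l. fst ` set l \<subseteq> S}"
proof (intro set_eqI iffI)
  fix \<mu> assume "\<mu> \<in> span (evaluation z N ` S)"
  then show "\<mu> \<in> {atoms z N l |l. fst ` set l \<subseteq> S}"
  proof (induction rule: span_induct_alt)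
    case base
    have "0 = atoms z N []" by (simp add: atoms_def fun_eq_iff)
    then show ?case by (intro CollectI exI[of _ "[]"]) simp
  next
    case (step c u v)
    then obtain x l where "x \<in> S" "u = evaluation z N x" "v = atoms z N l" "fst ` set l \<subseteq> S" by auto
    then have "c *\<^sub>R u + v = atoms z N ((x, c) # l)" "fst ` set ((x, c) # l) \<subseteq> S"
      by (auto simp: atoms_def evaluation_def fun_eq_iff)
    then show ?case by blast
  qed
next
  have "fst ` set l \<subseteq> S \<Longrightarrow> atoms z N l \<in> span (evaluation z N ` S)" for l
  proof (induction l)
    case Nil
    have "atoms z N [] = 0" by (simp add: atoms_def fun_eq_iff)
    then show ?case by (simp only: span_zero)
  next
    case (Cons p l)
    obtain x c where p: "p = (x, c)" by (cases p)
    have l: "atoms z N l \<in> span (evaluation z N ` S)" and x: "evaluation z N x \<in> evaluation z N ` S"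
      using Cons p by auto
    have eq: "atoms z N (p # l) = c *\<^sub>R evaluation z N x + atoms z N l"
      by (auto simp: atoms_def evaluation_def fun_eq_iff p)
    show ?case unfolding eq by (intro span_add span_scale l span_base x)
  qed
  then show "\<mu> \<in> {atoms z N l |l. fst ` set l \<subseteq> S} \<Longrightarrow> \<mu> \<in> span (evaluation z N ` S)" for \<mu> by auto
qed

lemma atoms_bound:
  assumes z: "z \<in> N"
  obtains C where "0 \<le> C" "\<And>L f. lip_fn z N L f \<Longrightarrow> \<bar>atoms z N l f\<bar> \<le> C * L"
proof
  define C where "C = (\<Sum>(x, a)\<leftarrow>l. \<bar>a\<bar> * dist x z)"
  show "0 \<le> C" unfolding C_def by (intro sum_list_nonneg) auto
  fix L f assume f: "lip_fn z N L f"
  have "\<bar>\<Sum>(x, a)\<leftarrow>l. a * f x\<bar> \<le> C * L" unfolding C_def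
  proof (induction l)
    case (Cons p l)
    have "\<bar>a * f x\<bar> \<le> \<bar>a\<bar> * dist x z * L" for a x
      using mult_left_mono[OF lip_fn_bound[OF f z, of x], of "\<bar>a\<bar>"] by (simp add: abs_mult algebra_simps)
    then have "\<bar>snd p * f (fst p)\<bar> \<le> \<bar>snd p\<bar> * dist (fst p) z * L" .
    then show ?case using Cons by (simp add: case_prod_beta distrib_right)
  qed simp
  then show "\<bar>atoms z N l f\<bar> \<le> C * L" using lip_fnD(5)[OF f] by (simp add: atoms_def)
qed

lemma atoms_add:
  assumes "f \<in> vecs (Lip0 z N)" "g \<in> vecs (Lip0 z N)"
  shows "atoms z N l (f + g) = atoms z N l f + atoms z N l g"
  using assms subspace_add[OF subspace_Lip0 assms]
  by (simp add: atoms_def) (induction l, auto simp: algebra_simps)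

lemma atoms_scale:
  assumes "f \<in> vecs (Lip0 z N)"
  shows "atoms z N l (c *\<^sub>R f) = c * atoms z N l f"
  using assms subspace_scale[OF subspace_Lip0 assms]
  by (simp add: atoms_def) (induction l, auto simp: algebra_simps)

lemma sum_list_weights_cong:
  fixes f g :: "'a \<Rightarrow> real"
  assumes "\<And>x. x \<in> fst ` set l \<Longrightarrow> f x = g x"
  shows "(\<Sum>(x, a)\<leftarrow>l. a * f x) = (\<Sum>(x, a)\<leftarrow>l. a * g x)"
  using assms by (induction l) auto

lemma atoms_cong:
  assumes "f \<in> vecs (Lip0 z N)" "g \<in> vecs (Lip0 z N)" "\<And>x. x \<in> fst ` set l \<Longrightarrow> f x = g x"
  shows "atoms z N l f = atoms z N l g"
  using sum_list_weights_cong[of l f g] assms by (simp add: atoms_def)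

lemma dual_Lip0_le:
  assumes m: "m \<in> vecs (dual (Lip0 z N))" and f: "lip_fn z N L f"
  shows "\<bar>m f\<bar> \<le> nrm (dual (Lip0 z N)) m * L"
proof -
  obtain C where C: "\<And>f. f \<in> vecs (Lip0 z N) \<Longrightarrow> \<bar>m f\<bar> \<le> C * nrm (Lip0 z N) f"
    using dualD(4)[OF m] by blast
  have C': "\<bar>m f\<bar> \<le> \<bar>C\<bar> * L" if f: "lip_fn z N L f" for L f
  proof -
    have "C * nrm (Lip0 z N) f \<le> \<bar>C\<bar> * L"
      using nrm_Lip0_le[OF f] nrm_Lip0_nonneg[OF lip_fnD(5)[OF f]] by (intro mult_mono) auto
    then show ?thesis using C[OF lip_fnD(5)[OF f]] by linarith
  qed
  have up: "\<bar>m g\<bar> \<le> nrm (dual (Lip0 z N)) m" if g: "lip_fn z N 1 g" for g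
    using nrm_Lip0_nonneg m lip_fnD(5)[OF g] nrm_Lip0_le[OF g] by (rule dual_nrm_upper)
  show ?thesis
  proof (cases "L = 0")
    case True
    then show ?thesis using C'[OF f] by simp
  next
    case False
    then have L: "0 < L" using lip_fnD(1)[OF f] by simp
    have "lip_fn z N 1 ((1/L) *\<^sub>R f)" using lip_fn_scale[OF f, of "1/L"] L by simp
    from up[OF this] have "\<bar>m f\<bar> / L \<le> nrm (dual (Lip0 z N)) m"
      using dualD(2)[OF m lip_fnD(5)[OF f], of "1/L"] L by (simp add: abs_mult)
    then show ?thesis using L by (simp add: field_simps)
  qed
qed

lemma dual_Lip0_nrm_le:
  assumes "\<And>f. lip_fn z N 1 f \<Longrightarrow> \<bar>m f\<bar> \<le> c"
  shows "nrm (dual (Lip0 z N)) m \<le> c"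
proof -
  have zero: "lip_fn z N 1 0" by (rule lip_fn_mono[OF lip_fn_zero]) simp
  show ?thesis
    using lip_fnD(5)[OF zero] nrm_Lip0_le[OF zero]
    by (rule dual_nrm_least) (blast intro: assms lip_fn_mono lip_fn_nrm)
qed

lemma dual_Lip0_nrm_nonneg:
  assumes "m \<in> vecs (dual (Lip0 z N))"
  shows "0 \<le> nrm (dual (Lip0 z N)) m"
  using dual_Lip0_le[OF assms lip_fn_mono[OF lip_fn_zero, of 1]] by simp

lemma atoms_dual: "z \<in> N \<Longrightarrow> atoms z N l \<in> vecs (dual (Lip0 z N))"
proof -
  assume z: "z \<in> N"
  obtain C where C: "\<And>L f. lip_fn z N L f \<Longrightarrow> \<bar>atoms z N l f\<bar> \<le> C * L"
    using atoms_bound[OF z] by metis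
  show ?thesis
    by (rule dualI[where C = C]) (auto simp: atoms_add atoms_scale intro: C lip_fn_nrm, simp add: atoms_def)
qed

text \<open>
  A function that is approximated by bounded linear functionals, uniformly on bounded sets, is itself linear and
  bounded. With membership in this form, it is evident that norm limits stay in the free space.
\<close>

lemma free_space_iff:
  assumes z: "z \<in> N"
  shows "m \<in> vecs (free_space z N) \<longleftrightarrow> (\<forall>f. f \<notin> vecs (Lip0 z N) \<longrightarrow> m f = 0) \<and>
    (\<forall>e>0. \<exists>l. fst ` set l \<subseteq> N \<and> (\<forall>L f. lip_fn z N L f \<longrightarrow> \<bar>m f - atoms z N l f\<bar> \<le> e * L))"
    (is "?l \<longleftrightarrow> ?off \<and> ?app")
proof
  assume ?l
  then have m: "m \<in> vecs (dual (Lip0 z N))"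
    and app: "\<And>e. 0 < e \<Longrightarrow> \<exists>y\<in>span (evaluation z N ` N). nrm (dual (Lip0 z N)) (m - y) < e"
    by (auto simp: free_space_def norm_closure_def)
  have ?app
  proof (intro allI impI)
    fix e :: real assume "0 < e"
    then obtain l where l: "fst ` set l \<subseteq> N" "nrm (dual (Lip0 z N)) (m - atoms z N l) < e"
      using app unfolding span_evaluation by blast
    have d: "m - atoms z N l \<in> vecs (dual (Lip0 z N))"
      by (intro subspace_diff[OF subspace_dual] m atoms_dual z)
    have "\<bar>m f - atoms z N l f\<bar> \<le> e * L" if f: "lip_fn z N L f" for L f
    proof -
      have "\<bar>m f - atoms z N l f\<bar> \<le> nrm (dual (Lip0 z N)) (m - atoms z N l) * L"
        using dual_Lip0_le[OF d f] by simp
      also have "\<dots> \<le> e * L" using l lip_fnD(1)[OF f] by (intro mult_right_mono) auto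
      finally show ?thesis .
    qed
    with l show "\<exists>l. fst ` set l \<subseteq> N \<and> (\<forall>L f. lip_fn z N L f \<longrightarrow> \<bar>m f - atoms z N l f\<bar> \<le> e * L)"
      by blast
  qed
  then show "?off \<and> ?app" using dualD(3)[OF m] by blast
next
  assume R: "?off \<and> ?app"
  have zero: "t = 0" if "\<And>e. 0 < e \<Longrightarrow> \<bar>t\<bar> \<le> e * K" for t K :: real
  proof (rule ccontr)
    assume "t \<noteq> 0"
    then have "\<bar>t\<bar> \<le> \<bar>t\<bar> / (2 * (\<bar>K\<bar> + 1)) * K" by (intro that) auto
    also have "\<dots> \<le> \<bar>t\<bar> / (2 * (\<bar>K\<bar> + 1)) * (\<bar>K\<bar> + 1)" by (intro mult_left_mono) auto
    also have "\<dots> = \<bar>t\<bar> / 2" by (simp add: field_simps)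
    finally show False using \<open>t \<noteq> 0\<close> by simp
  qed
  have m: "m \<in> vecs (dual (Lip0 z N))"
  proof -
    obtain l where l: "\<And>L f. lip_fn z N L f \<Longrightarrow> \<bar>m f - atoms z N l f\<bar> \<le> 1 * L"
      using R zero_less_one by blast
    obtain C where C: "\<And>L f. lip_fn z N L f \<Longrightarrow> \<bar>atoms z N l f\<bar> \<le> C * L"
      using atoms_bound[OF z] by metis
    show ?thesis
    proof (rule dualI)
      fix f assume f: "f \<in> vecs (Lip0 z N)"
      show "\<bar>m f\<bar> \<le> (1 + C) * nrm (Lip0 z N) f"
        using l[OF lip_fn_nrm[OF f]] C[OF lip_fn_nrm[OF f]] by (simp add: distrib_right)
    next
      fix f g assume fg: "f \<in> vecs (Lip0 z N)" "g \<in> vecs (Lip0 z N)"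
      obtain L L' where L: "lip_fn z N L f" and L': "lip_fn z N L' g" using fg vecs_Lip0 by metis
      have "m (f + g) - m f - m g = 0"
      proof (rule zero)
        fix e :: real assume "0 < e"
        then obtain l where l: "\<And>L f. lip_fn z N L f \<Longrightarrow> \<bar>m f - atoms z N l f\<bar> \<le> e * L"
          using R by blast
        show "\<bar>m (f + g) - m f - m g\<bar> \<le> e * (2 * (L + L'))"
          using l[OF L] l[OF L'] l[OF lip_fn_add[OF L L']] atoms_add[OF fg, of l]
          by (simp add: algebra_simps)
      qed
      then show "m (f + g) = m f + m g" by simp
    next
      fix f c assume f: "f \<in> vecs (Lip0 z N)"
      obtain L where L: "lip_fn z N L f" using f vecs_Lip0 by metis
      have "m (c *\<^sub>R f) - c * m f = 0"
      proof (rule zero)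
        fix e :: real assume "0 < e"
        then obtain l where l: "\<And>L f. lip_fn z N L f \<Longrightarrow> \<bar>m f - atoms z N l f\<bar> \<le> e * L"
          using R by blast
        have "\<bar>c * m f - c * atoms z N l f\<bar> \<le> \<bar>c\<bar> * (e * L)"
          using mult_left_mono[OF l[OF L], of "\<bar>c\<bar>"] by (simp add: abs_mult[symmetric] algebra_simps)
        then show "\<bar>m (c *\<^sub>R f) - c * m f\<bar> \<le> e * (2 * (\<bar>c\<bar> * L))"
          using l[OF lip_fn_scale[OF L, of c]] atoms_scale[OF f, of l c] by (simp add: algebra_simps)
      qed
      then show "m (c *\<^sub>R f) = c * m f" by simp
    qed (use R in blast)
  qed
  moreover have "\<exists>y\<in>span (evaluation z N ` N). nrm (dual (Lip0 z N)) (m - y) < e" if e: "0 < e" for e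
  proof -
    obtain l where l: "fst ` set l \<subseteq> N" "\<And>L f. lip_fn z N L f \<Longrightarrow> \<bar>m f - atoms z N l f\<bar> \<le> e/2 * L"
      using R half_gt_zero[OF e] by blast
    have "nrm (dual (Lip0 z N)) (m - atoms z N l) \<le> e/2"
      by (rule dual_Lip0_nrm_le) (use l(2) in fastforce)
    moreover have "atoms z N l \<in> span (evaluation z N ` N)" using l(1) unfolding span_evaluation by blast
    ultimately show ?thesis using e by (intro bexI[of _ "atoms z N l"]) auto
  qed
  ultimately show ?l by (auto simp: free_space_def norm_closure_def)
qed

section \<open>Dual and weak topology of a free space\<close>

lemma atoms_append: "atoms z N (l @ l') = atoms z N l + atoms z N l'"
  by (simp add: atoms_def fun_eq_iff)

lemma sum_list_map_weights:
  fixes h :: "'a \<Rightarrow> real"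
  shows "(\<Sum>(x, a)\<leftarrow>map (\<lambda>(x, a). (x, h x * a)) l. a * f x) = (\<Sum>(x, a)\<leftarrow>l. a * (h x * f x))"
  by (induction l) (auto simp: algebra_simps)

lemma free_space_sub_dual: "m \<in> vecs (free_space z N) \<Longrightarrow> m \<in> vecs (dual (Lip0 z N))"
  by (simp add: free_space_def norm_closure_def)

lemmas free_add = dualD(1)[OF free_space_sub_dual]
lemmas free_scale = dualD(2)[OF free_space_sub_dual]

lemma free_diff:
  assumes "m \<in> vecs (free_space z N)" "f \<in> vecs (Lip0 z N)" "g \<in> vecs (Lip0 z N)"
  shows "m (f - g) = m f - m g"
  using free_add[OF assms(1,2) subspace_scale[OF subspace_Lip0 assms(3), of "-1"]]
    free_scale[OF assms(1,3), of "-1"] by simp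

lemma free_zero: "m \<in> vecs (free_space z N) \<Longrightarrow> m 0 = 0"
  using free_scale[OF _ subspace_0[OF subspace_Lip0], of m z N 0] by simp

lemma free_le:
  assumes "m \<in> vecs (free_space z N)" "lip_fn z N L f"
  shows "\<bar>m f\<bar> \<le> nrm (free_space z N) m * L"
  using dual_Lip0_le[OF free_space_sub_dual[OF assms(1)] assms(2)] by (simp add: free_space_def)

lemma free_nrm_nonneg: "m \<in> vecs (free_space z N) \<Longrightarrow> 0 \<le> nrm (free_space z N) m"
  using dual_Lip0_nrm_nonneg[OF free_space_sub_dual] by (simp add: free_space_def)

lemma free_nrm_le:
  assumes "\<And>f. lip_fn z N 1 f \<Longrightarrow> \<bar>m f\<bar> \<le> c"
  shows "nrm (free_space z N) m \<le> c"
  using dual_Lip0_nrm_le[OF assms] by (simp add: free_space_def)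

lemma free_approx:
  assumes "z \<in> N" "m \<in> vecs (free_space z N)" "0 < e"
  obtains l where "fst ` set l \<subseteq> N" "\<And>L f. lip_fn z N L f \<Longrightarrow> \<bar>m f - atoms z N l f\<bar> \<le> e * L"
  using assms free_space_iff[OF assms(1), of m] by blast

lemma atoms_free:
  assumes z: "z \<in> N" and "fst ` set l \<subseteq> N"
  shows "atoms z N l \<in> vecs (free_space z N)"
proof -
  have "\<exists>l'. fst ` set l' \<subseteq> N \<and> (\<forall>L f. lip_fn z N L f \<longrightarrow> \<bar>atoms z N l f - atoms z N l' f\<bar> \<le> e * L)"
    if "0 < e" for e
    using assms that by (intro exI[of _ l]) (auto dest: lip_fnD(1))
  moreover have "\<forall>f. f \<notin> vecs (Lip0 z N) \<longrightarrow> atoms z N l f = 0" by (simp add: atoms_def)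
  ultimately show ?thesis unfolding free_space_iff[OF z] by blast
qed

lemma subspace_free_space:
  assumes z: "z \<in> N"
  shows "subspace (vecs (free_space z N))"
proof (rule subspaceI)
  have "atoms z N [] = 0" by (simp add: atoms_def fun_eq_iff)
  then show "0 \<in> vecs (free_space z N)" using atoms_free[OF z, of "[]"] by (simp only: list.set) simp
next
  fix m m' assume m: "m \<in> vecs (free_space z N)" and m': "m' \<in> vecs (free_space z N)"
  have "\<exists>l. fst ` set l \<subseteq> N \<and> (\<forall>L f. lip_fn z N L f \<longrightarrow> \<bar>(m + m') f - atoms z N l f\<bar> \<le> e * L)"
    if e: "0 < e" for e
  proof -
    obtain l where l: "fst ` set l \<subseteq> N" "\<And>L f. lip_fn z N L f \<Longrightarrow> \<bar>m f - atoms z N l f\<bar> \<le> e/2 * L"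
      using free_approx[OF z m half_gt_zero[OF e]] by blast
    obtain l' where l': "fst ` set l' \<subseteq> N" "\<And>L f. lip_fn z N L f \<Longrightarrow> \<bar>m' f - atoms z N l' f\<bar> \<le> e/2 * L"
      using free_approx[OF z m' half_gt_zero[OF e]] by blast
    have "\<bar>(m + m') f - atoms z N (l @ l') f\<bar> \<le> e * L" if "lip_fn z N L f" for L f
      using l(2)[OF that] l'(2)[OF that] unfolding atoms_append plus_fun_apply by linarith
    then show ?thesis using l(1) l'(1) by (intro exI[of _ "l @ l'"]) auto
  qed
  moreover have "\<forall>f. f \<notin> vecs (Lip0 z N) \<longrightarrow> (m + m') f = 0"
    using dualD(3)[OF free_space_sub_dual[OF m]] dualD(3)[OF free_space_sub_dual[OF m']] by simp
  ultimately show "m + m' \<in> vecs (free_space z N)" unfolding free_space_iff[OF z] by blast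
next
  fix m and c :: real assume m: "m \<in> vecs (free_space z N)"
  have "\<exists>l. fst ` set l \<subseteq> N \<and> (\<forall>L f. lip_fn z N L f \<longrightarrow> \<bar>(c *\<^sub>R m) f - atoms z N l f\<bar> \<le> e * L)"
    if e: "0 < e" for e
  proof -
    have "0 < e / (\<bar>c\<bar> + 1)" using e by simp
    then obtain l where l: "fst ` set l \<subseteq> N"
      "\<And>L f. lip_fn z N L f \<Longrightarrow> \<bar>m f - atoms z N l f\<bar> \<le> e / (\<bar>c\<bar> + 1) * L"
      using free_approx[OF z m] by blast
    define l' where "l' = map (\<lambda>(x, a). (x, c * a)) l"
    have "\<bar>(c *\<^sub>R m) f - atoms z N l' f\<bar> \<le> e * L" if f: "lip_fn z N L f" for L f
    proof -
      have "atoms z N l' f = (\<Sum>(x, a)\<leftarrow>l. a * (c * f x))"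
        using lip_fnD(5)[OF f] sum_list_map_weights[of f "\<lambda>_. c" l] by (simp add: atoms_def l'_def)
      also have "\<dots> = c * atoms z N l f"
        using atoms_scale[OF lip_fnD(5)[OF f], of l c]
          subspace_scale[OF subspace_Lip0 lip_fnD(5)[OF f], of c] by (simp add: atoms_def)
      finally have "\<bar>(c *\<^sub>R m) f - atoms z N l' f\<bar> = \<bar>c\<bar> * \<bar>m f - atoms z N l f\<bar>"
        by (simp add: abs_mult[symmetric] algebra_simps)
      also have "\<dots> \<le> \<bar>c\<bar> * (e / (\<bar>c\<bar> + 1) * L)" by (intro mult_left_mono l f) auto
      also have "\<dots> = \<bar>c\<bar> / (\<bar>c\<bar> + 1) * (e * L)" by simp
      also have "\<dots> \<le> 1 * (e * L)" using e lip_fnD(1)[OF f] by (intro mult_right_mono) auto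
      finally show ?thesis by simp
    qed
    moreover have "fst ` set l' \<subseteq> N" using l(1) unfolding l'_def by force
    ultimately show ?thesis by blast
  qed
  moreover have "\<forall>f. f \<notin> vecs (Lip0 z N) \<longrightarrow> (c *\<^sub>R m) f = 0"
    using dualD(3)[OF free_space_sub_dual[OF m]] by simp
  ultimately show "c *\<^sub>R m \<in> vecs (free_space z N)" unfolding free_space_iff[OF z] by blast
qed

text \<open>
  The elementary molecules lie in the unit ball of the free space, and their values on a function are its
  difference quotients. They therefore norm \<open>Lip0\<close>.
\<close>

definition molecule :: "'a::metric_space \<Rightarrow> 'a set \<Rightarrow> 'a \<Rightarrow> 'a \<Rightarrow> ('a \<Rightarrow> real) \<Rightarrow> real"
  where "molecule z N x y = atoms z N [(x, 1 / dist x y), (y, - 1 / dist x y)]"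

lemma molecule_apply:
  "f \<in> vecs (Lip0 z N) \<Longrightarrow> molecule z N x y f = (f x - f y) / dist x y"
  by (simp add: molecule_def atoms_def diff_divide_distrib)

lemma molecule_free:
  assumes "z \<in> N" "x \<in> N" "y \<in> N"
  shows "molecule z N x y \<in> vecs (free_space z N)"
  unfolding molecule_def using assms by (intro atoms_free) auto

lemma molecule_le:
  assumes "x \<in> N" "y \<in> N" "lip_fn z N L f"
  shows "\<bar>molecule z N x y f\<bar> \<le> L"
proof (cases "x = y")
  case False
  then show ?thesis using lip_fnD(2)[OF assms(3,1,2)]
    by (simp add: molecule_apply[OF lip_fnD(5)[OF assms(3)]] field_simps)
qed (simp add: molecule_apply[OF lip_fnD(5)[OF assms(3)]] lip_fnD(1)[OF assms(3)])

text \<open>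
  The dual of the free space is \<open>Lip0\<close>: a functional is determined by its values on the evaluations, and its
  boundedness on molecules says that these values depend on the point in a Lipschitz way.
\<close>

lemma dual_free_space_representation:
  assumes z: "z \<in> N" and \<phi>: "\<phi> \<in> vecs (dual (free_space z N))"
    and C: "0 \<le> C" "\<And>m. m \<in> vecs (free_space z N) \<Longrightarrow> \<bar>\<phi> m\<bar> \<le> C * nrm (free_space z N) m"
  obtains f where "lip_fn z N C f" "\<And>m. m \<in> vecs (free_space z N) \<Longrightarrow> \<phi> m = m f"
    "\<And>x. x \<in> N \<Longrightarrow> f x = \<phi> (evaluation z N x)"
proof
  let ?F = "vecs (free_space z N)"
  define f where "f x = (if x \<in> N then \<phi> (evaluation z N x) else 0)" for x
  have ev: "evaluation z N x = atoms z N [(x, 1)]" for x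
    by (auto simp: evaluation_def atoms_def fun_eq_iff)
  have evF: "evaluation z N x \<in> ?F" if "x \<in> N" for x
    unfolding ev by (rule atoms_free[OF z]) (use that in simp)
  have sum: "\<phi> (atoms z N l) = (\<Sum>(x, a)\<leftarrow>l. a * f x)" if "fst ` set l \<subseteq> N" for l
    using that
  proof (induction l)
    case Nil
    have nil: "atoms z N [] = 0 *\<^sub>R evaluation z N z" by (simp add: atoms_def fun_eq_iff)
    show ?case unfolding nil dualD(2)[OF \<phi> evF[OF z]] by simp
  next
    case (Cons p l)
    obtain x a where p: "p = (x, a)" by (cases p)
    then have x: "x \<in> N" and l: "fst ` set l \<subseteq> N" using Cons.prems by auto
    have "atoms z N (p # l) = a *\<^sub>R evaluation z N x + atoms z N l"
      by (auto simp: atoms_def evaluation_def fun_eq_iff p)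
    then have "\<phi> (atoms z N (p # l)) = a * \<phi> (evaluation z N x) + \<phi> (atoms z N l)"
      using dualD(1)[OF \<phi> subspace_scale[OF subspace_free_space[OF z] evF[OF x], of a] atoms_free[OF z l]]
        dualD(2)[OF \<phi> evF[OF x], of a] by simp
    then show ?case using Cons.IH[OF l] x by (simp add: p f_def)
  qed
  show lip: "lip_fn z N C f"
  proof (rule lip_fnI)
    fix x y assume x: "x \<in> N" and y: "y \<in> N"
    show "\<bar>f x - f y\<bar> \<le> C * dist x y"
    proof (cases "x = y")
      case False
      have "nrm (free_space z N) (molecule z N x y) \<le> 1"
        using molecule_le[OF x y] by (rule free_nrm_le)
      then have "\<bar>\<phi> (molecule z N x y)\<bar> \<le> C * 1"
        using C(2)[OF molecule_free[OF z x y]] mult_left_mono[OF _ C(1)] by (meson order_trans)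
      moreover have "\<phi> (molecule z N x y) = (f x - f y) / dist x y"
        using sum[of "[(x, 1 / dist x y), (y, - 1 / dist x y)]"] x y
        by (simp add: molecule_def diff_divide_distrib)
      ultimately show ?thesis using False by (simp add: field_simps)
    qed simp
  next
    have "evaluation z N z = 0 *\<^sub>R evaluation z N z"
      by (auto simp: evaluation_def fun_eq_iff dest: vecs_Lip0[THEN iffD1] lip_fnD(3))
    then show "f z = 0" using dualD(2)[OF \<phi> evF[OF z], of 0] z by (simp add: f_def)
  qed (use C in \<open>auto simp: f_def\<close>)
  show "f x = \<phi> (evaluation z N x)" if "x \<in> N" for x using that by (simp add: f_def)
  fix m assume m: "m \<in> ?F"
  have close: "\<bar>\<phi> m - m f\<bar> \<le> e * (2 * C)" if e: "0 < e" for e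
  proof -
    obtain l where l: "fst ` set l \<subseteq> N" "\<And>L f. lip_fn z N L f \<Longrightarrow> \<bar>m f - atoms z N l f\<bar> \<le> e * L"
      using free_approx[OF z m e] by blast
    have d: "m - atoms z N l \<in> ?F"
      by (intro subspace_diff[OF subspace_free_space[OF z]] m atoms_free[OF z] l)
    have "nrm (free_space z N) (m - atoms z N l) \<le> e"
      by (rule free_nrm_le) (use l(2)[of 1] in simp)
    then have "\<bar>\<phi> (m - atoms z N l)\<bar> \<le> C * e"
      using C(2)[OF d] mult_left_mono[OF _ C(1)] by (meson order_trans)
    moreover have "\<phi> m = \<phi> (m - atoms z N l) + \<phi> (atoms z N l)"
      using dualD(1)[OF \<phi> d atoms_free[OF z l(1)]] by simp
    moreover have "\<phi> (atoms z N l) = atoms z N l f"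
      using sum[OF l(1)] lip_fnD(5)[OF lip] by (simp add: atoms_def)
    ultimately show ?thesis using l(2)[OF lip] by (simp add: algebra_simps)
  qed
  have "\<bar>\<phi> m - m f\<bar> \<le> e" if "0 < e" for e
  proof -
    have "\<bar>\<phi> m - m f\<bar> \<le> e / (2 * C + 1) * (2 * C)" using that C(1) by (intro close) auto
    also have "\<dots> \<le> e" using that C(1) by (simp add: field_simps)
    finally show ?thesis .
  qed
  then show "\<phi> m = m f" using field_le_epsilon[of "\<bar>\<phi> m - m f\<bar>" 0] by simp
qed

lemma dual_free_space_obtain:
  assumes z: "z \<in> N" and \<phi>: "\<phi> \<in> vecs (dual (free_space z N))"
  obtains f where "f \<in> vecs (Lip0 z N)" "\<And>m. m \<in> vecs (free_space z N) \<Longrightarrow> \<phi> m = m f"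
proof -
  obtain C where C: "\<And>m. m \<in> vecs (free_space z N) \<Longrightarrow> \<bar>\<phi> m\<bar> \<le> C * nrm (free_space z N) m"
    using dualD(4)[OF \<phi>] by blast
  have "\<bar>\<phi> m\<bar> \<le> \<bar>C\<bar> * nrm (free_space z N) m" if "m \<in> vecs (free_space z N)" for m
    using C[OF that] mult_right_mono[OF abs_ge_self free_nrm_nonneg[OF that]] order_trans by blast
  then show ?thesis
    using dual_free_space_representation[OF z \<phi> abs_ge_zero[of C]] lip_fnD(5) that by metis
qed

lemma evaluation_at_dual:
  assumes z: "z \<in> N" and f: "lip_fn z N L f"
  shows "(\<lambda>m. if m \<in> vecs (free_space z N) then m f else 0) \<in> vecs (dual (free_space z N))"
proof (rule dualI[where C = L])
  show "\<bar>if m \<in> vecs (free_space z N) then m f else 0\<bar> \<le> L * nrm (free_space z N) m"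
    if "m \<in> vecs (free_space z N)" for m
    using free_le[OF that f] that by (simp add: mult.commute)
qed (simp_all add: subspace_add[OF subspace_free_space[OF z]] subspace_scale[OF subspace_free_space[OF z]])

text \<open>
  Elements of the free space are functions on \<open>Lip0\<close>, and all bounded functionals are evaluations at elements
  of \<open>Lip0\<close>. So the weak topology is the topology of pointwise convergence.
\<close>

lemma weak_topology_free_space:
  assumes z: "z \<in> N"
  shows "weak_topology (free_space z N) = subtopology euclidean (vecs (free_space z N))"
proof -
  let ?F = "vecs (free_space z N)"
  let ?B = "{{x \<in> ?F. \<phi> x \<in> U} | \<phi> U. \<phi> \<in> vecs (dual (free_space z N)) \<and> open (U::real set)}"
  have top: "topspace (weak_topology (free_space z N)) = ?F"
  proof -
    have "{x \<in> ?F. 0 x \<in> UNIV} \<in> ?B" using subspace_0[OF subspace_dual] open_UNIV by blast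
    then have "?F \<subseteq> \<Union>?B" by (intro Union_upper) simp
    moreover have "\<Union>?B \<subseteq> ?F" by blast
    ultimately show ?thesis unfolding weak_topology_def topology_generated_by_topspace by (rule antisym[rotated])
  qed
  have coord: "continuous_map (weak_topology (free_space z N)) euclidean (\<lambda>m. m f)" for f
  proof (cases "f \<in> vecs (Lip0 z N)")
    case True
    then obtain L where L: "lip_fn z N L f" using vecs_Lip0 by blast
    have "openin (weak_topology (free_space z N)) {m \<in> ?F. m f \<in> U}" if "open U" for U
    proof -
      have eq: "{m \<in> ?F. m f \<in> U} = {m \<in> ?F. (\<lambda>m. if m \<in> ?F then m f else 0) m \<in> U}" by auto
      have "{m \<in> ?F. m f \<in> U} \<in> ?B"
        unfolding eq by (rule CollectI, intro exI conjI, rule refl, rule evaluation_at_dual[OF z L], rule that)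
      then show ?thesis unfolding weak_topology_def by (rule topology_generated_by_Basis)
    qed
    then show ?thesis by (simp add: continuous_map_def top open_openin[symmetric])
  next
    case False
    have "continuous_map (weak_topology (free_space z N)) euclidean (\<lambda>m. 0::real)" by simp
    then show ?thesis
      by (rule continuous_map_eq) (simp only: top dualD(3)[OF free_space_sub_dual False])
  qed
  have id: "continuous_map (weak_topology (free_space z N)) euclidean (\<lambda>m. m)"
    unfolding euclidean_product_topology[symmetric] continuous_map_componentwise_UNIV
    using coord by blast
  show ?thesis
  proof (rule topology_eq[THEN iffD2], intro allI iffI)
    fix S assume "openin (weak_topology (free_space z N)) S"
    then have "generate_topology_on ?B S"
      unfolding weak_topology_def by (rule openin_topology_generated_by)
    then show "openin (subtopology euclidean ?F) S"
    proof (induction rule: generate_topology_on.induct)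
      case (Basis S)
      then obtain \<phi> U where S: "S = {x \<in> ?F. \<phi> x \<in> U}" "\<phi> \<in> vecs (dual (free_space z N))" "open U"
        by blast
      obtain f where f: "\<And>m. m \<in> ?F \<Longrightarrow> \<phi> m = m f" using dual_free_space_obtain[OF z S(2)] by metis
      have "open {m :: ('a \<Rightarrow> real) \<Rightarrow> real. m f \<in> U}"
        using open_vimage[OF S(3) continuous_on_product_coordinates[of f]] by (simp add: vimage_def)
      moreover have "S = ?F \<inter> {m. m f \<in> U}" using S f by auto
      ultimately show ?case by (auto simp: openin_subtopology)
    qed (auto intro: openin_Int openin_Union)
  next
    fix S assume "openin (subtopology euclidean ?F) S"
    then obtain T where T: "open T" "S = T \<inter> ?F" by (auto simp: openin_subtopology)
    then show "openin (weak_topology (free_space z N)) S"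
      using openin_continuous_map_preimage[OF id, of T] top by (simp add: Int_def conj_commute)
  qed
qed

lemma compact_imp_closed_fun:
  fixes C :: "('b \<Rightarrow> real) set"
  assumes "compact C" shows "closed C"
proof -
  have "Hausdorff_space (euclidean :: ('b \<Rightarrow> real) topology)"
    unfolding euclidean_product_topology[symmetric]
    by (auto simp: Hausdorff_space_product_topology intro: Hausdorff_space_euclidean)
  then show ?thesis using compactin_imp_closedin assms by fastforce
qed

text \<open>
  By \<open>weak_topology_free_space\<close>, a set is relatively weakly compact exactly if it is contained in a pointwise
  compact set of elements of the free space. This lemma and the next one are the two implications.
\<close>

lemma relatively_weakly_compact_free_spaceD:
  assumes z: "z \<in> N" and rwc: "relatively_weakly_compact (free_space z N) \<Gamma>"
    and \<Gamma>: "\<Gamma> \<subseteq> vecs (free_space z N)"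
  obtains C where "compact C" "\<Gamma> \<subseteq> C" "C \<subseteq> vecs (free_space z N)"
proof
  let ?X = "subtopology euclidean (vecs (free_space z N))"
  have "compactin ?X (?X closure_of \<Gamma>)"
    using rwc unfolding relatively_weakly_compact_def weak_topology_free_space[OF z] .
  then show "compact (?X closure_of \<Gamma>)" "?X closure_of \<Gamma> \<subseteq> vecs (free_space z N)"
    by (simp_all add: compactin_subtopology)
  show "\<Gamma> \<subseteq> ?X closure_of \<Gamma>" using \<Gamma> by (intro closure_of_subset) simp
qed

lemma relatively_weakly_compact_free_spaceI:
  assumes z: "z \<in> N" and C: "compact C" "\<Gamma> \<subseteq> C" "C \<subseteq> vecs (free_space z N)"
  shows "relatively_weakly_compact (free_space z N) \<Gamma>"
proof -
  let ?F = "vecs (free_space z N)"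
  have cl: "closure \<Gamma> \<subseteq> C" using C compact_imp_closed_fun by (intro closure_minimal) auto
  have "subtopology euclidean ?F closure_of \<Gamma> = closure \<Gamma>"
    using cl C closure_subset[of \<Gamma>] by (auto simp: closure_of_subtopology Int_absorb1)
  moreover have "compact (closure \<Gamma>)"
    using closed_Int_compact[OF closed_closure C(1), of \<Gamma>] cl by (simp add: Int_absorb2)
  ultimately show ?thesis
    using cl C unfolding relatively_weakly_compact_def weak_topology_free_space[OF z]
    by (simp add: compactin_subtopology)
qed

section \<open>(V*)-sets in free spaces\<close>

text \<open>
  The condition says that \<open>x \<mapsto> (f n x)\<close>, with \<open>n\<close> running over the natural numbers, is a \<open>C\<close>-Lipschitz map
  into \<open>\<ell>\<^sub>1\<close>. It characterises the weakly unconditionally Cauchy series in \<open>Lip0\<close>.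
\<close>

definition unconditionally_lipschitz ::
  "'a::metric_space \<Rightarrow> 'a set \<Rightarrow> real \<Rightarrow> (nat \<Rightarrow> 'a \<Rightarrow> real) \<Rightarrow> bool"
  where "unconditionally_lipschitz z N C f \<longleftrightarrow> 0 \<le> C \<and> (\<forall>n. f n z = 0 \<and> (\<forall>x. x \<notin> N \<longrightarrow> f n x = 0)) \<and>
    (\<forall>x\<in>N. \<forall>y\<in>N. \<forall>k. (\<Sum>n<k. \<bar>f n x - f n y\<bar>) \<le> C * dist x y)"

lemma sum_scaleR_apply: "(\<Sum>n<(k::nat). s n *\<^sub>R f n) x = (\<Sum>n<k. s n *\<^sub>R f n x)"
  by (induction k) auto

lemma unconditionally_lipschitz_signed_sum:
  assumes f: "unconditionally_lipschitz z N C f" and s: "\<And>n. \<bar>s n\<bar> \<le> 1"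
  shows "lip_fn z N C (\<Sum>n<k. s n *\<^sub>R f n)"
proof (rule lip_fnI)
  fix x y assume xy: "x \<in> N" "y \<in> N"
  have "(\<Sum>n<k. s n *\<^sub>R f n) x - (\<Sum>n<k. s n *\<^sub>R f n) y = (\<Sum>n<k. s n * (f n x - f n y))"
    by (simp add: sum_scaleR_apply sum_subtractf[symmetric] algebra_simps)
  also have "\<bar>\<dots>\<bar> \<le> (\<Sum>n<k. \<bar>s n * (f n x - f n y)\<bar>)" by (rule sum_abs)
  also have "\<dots> \<le> (\<Sum>n<k. \<bar>f n x - f n y\<bar>)"
  proof (rule sum_mono)
    fix n
    show "\<bar>s n * (f n x - f n y)\<bar> \<le> \<bar>f n x - f n y\<bar>"
      using mult_right_mono[OF s[of n], of "\<bar>f n x - f n y\<bar>"] by (simp add: abs_mult)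
  qed
  also have "\<dots> \<le> C * dist x y" using f xy by (simp add: unconditionally_lipschitz_def)
  finally show "\<bar>(\<Sum>n<k. s n *\<^sub>R f n) x - (\<Sum>n<k. s n *\<^sub>R f n) y\<bar> \<le> C * dist x y" .
qed (use f in \<open>simp_all add: unconditionally_lipschitz_def sum_scaleR_apply\<close>)

lemma unconditionally_lipschitz_lip_fn:
  assumes f: "unconditionally_lipschitz z N C f"
  shows "lip_fn z N C (f n)"
proof (rule lip_fnI)
  fix x y assume xy: "x \<in> N" "y \<in> N"
  have "\<bar>f n x - f n y\<bar> \<le> (\<Sum>i<Suc n. \<bar>f i x - f i y\<bar>)" by (simp add: sum_nonneg)
  also have "\<dots> \<le> C * dist x y" using f xy unfolding unconditionally_lipschitz_def by blast
  finally show "\<bar>f n x - f n y\<bar> \<le> C * dist x y" .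
qed (use f in \<open>simp_all add: unconditionally_lipschitz_def\<close>)

lemma unconditionally_lipschitz_if_molecules_bounded:
  assumes f: "\<And>n. f n \<in> vecs (Lip0 z N)"
    and C: "\<And>x y k. x \<in> N \<Longrightarrow> y \<in> N \<Longrightarrow> (\<Sum>n<k. \<bar>molecule z N x y (f n)\<bar>) \<le> C"
  shows "unconditionally_lipschitz z N \<bar>C\<bar> f"
  unfolding unconditionally_lipschitz_def
proof (intro conjI allI ballI impI)
  fix x y k assume xy: "x \<in> N" "y \<in> N"
  show "(\<Sum>n<k. \<bar>f n x - f n y\<bar>) \<le> \<bar>C\<bar> * dist x y"
  proof (cases "x = y")
    case False
    have "(\<Sum>n<k. \<bar>f n x - f n y\<bar>) = (\<Sum>n<k. \<bar>molecule z N x y (f n)\<bar>) * dist x y"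
      using False by (simp add: molecule_apply[OF f] sum_distrib_right)
    also have "\<dots> \<le> \<bar>C\<bar> * dist x y" using C[OF xy, of k] by (intro mult_right_mono) auto
    finally show ?thesis .
  qed simp
next
  fix n
  obtain L where L: "lip_fn z N L (f n)" using f vecs_Lip0 by blast
  show "f n z = 0" by (rule lip_fnD(3)[OF L])
  show "f n x = 0" if "x \<notin> N" for x by (rule lip_fnD(4)[OF L that])
qed simp

lemma unconditionally_lipschitz_imp_WUC:
  assumes f: "unconditionally_lipschitz z N C f"
  shows "WUC (Lip0 z N) f"
  by (rule WUC_if_signed_sums_bounded[where C = C])
    (auto intro: subspace_Lip0 nrm_Lip0_nonneg nrm_Lip0_le unconditionally_lipschitz_signed_sum[OF f]
      lip_fnD(5)[OF unconditionally_lipschitz_lip_fn[OF f]])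

lemma WUC_imp_unconditionally_lipschitz:
  assumes z: "z \<in> N" and f: "WUC (Lip0 z N) f"
  obtains C where "unconditionally_lipschitz z N C f"
proof -
  let ?P = "{molecule z N x y |x y. x \<in> N \<and> y \<in> N}"
  have P: "?P \<subseteq> vecs (dual (Lip0 z N))" using molecule_free[OF z] free_space_sub_dual by blast
  have le: "\<bar>p g\<bar> \<le> nrm (Lip0 z N) g" if "p \<in> ?P" "g \<in> vecs (Lip0 z N)" for p g
    using that molecule_le lip_fn_nrm by blast
  obtain C where C: "\<And>p k. p \<in> ?P \<Longrightarrow> (\<Sum>n<k. \<bar>p (f n)\<bar>) \<le> C"
    using WUC_uniformly_bounded[OF f P] le by blast
  have fv: "f n \<in> vecs (Lip0 z N)" for n using f by (auto simp: WUC_def)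
  have "unconditionally_lipschitz z N \<bar>C\<bar> f"
    using fv by (rule unconditionally_lipschitz_if_molecules_bounded) (use C in blast)
  then show ?thesis by (rule that)
qed

text \<open>
  Weakly unconditionally Cauchy series in the dual of the free space correspond to unconditionally Lipschitz
  sequences. In one direction the functionals \<open>\<psi> \<mapsto> \<psi> (molecule z N x y)\<close> are uniformly bounded along the series by
  \<open>WUC_uniformly_bounded\<close>; in the other one, signed partial sums have norm at most \<open>C\<close>.
\<close>

lemma Vstar_set_free_space_iff:
  assumes z: "z \<in> N"
  shows "Vstar_set (free_space z N) \<Gamma> \<longleftrightarrow> \<Gamma> \<subseteq> vecs (free_space z N) \<and>
    (\<forall>C f. unconditionally_lipschitz z N C f \<longrightarrow>
      (\<forall>e>0. \<exists>n\<^sub>0. \<forall>n\<ge>n\<^sub>0. \<forall>m\<in>\<Gamma>. \<bar>m (f n)\<bar> \<le> e))"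
    (is "?l \<longleftrightarrow> ?sub \<and> ?small")
proof
  let ?F = "vecs (free_space z N)"
  assume V: ?l
  then have \<Gamma>: ?sub by (simp add: Vstar_set_def)
  have ?small
  proof (intro allI impI)
    fix C f and e :: real assume f: "unconditionally_lipschitz z N C f" and e: "0 < e"
    define \<phi> where "\<phi> n m = (if m \<in> ?F then m (f n) else 0)" for n m
    have \<phi>: "\<phi> n \<in> vecs (dual (free_space z N))" for n
      unfolding \<phi>_def by (rule evaluation_at_dual[OF z unconditionally_lipschitz_lip_fn[OF f]])
    have "WUC (dual (free_space z N)) \<phi>"
    proof (rule WUC_if_signed_sums_bounded[where C = C])
      show "0 \<le> nrm (dual (free_space z N)) \<psi>" if "\<psi> \<in> vecs (dual (free_space z N))" for \<psi>
        using dual_nrm_upper[OF free_nrm_nonneg that molecule_free[OF z z z]]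
          free_nrm_le[of z N "molecule z N z z" 1] molecule_le[OF z z] by (meson abs_ge_zero order_trans)
      show "nrm (dual (free_space z N)) (\<Sum>n<k. s n *\<^sub>R \<phi> n) \<le> C" if s: "\<And>n. \<bar>s n\<bar> \<le> 1" for k s
      proof (rule dual_nrm_least[OF molecule_free[OF z z z]])
        show "nrm (free_space z N) (molecule z N z z) \<le> 1" using molecule_le[OF z z] by (rule free_nrm_le)
        fix m assume m: "m \<in> ?F" "nrm (free_space z N) m \<le> 1"
        have "(\<Sum>n<k. s n *\<^sub>R \<phi> n) m = m (\<Sum>n<k. s n *\<^sub>R f n)"
          unfolding sum_scaleR_apply[of s \<phi>]
          using linear_on_sum[OF subspace_Lip0, of z N m f s k] free_add[OF m(1)] free_scale[OF m(1)]
            lip_fnD(5)[OF unconditionally_lipschitz_lip_fn[OF f]] m(1) by (simp add: \<phi>_def)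
        also have "\<bar>\<dots>\<bar> \<le> nrm (free_space z N) m * C"
          using m(1) unconditionally_lipschitz_signed_sum[OF f s] by (rule free_le)
        also have "\<dots> \<le> 1 * C" using m f by (intro mult_right_mono) (auto simp: unconditionally_lipschitz_def)
        finally show "\<bar>(\<Sum>n<k. s n *\<^sub>R \<phi> n) m\<bar> \<le> C" by simp
      qed
    qed (use \<phi> subspace_dual in auto)
    then have "(\<lambda>n. SUP m\<in>\<Gamma>. ennreal \<bar>\<phi> n m\<bar>) \<longlonglongrightarrow> 0" using V by (simp add: Vstar_set_def)
    then have "\<forall>\<^sub>F n in sequentially. (SUP m\<in>\<Gamma>. ennreal \<bar>\<phi> n m\<bar>) < ennreal e"
      using e by (intro order_tendstoD) auto
    then obtain n\<^sub>0 where n\<^sub>0: "\<And>n. n\<^sub>0 \<le> n \<Longrightarrow> (SUP m\<in>\<Gamma>. ennreal \<bar>\<phi> n m\<bar>) < ennreal e"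
      unfolding eventually_sequentially by blast
    have "\<bar>m (f n)\<bar> \<le> e" if "n\<^sub>0 \<le> n" "m \<in> \<Gamma>" for n m
    proof -
      have "ennreal \<bar>\<phi> n m\<bar> \<le> (SUP m\<in>\<Gamma>. ennreal \<bar>\<phi> n m\<bar>)" using that(2) by (rule SUP_upper)
      also have "\<dots> < ennreal e" by (rule n\<^sub>0[OF that(1)])
      finally have "\<bar>\<phi> n m\<bar> \<le> e" using e by (simp add: ennreal_less_iff)
      then show ?thesis using \<Gamma> that(2) by (simp add: \<phi>_def subset_iff)
    qed
    then show "\<exists>n\<^sub>0. \<forall>n\<ge>n\<^sub>0. \<forall>m\<in>\<Gamma>. \<bar>m (f n)\<bar> \<le> e" by blast
  qed
  with \<Gamma> show "?sub \<and> ?small" by blast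
next
  let ?F = "vecs (free_space z N)"
  assume R: "?sub \<and> ?small"
  have "(\<lambda>n. SUP m\<in>\<Gamma>. ennreal \<bar>\<phi> n m\<bar>) \<longlonglongrightarrow> 0" if W: "WUC (dual (free_space z N)) \<phi>" for \<phi>
  proof -
    have \<phi>: "\<phi> n \<in> vecs (dual (free_space z N))" for n using W by (auto simp: WUC_def)
    then have "\<exists>f. f \<in> vecs (Lip0 z N) \<and> (\<forall>m\<in>?F. \<phi> n m = m f)" for n
      using dual_free_space_obtain[OF z \<phi>[of n]] by metis
    then obtain f where f: "\<And>n. f n \<in> vecs (Lip0 z N)" and \<phi>f: "\<And>n m. m \<in> ?F \<Longrightarrow> \<phi> n m = m (f n)"
      by metis
    define p where "p u = (\<lambda>\<psi>. if \<psi> \<in> vecs (dual (free_space z N)) then \<psi> u else 0)"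
      for u :: "('a \<Rightarrow> real) \<Rightarrow> real"
    let ?P = "{p (molecule z N x y) |x y. x \<in> N \<and> y \<in> N}"
    have le: "\<bar>q \<psi>\<bar> \<le> nrm (dual (free_space z N)) \<psi>"
      if q: "q \<in> ?P" and \<psi>: "\<psi> \<in> vecs (dual (free_space z N))" for q \<psi>
    proof -
      obtain x y where xy: "x \<in> N" "y \<in> N" "q = p (molecule z N x y)" using q by blast
      have "nrm (free_space z N) (molecule z N x y) \<le> 1" using molecule_le[OF xy(1,2)] by (rule free_nrm_le)
      then show ?thesis
        using dual_nrm_upper[OF free_nrm_nonneg \<psi> molecule_free[OF z xy(1,2)]] \<psi> by (simp add: xy(3) p_def)
    qed
    have P: "?P \<subseteq> vecs (dual (dual (free_space z N)))"
    proof
      fix q assume q: "q \<in> ?P"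
      then obtain x y where xy: "x \<in> N" "y \<in> N" "q = p (molecule z N x y)" by blast
      show "q \<in> vecs (dual (dual (free_space z N)))"
        by (rule dualI[where C = 1])
          (use le[OF q] in \<open>simp_all add: xy(3) p_def subspace_add[OF subspace_dual] subspace_scale[OF subspace_dual]\<close>)
    qed
    obtain C where C: "\<And>q k. q \<in> ?P \<Longrightarrow> (\<Sum>n<k. \<bar>q (\<phi> n)\<bar>) \<le> C"
      using WUC_uniformly_bounded[OF W P] le by blast
    have f_uncond: "unconditionally_lipschitz z N \<bar>C\<bar> f"
    proof (rule unconditionally_lipschitz_if_molecules_bounded[OF f])
      fix x y k assume xy: "x \<in> N" "y \<in> N"
      have "p (molecule z N x y) (\<phi> n) = molecule z N x y (f n)" for n
        using \<phi> \<phi>f[OF molecule_free[OF z xy]] by (simp add: p_def)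
      moreover have "(\<Sum>n<k. \<bar>p (molecule z N x y) (\<phi> n)\<bar>) \<le> C" using xy by (intro C) blast
      ultimately show "(\<Sum>n<k. \<bar>molecule z N x y (f n)\<bar>) \<le> C" by simp
    qed
    show ?thesis
    proof (rule order_tendstoI)
      fix a :: ennreal assume "0 < a"
      then obtain b where b: "0 < b" "b < a" using dense by blast
      then obtain e where e: "b = ennreal e" "0 < e" by (cases b) auto
      obtain n\<^sub>0 where n\<^sub>0: "\<And>n m. n\<^sub>0 \<le> n \<Longrightarrow> m \<in> \<Gamma> \<Longrightarrow> \<bar>m (f n)\<bar> \<le> e"
        using R f_uncond e(2) by blast
      have "(SUP m\<in>\<Gamma>. ennreal \<bar>\<phi> n m\<bar>) \<le> ennreal e" if "n\<^sub>0 \<le> n" for n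
      proof (rule SUP_least)
        fix m assume "m \<in> \<Gamma>"
        then show "ennreal \<bar>\<phi> n m\<bar> \<le> ennreal e" using n\<^sub>0[OF that] R \<phi>f by (auto intro!: ennreal_leI)
      qed
      then show "\<forall>\<^sub>F n in sequentially. (SUP m\<in>\<Gamma>. ennreal \<bar>\<phi> n m\<bar>) < a"
        using b e unfolding eventually_sequentially by (meson le_less_trans)
    qed simp
  qed
  then show ?l using R by (simp add: Vstar_set_def)
qed

section \<open>Concentration of (V*)-sets near finite sets\<close>

text \<open>
  Functions by which \<open>Lip0\<close> may be multiplied. The factor \<open>1 + dist x z\<close> compensates for the growth of the
  functions \<open>f\<close> in \<open>Lip0\<close>, which satisfy \<open>\<bar>f x\<bar> \<le> L * dist x z\<close> only; it makes the product Lipschitz on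
  unbounded spaces, too.
\<close>

definition multiplier :: "'a::metric_space \<Rightarrow> real \<Rightarrow> ('a \<Rightarrow> real) \<Rightarrow> bool"
  where "multiplier z c h \<longleftrightarrow> (\<forall>x. 0 \<le> h x \<and> h x \<le> 1) \<and>
    (\<forall>x y. (1 + dist x z) * \<bar>h x - h y\<bar> \<le> c * dist x y)"

lemma multiplierD:
  assumes "multiplier z c h"
  shows "0 \<le> h x" "h x \<le> 1" "(1 + dist x z) * \<bar>h x - h y\<bar> \<le> c * dist x y"
  using assms by (auto simp: multiplier_def)

lemma multiplier_one: "multiplier z 0 (\<lambda>_. 1)"
  by (simp add: multiplier_def)

lemma multiplier_mult:
  assumes h: "multiplier z c h" and k: "multiplier z d k"
  shows "multiplier z (c + d) (\<lambda>x. h x * k x)"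
  unfolding multiplier_def
proof (intro conjI allI)
  fix x y
  show "0 \<le> h x * k x" "h x * k x \<le> 1"
    using multiplierD[OF h] multiplierD[OF k] by (simp_all add: mult_le_one)
  have "\<bar>h x * k x - h y * k y\<bar> = \<bar>k x * (h x - h y) + h y * (k x - k y)\<bar>"
    by (simp add: algebra_simps)
  also have "\<dots> \<le> k x * \<bar>h x - h y\<bar> + h y * \<bar>k x - k y\<bar>"
    using multiplierD(1)[OF h] multiplierD(1)[OF k] by (intro order_trans[OF abs_triangle_ineq]) (simp add: abs_mult)
  also have "\<dots> \<le> 1 * \<bar>h x - h y\<bar> + 1 * \<bar>k x - k y\<bar>"
    using multiplierD[OF h] multiplierD[OF k] by (intro add_mono mult_right_mono) auto
  finally have "(1 + dist x z) * \<bar>h x * k x - h y * k y\<bar> \<le> (1 + dist x z) * (\<bar>h x - h y\<bar> + \<bar>k x - k y\<bar>)"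
    by (intro mult_left_mono) auto
  also have "\<dots> \<le> (c + d) * dist x y"
    using multiplierD(3)[OF h, of x y] multiplierD(3)[OF k, of x y] by (simp add: algebra_simps)
  finally show "(1 + dist x z) * \<bar>h x * k x - h y * k y\<bar> \<le> (c + d) * dist x y" .
qed

lemma lip_fn_multiplier:
  assumes h: "multiplier z c h" and c: "0 \<le> c" and f: "lip_fn z UNIV L f"
  shows "lip_fn z UNIV ((1 + c) * L) (\<lambda>x. h x * f x)"
proof (rule lip_fnI)
  note L = lip_fnD(1)[OF f]
  fix x y
  have "\<bar>f x\<bar> \<le> L * (1 + dist x z)"
    using lip_fn_bound[OF f, of x] L by (simp add: distrib_left)
  then have "\<bar>f x\<bar> * \<bar>h x - h y\<bar> \<le> L * (1 + dist x z) * \<bar>h x - h y\<bar>" by (intro mult_right_mono) auto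
  also have "\<dots> \<le> L * (c * dist x y)"
    unfolding mult.assoc using L by (intro mult_left_mono multiplierD(3)[OF h])
  finally have 1: "\<bar>f x\<bar> * \<bar>h x - h y\<bar> \<le> L * (c * dist x y)" .
  have 2: "h y * \<bar>f x - f y\<bar> \<le> 1 * (L * dist x y)"
    using multiplierD[OF h] lip_fnD(2)[OF f, of x y] by (intro mult_mono) auto
  have "\<bar>h x * f x - h y * f y\<bar> = \<bar>f x * (h x - h y) + h y * (f x - f y)\<bar>" by (simp add: algebra_simps)
  also have "\<dots> \<le> \<bar>f x\<bar> * \<bar>h x - h y\<bar> + h y * \<bar>f x - f y\<bar>"
    using multiplierD(1)[OF h] by (intro order_trans[OF abs_triangle_ineq]) (simp add: abs_mult)
  also have "\<dots> \<le> (1 + c) * L * dist x y" using 1 2 by (simp add: algebra_simps)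
  finally show "\<bar>h x * f x - h y * f y\<bar> \<le> (1 + c) * L * dist x y" .
qed (use c lip_fnD[OF f] in auto)

text \<open>
  A cut-off equal to \<open>1\<close> near \<open>A\<close> and to \<open>0\<close> far from it. The scale \<open>\<delta> * (1 + dist x z)\<close> grows with the distance
  from the base point, so that the slope decays as a multiplier requires.
\<close>

definition bump :: "'a::metric_space \<Rightarrow> 'a set \<Rightarrow> real \<Rightarrow> 'a \<Rightarrow> real"
  where "bump z A \<delta> x = max 0 (min 1 (2 - infdist x A / (\<delta> * (1 + dist x z))))"

lemma one_plus_dist_pos: "0 < 1 + dist x z"
  by (simp add: add_pos_nonneg)

lemma multiplier_bump:
  assumes z: "z \<in> A" and \<delta>: "0 < \<delta>"
  shows "multiplier z (2 / \<delta>) (bump z A \<delta>)"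
  unfolding multiplier_def
proof (intro conjI allI)
  fix x y
  show "0 \<le> bump z A \<delta> x" "bump z A \<delta> x \<le> 1" by (simp_all add: bump_def)
  define t where "t x = infdist x A / (1 + dist x z)" for x
  have t_le: "t y \<le> 1"
    using infdist_le[OF z, of y] one_plus_dist_pos[of y z] by (simp add: t_def)
  have t_nonneg: "0 \<le> t y" by (simp add: t_def infdist_nonneg)
  have Dx: "infdist x A = t x * (1 + dist x z)" and Dy: "infdist y A = t y * (1 + dist y z)"
    using one_plus_dist_pos[of x z] one_plus_dist_pos[of y z] by (simp_all add: t_def)
  have "(1 + dist x z) * (t x - t y) = (infdist x A - infdist y A) + t y * (dist y z - dist x z)"
    unfolding Dx Dy by (simp add: algebra_simps)
  also have "\<bar>\<dots>\<bar> \<le> dist x y + 1 * dist x y"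
  proof (intro order_trans[OF abs_triangle_ineq] add_mono)
    show "\<bar>infdist x A - infdist y A\<bar> \<le> dist x y"
      using infdist_triangle[of x A y] infdist_triangle[of y A x] by (simp add: abs_le_iff dist_commute)
    have "\<bar>dist y z - dist x z\<bar> \<le> dist x y"
      using dist_triangle[of x z y] dist_triangle[of y z x] by (simp add: abs_le_iff dist_commute)
    then show "\<bar>t y * (dist y z - dist x z)\<bar> \<le> 1 * dist x y"
      unfolding abs_mult using t_le t_nonneg by (intro mult_mono) auto
  qed
  finally have t: "(1 + dist x z) * \<bar>t x - t y\<bar> \<le> 2 * dist x y"
    using one_plus_dist_pos[of x z] by (simp add: abs_mult)
  have "\<bar>bump z A \<delta> x - bump z A \<delta> y\<bar> \<le> \<bar>t x / \<delta> - t y / \<delta>\<bar>"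
    by (auto simp: bump_def t_def max_def min_def mult.commute)
  also have "\<dots> = \<bar>t x - t y\<bar> / \<delta>" using \<delta> by (simp add: diff_divide_distrib[symmetric])
  finally have "(1 + dist x z) * \<bar>bump z A \<delta> x - bump z A \<delta> y\<bar> \<le> (1 + dist x z) * (\<bar>t x - t y\<bar> / \<delta>)"
    using one_plus_dist_pos[of x z] by (intro mult_left_mono) auto
  also have "\<dots> = (1 + dist x z) * \<bar>t x - t y\<bar> / \<delta>" by simp
  also have "\<dots> \<le> 2 * dist x y / \<delta>" using t \<delta> by (intro divide_right_mono) auto
  finally show "(1 + dist x z) * \<bar>bump z A \<delta> x - bump z A \<delta> y\<bar> \<le> 2 / \<delta> * dist x y" by simp
qed

lemma bump_nonzero:
  assumes "0 < \<delta>"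
  shows "bump z A \<delta> x \<noteq> 0 \<longleftrightarrow> infdist x A < 2 * \<delta> * (1 + dist x z)"
  using mult_pos_pos[OF assms one_plus_dist_pos[of x z]]
  by (auto simp: bump_def max_def min_def divide_simps mult_ac)

lemma bump_eq_one:
  assumes "0 < \<delta>" "infdist x A \<le> \<delta> * (1 + dist x z)"
  shows "bump z A \<delta> x = 1"
  using mult_pos_pos[OF assms(1) one_plus_dist_pos[of x z]] assms(2)
  by (simp add: bump_def divide_simps)

lemma bump_nonzero_mono:
  assumes "0 < \<delta>" "A \<noteq> {}" "A \<subseteq> B" "bump z A \<delta> x \<noteq> 0"
  shows "bump z B \<delta> x \<noteq> 0"
  using assms(4) infdist_mono[OF assms(3,2), of x] unfolding bump_nonzero[OF assms(1)] by linarith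

lemma unconditionally_lipschitz_disjoint_supports:
  assumes g: "\<And>n. lip_fn z N L (g n)"
    and disj: "\<And>n m x. g n x \<noteq> 0 \<Longrightarrow> g m x \<noteq> 0 \<Longrightarrow> n = m"
  shows "unconditionally_lipschitz z N (2 * L) g"
  unfolding unconditionally_lipschitz_def
proof (intro conjI allI ballI impI)
  fix x y k assume xy: "x \<in> N" "y \<in> N"
  let ?S = "\<lambda>x. {n. n < k \<and> g n x \<noteq> 0}"
  have card: "card (?S x) \<le> 1" for x
    by (auto simp: card_le_Suc0_iff_eq intro: disj)
  have "(\<Sum>n<k. \<bar>g n x - g n y\<bar>) = (\<Sum>n\<in>?S x \<union> ?S y. \<bar>g n x - g n y\<bar>)"
    by (rule sum.mono_neutral_right) auto
  also have "\<dots> \<le> of_nat (card (?S x \<union> ?S y)) * (L * dist x y)"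
    using lip_fnD(2)[OF g xy] by (intro sum_bounded_above)
  also have "\<dots> \<le> 2 * (L * dist x y)"
    using card[of x] card[of y] card_Un_le[of "?S x" "?S y"]
    by (intro mult_right_mono mult_nonneg_nonneg lip_fnD(1)[OF g] zero_le_dist) linarith
  finally show "(\<Sum>n<k. \<bar>g n x - g n y\<bar>) \<le> 2 * L * dist x y" by simp
qed (use lip_fnD(1)[OF g] lip_fnD(3,4)[OF g] in auto)

text \<open>
  An element of the free space is almost carried by a finite set. A bump around that set localises \<open>f\<close> there
  and hardly changes the value of \<open>\<gamma>\<close> at \<open>f\<close>.
\<close>

lemma localised_witness:
  assumes \<gamma>: "\<gamma> \<in> vecs (free_space z UNIV)" and A: "finite A" "z \<in> A"
    and \<delta>: "0 < \<delta>" and \<epsilon>: "0 < \<epsilon>" and f: "lip_fn z UNIV 1 f" "\<epsilon> < \<bar>\<gamma> f\<bar>"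
  obtains B where "finite B" "A \<subseteq> B" "lip_fn z UNIV (1 + 2 / \<delta>) (\<lambda>x. bump z B \<delta> x * f x)"
    "\<epsilon> / 2 < \<bar>\<gamma> (\<lambda>x. bump z B \<delta> x * f x)\<bar>"
proof -
  define e where "e = \<epsilon> / (4 * (1 + 2 / \<delta>))"
  have e: "0 < e" using \<epsilon> \<delta> by (simp add: e_def add_pos_pos)
  obtain l where l: "\<And>L f. lip_fn z UNIV L f \<Longrightarrow> \<bar>\<gamma> f - atoms z UNIV l f\<bar> \<le> e * L"
    using free_approx[OF UNIV_I \<gamma> e] by metis
  define B where "B = A \<union> fst ` set l"
  let ?g = "\<lambda>x. bump z B \<delta> x * f x"
  have g: "lip_fn z UNIV (1 + 2 / \<delta>) ?g"
    using lip_fn_multiplier[OF multiplier_bump[of z B \<delta>] _ f(1)] A \<delta> by (simp add: B_def)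
  have "atoms z UNIV l ?g = atoms z UNIV l f"
  proof (rule atoms_cong[OF lip_fnD(5)[OF g] lip_fnD(5)[OF f(1)]])
    fix x assume "x \<in> fst ` set l"
    then have "infdist x B = 0" by (intro infdist_zero) (simp add: B_def)
    then show "?g x = f x" using bump_eq_one[OF \<delta>, of x B z] \<delta> one_plus_dist_pos[of x z] by simp
  qed
  moreover have "\<epsilon> / (4 * c) * c = \<epsilon> / 4" if "0 < c" for c using that by simp
  then have "e * (1 + 2 / \<delta>) = \<epsilon> / 4" unfolding e_def using \<delta> by (meson add_pos_pos divide_pos_pos zero_less_numeral zero_less_one)
  moreover have "e * 1 \<le> e * (1 + 2 / \<delta>)" using e \<delta> by (intro mult_left_mono) auto
  ultimately have "\<epsilon> / 2 < \<bar>\<gamma> ?g\<bar>" using l[OF g] l[OF f(1)] f(2) by linarith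
  then show ?thesis using that[of B] g A by (simp add: B_def)
qed

text \<open>
  If no finite set works, one finds inductively growing finite sets \<open>A n\<close>, functions \<open>g n\<close>
  supported near \<open>A (n + 1)\<close> but not near \<open>A n\<close>, and elements of \<open>\<Gamma>\<close> whose value at \<open>g n\<close> is at least
  \<open>\<epsilon> / 2\<close>. The functions have disjoint supports and a common Lipschitz constant, so they form an
  unconditionally Lipschitz sequence; along it \<open>\<Gamma>\<close> would have to tend to \<open>0\<close> uniformly.
\<close>

theorem Vstar_set_almost_supported_near_finite:
  assumes V: "Vstar_set (free_space z (UNIV :: 'a::metric_space set)) \<Gamma>" and \<epsilon>: "0 < \<epsilon>" and \<delta>: "0 < \<delta>"
  shows "\<exists>A. finite A \<and> z \<in> A \<and> (\<forall>\<gamma>\<in>\<Gamma>. \<forall>L f. lip_fn z UNIV L f \<longrightarrow>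
    (\<forall>x. bump z A \<delta> x \<noteq> 0 \<longrightarrow> f x = 0) \<longrightarrow> \<bar>\<gamma> f\<bar> \<le> \<epsilon> * L)"
proof (rule ccontr)
  assume neg: "\<not> ?thesis"
  have \<Gamma>: "\<Gamma> \<subseteq> vecs (free_space z UNIV)"
    and small: "\<And>C f e. unconditionally_lipschitz z UNIV C f \<Longrightarrow> 0 < e \<Longrightarrow>
      \<exists>n\<^sub>0. \<forall>n\<ge>n\<^sub>0. \<forall>m\<in>\<Gamma>. \<bar>m (f n)\<bar> \<le> e"
    using V unfolding Vstar_set_free_space_iff[OF UNIV_I] by blast+
  have bad: "\<exists>\<gamma>\<in>\<Gamma>. \<exists>f. lip_fn z UNIV 1 f \<and> (\<forall>x. bump z A \<delta> x \<noteq> 0 \<longrightarrow> f x = 0) \<and> \<epsilon> < \<bar>\<gamma> f\<bar>"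
    if A: "finite A" "z \<in> A" for A
  proof -
    obtain \<gamma> L f where *: "\<gamma> \<in> \<Gamma>" "lip_fn z UNIV L f" "\<And>x. bump z A \<delta> x \<noteq> 0 \<Longrightarrow> f x = 0" "\<epsilon> * L < \<bar>\<gamma> f\<bar>"
      using neg A by (meson not_le)
    have \<gamma>: "\<gamma> \<in> vecs (free_space z UNIV)" using *(1) \<Gamma> by blast
    have "L \<noteq> 0" using free_le[OF \<gamma> *(2)] *(4) by auto
    then have L: "0 < L" using lip_fnD(1)[OF *(2)] by simp
    have "lip_fn z UNIV 1 ((1 / L) *\<^sub>R f)" using lip_fn_scale[OF *(2), of "1 / L"] L by simp
    moreover have "\<epsilon> < \<bar>\<gamma> ((1 / L) *\<^sub>R f)\<bar>"
      using *(4) L unfolding free_scale[OF \<gamma> lip_fnD(5)[OF *(2)]] abs_mult by (simp add: field_simps)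
    ultimately show ?thesis using *(1,3) by (intro bexI[of _ \<gamma>] exI[of _ "(1 / L) *\<^sub>R f"]) auto
  qed
  let ?step = "\<lambda>A B g \<gamma>. A \<subseteq> B \<and> \<gamma> \<in> \<Gamma> \<and> lip_fn z UNIV (1 + 2 / \<delta>) g \<and> \<epsilon> / 2 < \<bar>\<gamma> g\<bar> \<and>
    (\<forall>x. g x \<noteq> 0 \<longrightarrow> bump z A \<delta> x = 0 \<and> bump z B \<delta> x \<noteq> 0)"
  have step: "\<exists>B. (finite B \<and> z \<in> B) \<and> (\<exists>g \<gamma>. ?step A B g \<gamma>)" if A: "finite A \<and> z \<in> A" for A
  proof -
    obtain \<gamma> f where *: "\<gamma> \<in> \<Gamma>" "lip_fn z UNIV 1 f" "\<And>x. bump z A \<delta> x \<noteq> 0 \<Longrightarrow> f x = 0" "\<epsilon> < \<bar>\<gamma> f\<bar>"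
      using bad[of A] A by blast
    have \<gamma>: "\<gamma> \<in> vecs (free_space z UNIV)" using *(1) \<Gamma> by blast
    obtain B where B: "finite B" "A \<subseteq> B" "lip_fn z UNIV (1 + 2 / \<delta>) (\<lambda>x. bump z B \<delta> x * f x)"
      "\<epsilon> / 2 < \<bar>\<gamma> (\<lambda>x. bump z B \<delta> x * f x)\<bar>"
      by (rule localised_witness[where f = f and \<gamma> = \<gamma>, OF \<gamma> conjunct1[OF A] conjunct2[OF A] \<delta> \<epsilon> *(2,4)])
    have "?step A B (\<lambda>x. bump z B \<delta> x * f x) \<gamma>" using B *(1,3) by auto
    moreover have "z \<in> B" using A B(2) by blast
    ultimately show ?thesis using B(1) by blast
  qed
  have "\<exists>A. \<forall>n. (finite (A n) \<and> z \<in> A n) \<and> (\<exists>g \<gamma>. ?step (A n) (A (Suc n)) g \<gamma>)"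
  proof (rule dependent_nat_choice)
    show "\<exists>A. finite A \<and> z \<in> A" by (rule exI[of _ "{z}"]) simp
  qed (rule step)
  then obtain A where A: "\<And>n. finite (A n) \<and> z \<in> A n"
    and "\<And>n. \<exists>g \<gamma>. ?step (A n) (A (Suc n)) g \<gamma>" by blast
  then have "\<exists>g. \<forall>n. \<exists>\<gamma>. ?step (A n) (A (Suc n)) (g n) \<gamma>" by (intro choice) blast
  then obtain g where "\<And>n. \<exists>\<gamma>. ?step (A n) (A (Suc n)) (g n) \<gamma>" by blast
  then have "\<exists>\<gamma>. \<forall>n. ?step (A n) (A (Suc n)) (g n) (\<gamma> n)" by (intro choice) blast
  then obtain \<gamma> where gs: "\<And>n. ?step (A n) (A (Suc n)) (g n) (\<gamma> n)" by blast
  have mono: "A n \<subseteq> A m" if "n \<le> m" for n m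
    using gs by (intro lift_Suc_mono_le[OF _ that]) blast
  have less: False if "n < m" "g n x \<noteq> 0" "g m x \<noteq> 0" for n m x
  proof -
    have "bump z (A (Suc n)) \<delta> x \<noteq> 0" using gs that(2) by blast
    then have "bump z (A m) \<delta> x \<noteq> 0"
      by (rule bump_nonzero_mono[OF \<delta> _ mono, rotated 2]) (use A that(1) in auto)
    then show False using gs that(3) by blast
  qed
  have "unconditionally_lipschitz z UNIV (2 * (1 + 2 / \<delta>)) g"
    by (rule unconditionally_lipschitz_disjoint_supports) (use gs less in \<open>auto, metis linorder_neqE_nat\<close>)
  then obtain n where "\<forall>m\<in>\<Gamma>. \<bar>m (g n)\<bar> \<le> \<epsilon> / 2" using small half_gt_zero[OF \<epsilon>] by blast
  then show False using gs[of n] by fastforce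
qed

section \<open>Elements of free spaces carried by a subset\<close>

lemma free_nrm_triangle:
  assumes "m \<in> vecs (free_space z N)" "m' \<in> vecs (free_space z N)"
  shows "nrm (free_space z N) (m + m') \<le> nrm (free_space z N) m + nrm (free_space z N) m'"
proof (rule free_nrm_le)
  fix f assume "lip_fn z N 1 f"
  from free_le[OF assms(1) this] free_le[OF assms(2) this]
  show "\<bar>(m + m') f\<bar> \<le> nrm (free_space z N) m + nrm (free_space z N) m'" by simp
qed

lemma free_nrm_scale_le:
  assumes "m \<in> vecs (free_space z N)"
  shows "nrm (free_space z N) (c *\<^sub>R m) \<le> \<bar>c\<bar> * nrm (free_space z N) m"
proof (rule free_nrm_le)
  fix f assume "lip_fn z N 1 f"
  from mult_left_mono[OF free_le[OF assms this] abs_ge_zero[of c]]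
  show "\<bar>(c *\<^sub>R m) f\<bar> \<le> \<bar>c\<bar> * nrm (free_space z N) m" by (simp add: abs_mult)
qed

text \<open>
  By the Hahn-Banach theorem for the distance to the span of the evaluations at points of \<open>K\<close>: an element at
  positive distance is separated from the span by a functional, and this functional is a function in \<open>Lip0\<close>
  that vanishes on \<open>K\<close>.
\<close>

lemma free_space_bipolar:
  assumes z: "z \<in> N" and K: "K \<subseteq> N" and m: "m \<in> vecs (free_space z N)"
    and ann: "\<And>f. f \<in> vecs (Lip0 z N) \<Longrightarrow> (\<And>x. x \<in> K \<Longrightarrow> f x = 0) \<Longrightarrow> m f = 0" and e: "0 < e"
  shows "\<exists>l. fst ` set l \<subseteq> K \<and> (\<forall>L f. lip_fn z N L f \<longrightarrow> \<bar>m f - atoms z N l f\<bar> \<le> e * L)"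
proof (rule ccontr)
  assume neg: "\<not> ?thesis"
  let ?F = "vecs (free_space z N)" and ?n = "nrm (free_space z N)"
  define S where "S = span (evaluation z N ` K)"
  have V: "subspace ?F" by (rule subspace_free_space[OF z])
  have S: "subspace S" unfolding S_def by (rule subspace_span)
  have SF: "s \<in> ?F" if s: "s \<in> S" for s
  proof -
    obtain l where "s = atoms z N l" "fst ` set l \<subseteq> K" using s unfolding S_def span_evaluation by blast
    then show ?thesis using atoms_free[OF z] K by blast
  qed
  define p where "p u = (INF s\<in>S. ?n (u - s))" for u
  have bdd: "bdd_below ((\<lambda>s. ?n (u - s)) ` S)" if "u \<in> ?F" for u
    using free_nrm_nonneg[OF subspace_diff[OF V that SF]] by (intro bdd_belowI2[where m = 0])
  have p_le: "p u \<le> ?n (u - s)" if "u \<in> ?F" "s \<in> S" for u s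
    unfolding p_def using bdd[OF that(1)] that(2) by (rule cINF_lower)
  have S_ne: "S \<noteq> {}" using subspace_0[OF S] by blast
  have p_ge: "r \<le> p u" if "\<And>s. s \<in> S \<Longrightarrow> r \<le> ?n (u - s)" for r u
    unfolding p_def using S_ne that by (rule cINF_greatest)
  have n0: "?n 0 = 0"
    using free_nrm_scale_le[OF subspace_0[OF V], of 0] free_nrm_nonneg[OF subspace_0[OF V]] by simp
  have p: "sublinear_on ?F p"
  proof (rule sublinear_onI[OF V])
    fix u v assume u: "u \<in> ?F" and v: "v \<in> ?F"
    have *: "p (u + v) \<le> ?n (u - s) + ?n (v - t)" if st: "s \<in> S" "t \<in> S" for s t
    proof -
      have "p (u + v) \<le> ?n ((u + v) - (s + t))"
        by (intro p_le subspace_add[OF V u v] subspace_add[OF S st])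
      also have "(u + v) - (s + t) = (u - s) + (v - t)" by simp
      also have "?n \<dots> \<le> ?n (u - s) + ?n (v - t)"
        by (intro free_nrm_triangle subspace_diff[OF V] u v SF st)
      finally show ?thesis .
    qed
    have "p (u + v) - ?n (u - s) \<le> p v" if s: "s \<in> S" for s
      using *[OF s] by (intro p_ge) (simp add: diff_le_eq add.commute)
    then have "p (u + v) - p v \<le> p u" by (intro p_ge) (simp add: algebra_simps)
    then show "p (u + v) \<le> p u + p v" by simp
  next
    have "0 \<le> p 0" by (intro p_ge free_nrm_nonneg subspace_diff[OF V] subspace_0[OF V] SF)
    then show "p 0 = 0" using p_le[OF subspace_0[OF V] subspace_0[OF S]] n0 by simp
  next
    fix u and c :: real assume u: "u \<in> ?F" and c: "0 < c"
    have "p (c *\<^sub>R u) / c \<le> ?n (u - s)" if s: "s \<in> S" for s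
    proof -
      have "p (c *\<^sub>R u) \<le> ?n (c *\<^sub>R u - c *\<^sub>R s)"
        by (intro p_le subspace_scale[OF V u] subspace_scale[OF S s])
      also have "\<dots> = ?n (c *\<^sub>R (u - s))" by (simp only: scaleR_diff_right)
      also have "\<dots> \<le> \<bar>c\<bar> * ?n (u - s)" by (intro free_nrm_scale_le subspace_diff[OF V u SF[OF s]])
      finally show ?thesis using c by (simp add: field_simps)
    qed
    then have "p (c *\<^sub>R u) / c \<le> p u" by (rule p_ge)
    then show "p (c *\<^sub>R u) \<le> c * p u" using c by (simp add: field_simps)
  qed
  obtain \<psi> where \<psi>_add: "\<And>x y. x \<in> ?F \<Longrightarrow> y \<in> ?F \<Longrightarrow> \<psi> (x + y) = \<psi> x + \<psi> y"
    and \<psi>_scale: "\<And>c x. x \<in> ?F \<Longrightarrow> \<psi> (c *\<^sub>R x) = c * \<psi> x"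
    and \<psi>_le: "\<And>x. x \<in> ?F \<Longrightarrow> \<psi> x \<le> p x" and \<psi>_m: "\<psi> m = p m"
    using Hahn_Banach_sublinear[OF V p m] by blast
  have \<psi>_abs: "\<bar>\<psi> u\<bar> \<le> ?n (u - s)" if u: "u \<in> ?F" and s: "s \<in> S" for u s
  proof -
    have "\<psi> u \<le> ?n (u - s)" using \<psi>_le[OF u] p_le[OF u s] by linarith
    moreover have "- \<psi> u \<le> ?n (u - s)"
    proof -
      have "- \<psi> u = \<psi> ((-1) *\<^sub>R u)" using \<psi>_scale[OF u, of "-1"] by simp
      also have "\<dots> \<le> p ((-1) *\<^sub>R u)" by (intro \<psi>_le subspace_scale[OF V u])
      also have "\<dots> \<le> ?n ((-1) *\<^sub>R u - (-1) *\<^sub>R s)"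
        by (intro p_le subspace_scale[OF V u] subspace_scale[OF S s])
      also have "\<dots> = ?n ((-1) *\<^sub>R (u - s))" by (simp only: scaleR_diff_right)
      also have "\<dots> \<le> \<bar>-1\<bar> * ?n (u - s)" by (intro free_nrm_scale_le subspace_diff[OF V u SF[OF s]])
      finally show ?thesis by simp
    qed
    ultimately show ?thesis by (simp add: abs_le_iff)
  qed
  define \<phi> where "\<phi> u = (if u \<in> ?F then \<psi> u else 0)" for u
  have \<phi>_bound: "\<bar>\<phi> u\<bar> \<le> 1 * ?n u" if "u \<in> ?F" for u
    using \<psi>_abs[OF that subspace_0[OF S]] that by (simp add: \<phi>_def)
  have \<phi>: "\<phi> \<in> vecs (dual (free_space z N))"
  proof (rule dualI[where C = 1])
    show "\<bar>\<phi> u\<bar> \<le> 1 * ?n u" if "u \<in> ?F" for u using \<phi>_bound[OF that] .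
  qed (simp_all add: \<phi>_def \<psi>_add \<psi>_scale subspace_add[OF V] subspace_scale[OF V])
  obtain f where f: "lip_fn z N 1 f" "\<And>u. u \<in> ?F \<Longrightarrow> \<phi> u = u f"
    and f_ev: "\<And>x. x \<in> N \<Longrightarrow> f x = \<phi> (evaluation z N x)"
    using dual_free_space_representation[OF z \<phi> zero_le_one \<phi>_bound] by metis
  have "f x = 0" if x: "x \<in> K" for x
  proof -
    have ev: "evaluation z N x \<in> S" unfolding S_def using x by (intro span_base) blast
    have "\<bar>\<psi> (evaluation z N x)\<bar> \<le> ?n (evaluation z N x - evaluation z N x)"
      by (rule \<psi>_abs[OF SF[OF ev] ev])
    then have "\<psi> (evaluation z N x) = 0" using n0 by simp
    then show ?thesis using f_ev x K SF[OF ev] by (auto simp: \<phi>_def)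
  qed
  then have "m f = 0" using ann[OF lip_fnD(5)[OF f(1)]] by blast
  then have "p m = 0" using f(2)[OF m] m \<psi>_m by (simp add: \<phi>_def)
  moreover have "e \<le> p m"
  proof (rule p_ge)
    fix s assume s: "s \<in> S"
    then obtain l where l: "s = atoms z N l" "fst ` set l \<subseteq> K" unfolding S_def span_evaluation by blast
    have "\<not> (\<forall>L f. lip_fn z N L f \<longrightarrow> \<bar>m f - atoms z N l f\<bar> \<le> e * L)" using neg l(2) by blast
    then obtain L g where g: "lip_fn z N L g" "e * L < \<bar>(m - s) g\<bar>" unfolding l(1) minus_apply not_all not_imp not_le by blast
    have "\<bar>(m - s) g\<bar> \<le> ?n (m - s) * L" by (rule free_le[OF subspace_diff[OF V m SF[OF s]] g(1)])
    then have "e * L < ?n (m - s) * L" using g(2) by linarith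
    from mult_right_less_imp_less[OF this lip_fnD(1)[OF g(1)]] show "e \<le> ?n (m - s)" by simp
  qed
  ultimately show False using e by simp
qed

text \<open>
  Two Lipschitz extensions of a function on \<open>K\<close> differ by a function that vanishes on \<open>K\<close>. So the value of \<open>m\<close> at
  an extension depends on the given function only, and \<open>free_space_bipolar\<close> provides the approximation by
  finitely supported elements carried by \<open>K\<close>.
\<close>

lemma free_space_restrict_support:
  assumes zK: "z \<in> K" and m: "m \<in> vecs (free_space z UNIV)"
    and ann: "\<And>f. f \<in> vecs (Lip0 z UNIV) \<Longrightarrow> (\<And>x. x \<in> K \<Longrightarrow> f x = 0) \<Longrightarrow> m f = 0"
  obtains m' where "m' \<in> vecs (free_space z K)"
    "\<And>f g. f \<in> vecs (Lip0 z K) \<Longrightarrow> g \<in> vecs (Lip0 z UNIV) \<Longrightarrow> (\<And>x. x \<in> K \<Longrightarrow> g x = f x) \<Longrightarrow> m' f = m g"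
proof
  define ext where "ext f = (SOME g. g \<in> vecs (Lip0 z UNIV) \<and> (\<forall>x\<in>K. g x = f x))" for f
  define m' where "m' f = (if f \<in> vecs (Lip0 z K) then m (ext f) else 0)" for f
  have ext: "ext f \<in> vecs (Lip0 z UNIV) \<and> (\<forall>x\<in>K. ext f x = f x)" if f: "f \<in> vecs (Lip0 z K)" for f
  proof -
    obtain L where "lip_fn z K L f" using f vecs_Lip0 by blast
    then obtain g where "lip_fn z UNIV L g" "\<And>x. x \<in> K \<Longrightarrow> g x = f x" using McShane_extension[OF _ zK] by blast
    then have "\<exists>g. g \<in> vecs (Lip0 z UNIV) \<and> (\<forall>x\<in>K. g x = f x)" using lip_fnD(5) by blast
    then show ?thesis unfolding ext_def by (rule someI_ex)
  qed
  show eq: "m' f = m g"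
    if f: "f \<in> vecs (Lip0 z K)" and g: "g \<in> vecs (Lip0 z UNIV)" "\<And>x. x \<in> K \<Longrightarrow> g x = f x" for f g
  proof -
    have "m (ext f - g) = 0"
      by (rule ann) (use ext[OF f] g in \<open>auto intro: subspace_diff[OF subspace_Lip0]\<close>)
    then show ?thesis using free_diff[OF m conjunct1[OF ext[OF f]] g(1)] f by (simp add: m'_def)
  qed
  have "\<exists>l. fst ` set l \<subseteq> K \<and> (\<forall>L f. lip_fn z K L f \<longrightarrow> \<bar>m' f - atoms z K l f\<bar> \<le> e * L)" if e: "0 < e" for e
  proof -
    obtain l where l: "fst ` set l \<subseteq> K" "\<And>L f. lip_fn z UNIV L f \<Longrightarrow> \<bar>m f - atoms z UNIV l f\<bar> \<le> e * L"
      using free_space_bipolar[where m = m and K = K, OF UNIV_I subset_UNIV m ann e] by blast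
    have "\<bar>m' f - atoms z K l f\<bar> \<le> e * L" if f: "lip_fn z K L f" for L f
    proof -
      obtain g where g: "lip_fn z UNIV L g" "\<And>x. x \<in> K \<Longrightarrow> g x = f x" using McShane_extension[OF f zK] by blast
      have "m' f = m g" by (rule eq[OF lip_fnD(5)[OF f] lip_fnD(5)[OF g(1)] g(2)])
      moreover have "(\<Sum>(x, a)\<leftarrow>l. a * f x) = (\<Sum>(x, a)\<leftarrow>l. a * g x)"
        using l(1) g(2) by (intro sum_list_weights_cong) auto
      then have "atoms z K l f = atoms z UNIV l g"
        using lip_fnD(5)[OF f] lip_fnD(5)[OF g(1)] by (simp add: atoms_def)
      ultimately show ?thesis using l(2)[OF g(1)] by simp
    qed
    with l(1) show ?thesis by blast
  qed
  then show "m' \<in> vecs (free_space z K)" unfolding free_space_iff[OF zK] by (auto simp: m'_def)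
qed

lemma geometric_increments_converge:
  fixes a :: "nat \<Rightarrow> real"
  assumes inc: "\<And>k. \<bar>a (Suc k) - a k\<bar> \<le> D / 2 ^ Suc k"
  shows "convergent a" "\<bar>lim a - a k\<bar> \<le> D / 2 ^ k"
proof -
  have step: "\<bar>a (k + j) - a k\<bar> \<le> D / 2 ^ k - D / 2 ^ (k + j)" for k j
  proof (induction j)
    case (Suc j)
    have "D / 2 ^ (k + j) - D / 2 ^ Suc (k + j) = D / 2 ^ Suc (k + j)" by (simp add: field_simps)
    then show ?case using Suc inc[of "k + j"] by simp
  qed simp
  have D: "0 \<le> D" using order_trans[OF abs_ge_zero inc[of 0]] by simp
  have bound: "\<bar>a (k + j) - a k\<bar> \<le> D / 2 ^ k" for k j
    using step[of k j] D by (smt (verit) divide_nonneg_pos zero_less_power)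
  have "Cauchy a"
  proof (rule metric_CauchyI)
    fix e :: real assume "0 < e"
    have "(\<lambda>k. D / 2 ^ k) \<longlonglongrightarrow> 0" by (rule LIMSEQ_divide_realpow_zero) simp
    then have "\<forall>\<^sub>F k in sequentially. D / 2 ^ k < e / 2" using \<open>0 < e\<close> by (intro order_tendstoD) auto
    then obtain M where M: "D / 2 ^ M < e / 2" using eventually_happens'[OF sequentially_bot] by blast
    have "dist (a m) (a n) < e" if "M \<le> m" "M \<le> n" for m n
    proof -
      have "\<bar>a m - a M\<bar> \<le> D / 2 ^ M" "\<bar>a n - a M\<bar> \<le> D / 2 ^ M"
        using bound[of M "m - M"] bound[of M "n - M"] that by simp_all
      then show ?thesis using M unfolding dist_real_def by linarith
    qed
    then show "\<exists>M. \<forall>m\<ge>M. \<forall>n\<ge>M. dist (a m) (a n) < e" by blast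
  qed
  then show conv: "convergent a" by (simp add: Cauchy_convergent_iff)
  have "(\<lambda>j. \<bar>a (j + k) - a k\<bar>) \<longlonglongrightarrow> \<bar>lim a - a k\<bar>"
    using conv unfolding convergent_LIMSEQ_iff by (intro tendsto_intros LIMSEQ_ignore_initial_segment)
  then show "\<bar>lim a - a k\<bar> \<le> D / 2 ^ k"
    by (rule LIMSEQ_le_const2) (use bound[of k] in \<open>auto simp: add.commute\<close>)
qed

lemma multiplier_prod:
  assumes "\<And>i. multiplier z (c i) (h i)"
  shows "multiplier z (\<Sum>i<k. c i) (\<lambda>x. \<Prod>i<(k::nat). h i x)"
proof (induction k)
  case (Suc k)
  then show ?case using multiplier_mult[OF Suc assms[of k]] by simp
qed (simp add: multiplier_one)

section \<open>Cutting off to a compact set\<close>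

text \<open>
  The neighbourhood of the finite set \<open>A 0\<close> is bounded, hence on it the radii of the neighbourhoods of \<open>A i\<close> tend to
  \<open>0\<close> uniformly, and the sequence is totally bounded. The factor \<open>1 / 4\<close> is there to make the first
  neighbourhood bounded although its radius grows with the distance from \<open>z\<close>.
\<close>

lemma nested_neighbourhoods_convergent_subsequence:
  fixes A :: "nat \<Rightarrow> 'a::complete_space set"
  assumes A: "\<And>i. finite (A i)" "\<And>i. z \<in> A i"
    and x: "\<And>k i. i < k \<Longrightarrow> infdist (x k) (A i) \<le> (1 + dist (x k) z) / (4 * 2 ^ i)"
  obtains l r where "strict_mono r" "(x \<circ> r) \<longlonglongrightarrow> l"
    "\<And>i. infdist l (A i) \<le> (1 + dist l z) / (4 * 2 ^ i)"
proof -
  have A_ne: "A i \<noteq> {}" for i using A(2) by blast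
  have near: "\<exists>a\<in>A i. dist (x k) a \<le> (1 + dist (x k) z) / (4 * 2 ^ i)" if "i < k" for i k
  proof -
    have "infdist (x k) (A i) = Min (dist (x k) ` A i)"
      using A_ne A(1) by (simp add: infdist_notempty cInf_eq_Min)
    also have "\<dots> \<in> dist (x k) ` A i" using A_ne A(1) by (intro Min_in) auto
    finally show ?thesis using x[OF that] by auto
  qed
  obtain R where R: "\<And>a. a \<in> A 0 \<Longrightarrow> dist a z \<le> R"
    using finite_imp_bounded[OF A(1)[of 0]] unfolding bounded_any_center[where a = z] by (metis dist_commute)
  have R_nonneg: "0 \<le> R" using R[OF A(2)] by simp
  have x_bound: "1 + dist (x k) z \<le> 2 * (R + 1)" if k: "0 < k" for k
  proof -
    obtain a where a: "a \<in> A 0" "dist (x k) a \<le> (1 + dist (x k) z) / 4" using near[OF k] by auto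
    have "dist (x k) z \<le> dist (x k) a + dist a z" by (rule dist_triangle)
    moreover have "4 * dist (x k) a \<le> 1 + dist (x k) z" using a(2) by simp
    ultimately show ?thesis using R[OF a(1)] R_nonneg by (simp add: algebra_simps)
  qed
  have "compact (closure (range x))"
    unfolding compact_eq_totally_bounded
  proof (intro conjI allI impI)
    show "complete (closure (range x))" by (simp add: complete_eq_closed)
    fix e :: real assume e: "0 < e"
    have "(\<lambda>i. (R + 1) / 2 ^ i) \<longlonglongrightarrow> 0" by (rule LIMSEQ_divide_realpow_zero) simp
    then have "\<forall>\<^sub>F i in sequentially. (R + 1) / 2 ^ i < e" using e by (intro order_tendstoD) auto
    then obtain i where i: "(R + 1) / 2 ^ i < e" using eventually_happens'[OF sequentially_bot] by blast
    define F where "F = A i \<union> x ` {..i}"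
    have "range x \<subseteq> (\<Union>a\<in>F. cball a (e / 2))"
    proof
      fix y assume "y \<in> range x"
      then obtain k where k: "y = x k" by blast
      show "y \<in> (\<Union>a\<in>F. cball a (e / 2))"
      proof (cases "k \<le> i")
        case True
        then have "x k \<in> F" by (simp add: F_def)
        moreover have "x k \<in> cball (x k) (e / 2)" using e by simp
        ultimately show ?thesis unfolding k by blast
      next
        case False
        then obtain a where a: "a \<in> A i" "dist (x k) a \<le> (1 + dist (x k) z) / (4 * 2 ^ i)"
          using near[of i k] by auto
        have "(1 + dist (x k) z) / (4 * 2 ^ i) \<le> 2 * (R + 1) / (4 * 2 ^ i)"
          using x_bound[of k] False by (intro divide_right_mono) auto
        also have "\<dots> = (R + 1) / 2 ^ i / 2" by (simp add: field_simps)
        also have "\<dots> \<le> e / 2" by (rule divide_right_mono[OF less_imp_le[OF i]]) simp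
        finally have "dist (x k) a \<le> e / 2" by (rule order_trans[OF a(2)])
        then have "x k \<in> cball a (e / 2)" by (simp add: dist_commute)
        then show ?thesis using a(1) unfolding k F_def by blast
      qed
    qed
    moreover have F: "finite F" using A(1) by (simp add: F_def)
    then have "closed (\<Union>a\<in>F. cball a (e / 2))" by (intro closed_UN) auto
    ultimately have "closure (range x) \<subseteq> (\<Union>a\<in>F. cball a (e / 2))" by (rule closure_minimal)
    also have "\<dots> \<subseteq> (\<Union>a\<in>F. ball a e)" using e by (intro UN_mono) auto
    finally show "\<exists>F. finite F \<and> closure (range x) \<subseteq> (\<Union>a\<in>F. ball a e)" using F by blast
  qed
  moreover have "\<forall>n. x n \<in> closure (range x)" using closure_subset[of "range x"] by blast
  ultimately obtain l r where r: "strict_mono r" and l: "(x \<circ> r) \<longlonglongrightarrow> l"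
    unfolding compact_def by metis
  have "infdist l (A i) \<le> (1 + dist l z) / (4 * 2 ^ i)" for i
  proof (rule LIMSEQ_le)
    show "(\<lambda>n. infdist ((x \<circ> r) n) (A i)) \<longlonglongrightarrow> infdist l (A i)"
      by (intro tendsto_infdist l)
    show "(\<lambda>n. (1 + dist ((x \<circ> r) n) z) / (4 * 2 ^ i)) \<longlonglongrightarrow> (1 + dist l z) / (4 * 2 ^ i)"
      by (intro tendsto_intros l) simp
    have "infdist ((x \<circ> r) n) (A i) \<le> (1 + dist ((x \<circ> r) n) z) / (4 * 2 ^ i)" if "Suc i \<le> n" for n
      using x[of i "r n"] seq_suble[OF r, of n] that by simp
    then show "\<exists>N. \<forall>n\<ge>N. infdist ((x \<circ> r) n) (A i) \<le> (1 + dist ((x \<circ> r) n) z) / (4 * 2 ^ i)" by blast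
  qed
  then show ?thesis by (rule that[OF r l])
qed

lemma nested_neighbourhoods_compact:
  fixes A :: "nat \<Rightarrow> 'a::complete_space set"
  assumes A: "\<And>i. finite (A i)" "\<And>i. z \<in> A i"
  defines "K \<equiv> {x. \<forall>i. infdist x (A i) \<le> (1 + dist x z) / (4 * 2 ^ i)}"
  shows "compact K" "z \<in> K"
    "\<And>U. open U \<Longrightarrow> K \<subseteq> U \<Longrightarrow>
      \<exists>k\<^sub>0. \<forall>k\<ge>k\<^sub>0. {x. \<forall>i<k. infdist x (A i) \<le> (1 + dist x z) / (4 * 2 ^ i)} \<subseteq> U"
proof -
  show "z \<in> K" using A(2) by (simp add: K_def)
  show "compact K" unfolding compact_def
  proof (intro allI impI)
    fix x :: "nat \<Rightarrow> 'a" assume "\<forall>n. x n \<in> K"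
    then obtain l and r :: "nat \<Rightarrow> nat" where "strict_mono r" "(x \<circ> r) \<longlonglongrightarrow> l"
      "\<And>i. infdist l (A i) \<le> (1 + dist l z) / (4 * 2 ^ i)"
      using nested_neighbourhoods_convergent_subsequence[where A = A and x = x and z = z, OF A] unfolding K_def mem_Collect_eq by metis
    then show "\<exists>l\<in>K. \<exists>r. strict_mono r \<and> (x \<circ> r) \<longlonglongrightarrow> l" unfolding K_def by blast
  qed
  fix U assume U: "open U" "K \<subseteq> U"
  show "\<exists>k\<^sub>0. \<forall>k\<ge>k\<^sub>0. {x. \<forall>i<k. infdist x (A i) \<le> (1 + dist x z) / (4 * 2 ^ i)} \<subseteq> U"
  proof (rule ccontr)
    assume "\<not> ?thesis"
    then have "\<exists>x. x \<notin> U \<and> (\<forall>i<k. infdist x (A i) \<le> (1 + dist x z) / (4 * 2 ^ i))" for k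
      by (smt (verit) le_trans less_le_trans mem_Collect_eq subsetI)
    then obtain x where x: "\<And>k. x k \<notin> U"
      "\<And>k i. i < k \<Longrightarrow> infdist (x k) (A i) \<le> (1 + dist (x k) z) / (4 * 2 ^ i)" by metis
    obtain l and r :: "nat \<Rightarrow> nat" where l: "(x \<circ> r) \<longlonglongrightarrow> l" "\<And>i. infdist l (A i) \<le> (1 + dist l z) / (4 * 2 ^ i)"
      using nested_neighbourhoods_convergent_subsequence[where A = A and x = x and z = z, OF A x(2)] by metis
    have "l \<in> - U"
      by (rule closed_sequentially[OF _ _ l(1)]) (use U x(1) in auto)
    then show False using l(2) U(2) by (auto simp: K_def)
  qed
qed

text \<open>
  The limit of the adjoints of the multiplications by \<open>H k\<close>.
\<close>

definition cutoff_limit :: "'a::metric_space \<Rightarrow> (nat \<Rightarrow> 'a \<Rightarrow> real) \<Rightarrow> (('a \<Rightarrow> real) \<Rightarrow> real) \<Rightarrow> ('a \<Rightarrow> real) \<Rightarrow> real"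
  where "cutoff_limit z H \<gamma> = (\<lambda>f. if f \<in> vecs (Lip0 z UNIV) then lim (\<lambda>k. \<gamma> (\<lambda>x. H k x * f x)) else 0)"

lemma cutoff_limit_le:
  assumes f: "lip_fn z UNIV L f"
    and inc: "\<And>k. \<bar>\<gamma> (\<lambda>x. H (Suc k) x * f x) - \<gamma> (\<lambda>x. H k x * f x)\<bar> \<le> \<epsilon> * L / 2 ^ Suc k"
  shows "\<bar>cutoff_limit z H \<gamma> f - \<gamma> (\<lambda>x. H k x * f x)\<bar> \<le> \<epsilon> * L / 2 ^ k"
  using geometric_increments_converge(2)[of "\<lambda>k. \<gamma> (\<lambda>x. H k x * f x)" "\<epsilon> * L" k] inc lip_fnD(5)[OF f]
  by (simp add: cutoff_limit_def)

lemma cutoff_limit_free: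
  assumes \<gamma>: "\<gamma> \<in> vecs (free_space z UNIV)"
    and H: "\<And>k. multiplier z (c k) (H k)" "\<And>k. 0 \<le> c k"
    and inc: "\<And>k L f. lip_fn z UNIV L f \<Longrightarrow>
      \<bar>\<gamma> (\<lambda>x. H (Suc k) x * f x) - \<gamma> (\<lambda>x. H k x * f x)\<bar> \<le> \<epsilon> * L / 2 ^ Suc k"
  shows "cutoff_limit z H \<gamma> \<in> vecs (free_space z UNIV)"
  unfolding free_space_iff[OF UNIV_I]
proof (intro conjI allI impI)
  show "cutoff_limit z H \<gamma> f = 0" if "f \<notin> vecs (Lip0 z UNIV)" for f using that by (simp add: cutoff_limit_def)
  fix e :: real assume e: "0 < e"
  have "(\<lambda>k. \<epsilon> / 2 ^ k) \<longlonglongrightarrow> 0" by (rule LIMSEQ_divide_realpow_zero) simp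
  then have "\<forall>\<^sub>F k in sequentially. \<epsilon> / 2 ^ k < e / 2" using e by (intro order_tendstoD) auto
  then obtain k where k: "\<epsilon> / 2 ^ k < e / 2" using eventually_happens'[OF sequentially_bot] by blast
  define d where "d = e / (2 * (1 + c k))"
  have ck: "0 < 1 + c k" using H(2)[of k] by simp
  have "e / (2 * C) * C = e / 2" if "0 < C" for C using that by simp
  then have d: "0 < d" "d * (1 + c k) = e / 2" using e ck unfolding d_def by (simp, blast)
  obtain l where l: "\<And>L f. lip_fn z UNIV L f \<Longrightarrow> \<bar>\<gamma> f - atoms z UNIV l f\<bar> \<le> d * L"
    using free_approx[OF UNIV_I \<gamma> d(1)] by metis
  define l' where "l' = map (\<lambda>(x, a). (x, H k x * a)) l"
  have "\<bar>cutoff_limit z H \<gamma> f - atoms z UNIV l' f\<bar> \<le> e * L" if f: "lip_fn z UNIV L f" for L f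
  proof -
    have g: "lip_fn z UNIV ((1 + c k) * L) (\<lambda>x. H k x * f x)" by (rule lip_fn_multiplier[OF H f])
    have "atoms z UNIV l' f = atoms z UNIV l (\<lambda>x. H k x * f x)"
      using lip_fnD(5)[OF f] lip_fnD(5)[OF g] sum_list_map_weights[of f "H k" l] by (simp add: atoms_def l'_def)
    moreover have "\<bar>\<gamma> (\<lambda>x. H k x * f x) - atoms z UNIV l (\<lambda>x. H k x * f x)\<bar> \<le> e / 2 * L"
      using l[OF g] unfolding mult.assoc[symmetric] d(2) .
    moreover have "\<bar>cutoff_limit z H \<gamma> f - \<gamma> (\<lambda>x. H k x * f x)\<bar> \<le> \<epsilon> / 2 ^ k * L"
      using cutoff_limit_le[OF f, where \<gamma> = \<gamma> and H = H and k = k and \<epsilon> = \<epsilon>] inc[OF f] by simp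
    moreover have "\<epsilon> / 2 ^ k * L \<le> e / 2 * L" using k lip_fnD(1)[OF f] by (intro mult_right_mono) auto
    moreover have "e * L = e / 2 * L + e / 2 * L" by simp
    ultimately show ?thesis by linarith
  qed
  then show "\<exists>l. fst ` set l \<subseteq> UNIV \<and> (\<forall>L f. lip_fn z UNIV L f \<longrightarrow> \<bar>cutoff_limit z H \<gamma> f - atoms z UNIV l f\<bar> \<le> e * L)"
    by blast
qed

text \<open>
  On functions with a common Lipschitz constant, elements of the free space are continuous for uniform
  convergence, because finitely supported ones are.
\<close>

lemma free_small_on_uniformly_small:
  assumes m: "m \<in> vecs (free_space z UNIV)" and e: "0 < e"
  obtains \<eta> where "0 < \<eta>" "\<And>f. lip_fn z UNIV L f \<Longrightarrow> (\<And>x. \<bar>f x\<bar> \<le> \<eta>) \<Longrightarrow> \<bar>m f\<bar> \<le> e"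
proof -
  define d where "d = e / (2 * (\<bar>L\<bar> + 1))"
  have d: "0 < d" "d * \<bar>L\<bar> \<le> e / 2" using e by (simp_all add: d_def field_simps)
  obtain l where l: "\<And>L f. lip_fn z UNIV L f \<Longrightarrow> \<bar>m f - atoms z UNIV l f\<bar> \<le> d * L"
    using free_approx[OF UNIV_I m d(1)] by metis
  define S where "S = (\<Sum>(x, a)\<leftarrow>l. \<bar>a\<bar>)"
  have S: "0 \<le> S" unfolding S_def by (intro sum_list_nonneg) auto
  define \<eta> where "\<eta> = e / (2 * (S + 1))"
  have \<eta>: "0 < \<eta>" "\<eta> * S \<le> e / 2" using e S by (simp_all add: \<eta>_def field_simps)
  have "\<bar>m f\<bar> \<le> e" if f: "lip_fn z UNIV L f" and small: "\<And>x. \<bar>f x\<bar> \<le> \<eta>" for f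
  proof -
    have "\<bar>\<Sum>(x, a)\<leftarrow>l. a * f x\<bar> \<le> \<eta> * (\<Sum>(x, a)\<leftarrow>l. \<bar>a\<bar>)"
    proof (induction l)
      case (Cons p l)
      have "\<bar>snd p * f (fst p)\<bar> \<le> \<bar>snd p\<bar> * \<eta>" unfolding abs_mult by (intro mult_left_mono small) simp
      then show ?case using Cons by (simp add: case_prod_beta algebra_simps)
    qed simp
    then have "\<bar>atoms z UNIV l f\<bar> \<le> e / 2" using \<eta>(2) lip_fnD(5)[OF f] by (simp add: atoms_def S_def)
    moreover have "d * L \<le> e / 2" using d lip_fnD(1)[OF f] by simp
    ultimately show ?thesis using l[OF f] by linarith
  qed
  then show ?thesis using \<eta>(1) that by blast
qed

lemma lip_fn_clip:
  assumes f: "lip_fn z UNIV L f" and \<eta>: "0 \<le> \<eta>"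
  shows "lip_fn z UNIV L (\<lambda>x. max (- \<eta>) (min \<eta> (f x)))"
proof (rule lip_fnI)
  fix x y
  have "\<bar>max (- \<eta>) (min \<eta> (f x)) - max (- \<eta>) (min \<eta> (f y))\<bar> \<le> \<bar>f x - f y\<bar>"
    by (auto simp: max_def min_def)
  also have "\<dots> \<le> L * dist x y" by (rule lip_fnD(2)[OF f]) simp_all
  finally show "\<bar>max (- \<eta>) (min \<eta> (f x)) - max (- \<eta>) (min \<eta> (f y))\<bar> \<le> L * dist x y" .
qed (use \<eta> lip_fnD[OF f] in auto)

text \<open>
  A function \<open>f\<close> that vanishes on \<open>K\<close> is smaller than \<open>\<eta>\<close> near \<open>K\<close>, hence on the support of \<open>H k\<close> for large \<open>k\<close>.
  So \<open>f\<close> may be replaced by its truncation at height \<open>\<eta>\<close>, which has the same Lipschitz constant, and for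
  \<open>\<eta> \<rightarrow> 0\<close> the values at the truncations tend to \<open>0\<close>.
\<close>

lemma cutoff_limit_annihilates:
  assumes \<gamma>: "\<gamma> \<in> vecs (free_space z UNIV)"
    and T: "cutoff_limit z H \<gamma> \<in> vecs (free_space z UNIV)"
    and inc: "\<And>k L f. lip_fn z UNIV L f \<Longrightarrow>
      \<bar>\<gamma> (\<lambda>x. H (Suc k) x * f x) - \<gamma> (\<lambda>x. H k x * f x)\<bar> \<le> \<epsilon> * L / 2 ^ Suc k"
    and supp: "\<And>U. open U \<Longrightarrow> K \<subseteq> U \<Longrightarrow> \<exists>k\<^sub>0. \<forall>k\<ge>k\<^sub>0. {x. H k x \<noteq> 0} \<subseteq> U"
    and f: "f \<in> vecs (Lip0 z UNIV)" "\<And>x. x \<in> K \<Longrightarrow> f x = 0"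
  shows "cutoff_limit z H \<gamma> f = 0"
proof -
  let ?T = "cutoff_limit z H \<gamma>"
  obtain L where L: "lip_fn z UNIV L f" using f(1) vecs_Lip0 by blast
  have clip: "?T f = ?T (\<lambda>x. max (- \<eta>) (min \<eta> (f x)))" if \<eta>: "0 < \<eta>" for \<eta>
  proof -
    let ?c = "\<lambda>x. max (- \<eta>) (min \<eta> (f x))"
    have c: "lip_fn z UNIV L ?c" by (rule lip_fn_clip[OF L]) (use \<eta> in simp)
    have d: "lip_fn z UNIV (L + L) (f - ?c)" by (rule lip_fn_diff[OF L c])
    have cont: "continuous_on UNIV f" using L unfolding lip_fn_def by (blast intro: lipschitz_on_continuous_on)
    have "open {x. \<bar>f x\<bar> < \<eta>}"
      by (intro open_Collect_less continuous_intros cont)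
    moreover have "K \<subseteq> {x. \<bar>f x\<bar> < \<eta>}" using f(2) \<eta> by auto
    ultimately obtain k\<^sub>0 where k\<^sub>0: "\<And>k. k\<^sub>0 \<le> k \<Longrightarrow> {x. H k x \<noteq> 0} \<subseteq> {x. \<bar>f x\<bar> < \<eta>}"
      using supp by blast
    have small: "\<bar>?T (f - ?c)\<bar> \<le> \<epsilon> * (L + L) / 2 ^ k" if k: "k\<^sub>0 \<le> k" for k
    proof -
      have "H k x * (f - ?c) x = 0" for x
        using k\<^sub>0[OF k] by (cases "H k x = 0") (auto simp: max_def min_def)
      then have "(\<lambda>x. H k x * (f - ?c) x) = 0" by (simp add: fun_eq_iff)
      then have "\<gamma> (\<lambda>x. H k x * (f - ?c) x) = 0" using free_zero[OF \<gamma>] by simp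
      then show ?thesis
        using cutoff_limit_le[OF d, where \<gamma> = \<gamma> and H = H and k = k and \<epsilon> = \<epsilon>] inc[OF d] by simp
    qed
    have "(\<lambda>k. \<epsilon> * (L + L) / 2 ^ k) \<longlonglongrightarrow> 0" by (rule LIMSEQ_divide_realpow_zero) simp
    then have "\<bar>?T (f - ?c)\<bar> \<le> 0" by (rule LIMSEQ_le_const) (use small in blast)
    then show ?thesis using free_diff[OF T f(1) lip_fnD(5)[OF c]] by simp
  qed
  have "\<bar>?T f\<bar> \<le> e" if e: "0 < e" for e
  proof -
    obtain \<eta> where \<eta>: "0 < \<eta>" "\<And>g. lip_fn z UNIV L g \<Longrightarrow> (\<And>x. \<bar>g x\<bar> \<le> \<eta>) \<Longrightarrow> \<bar>?T g\<bar> \<le> e"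
      using free_small_on_uniformly_small[OF T e] by metis
    show ?thesis unfolding clip[OF \<eta>(1)]
      by (rule \<eta>(2)[OF lip_fn_clip[OF L]]) (use \<eta>(1) in \<open>auto simp: max_def min_def\<close>)
  qed
  then show ?thesis using field_le_epsilon[of "\<bar>?T f\<bar>" 0] by simp
qed

section \<open>Compact reduction\<close>

text \<open>
  If \<open>h\<close> vanishes at \<open>v\<close>, the difference \<open>h u * f n u - h v * f n v\<close> equals \<open>f n u * (h u - h v)\<close>. The multiplier
  inequality controls this for every \<open>v\<close>, inside or outside \<open>N\<close>, and so the extension by zero is Lipschitz however
  close the support of \<open>h\<close> comes to the complement of \<open>N\<close>.
\<close>

lemma unconditionally_lipschitz_multiplier:
  assumes f: "unconditionally_lipschitz z N C f" and z: "z \<in> N"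
    and h: "multiplier z c h" and c: "0 \<le> c" and supp: "{x. h x \<noteq> 0} \<subseteq> N"
  shows "unconditionally_lipschitz z UNIV ((1 + c) * C) (\<lambda>n x. h x * f n x)"
  unfolding unconditionally_lipschitz_def
proof (intro conjI allI ballI impI)
  have C: "0 \<le> C" using f by (simp add: unconditionally_lipschitz_def)
  show "0 \<le> (1 + c) * C" using C c by simp
  show "h z * f n z = 0" for n using f by (simp add: unconditionally_lipschitz_def)
  show "h x * f n x = 0" if "x \<notin> UNIV" for n x using that by simp
  fix x y :: 'a and k :: nat
  have size: "(\<Sum>n<k. \<bar>f n u\<bar>) \<le> C * (1 + dist u z)" if u: "u \<in> N" for u
  proof -
    have "(\<Sum>n<k. \<bar>f n u\<bar>) = (\<Sum>n<k. \<bar>f n u - f n z\<bar>)"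
      using f by (simp add: unconditionally_lipschitz_def)
    also have "\<dots> \<le> C * dist u z" using f u z unfolding unconditionally_lipschitz_def by blast
    also have "\<dots> \<le> C * (1 + dist u z)" using C by (intro mult_left_mono) auto
    finally show ?thesis .
  qed
  have vary: "(\<Sum>n<k. \<bar>f n u\<bar> * \<bar>h u - h v\<bar>) \<le> c * C * dist u v" if u: "u \<in> N" for u v
  proof -
    have "(\<Sum>n<k. \<bar>f n u\<bar> * \<bar>h u - h v\<bar>) = (\<Sum>n<k. \<bar>f n u\<bar>) * \<bar>h u - h v\<bar>"
      by (simp add: sum_distrib_right)
    also have "\<dots> \<le> C * (1 + dist u z) * \<bar>h u - h v\<bar>" using size[OF u] by (intro mult_right_mono) auto
    also have "\<dots> \<le> C * (c * dist u v)"
      unfolding mult.assoc using C by (intro mult_left_mono multiplierD(3)[OF h])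
    finally show ?thesis by (simp add: mult_ac)
  qed
  have outside: "(\<Sum>n<k. \<bar>h u * f n u - h v * f n v\<bar>) \<le> (1 + c) * C * dist u v" if v: "h v = 0" for u v
  proof (cases "u \<in> N")
    case True
    have "(\<Sum>n<k. \<bar>h u * f n u - h v * f n v\<bar>) = (\<Sum>n<k. \<bar>f n u\<bar> * \<bar>h u - h v\<bar>)"
      by (simp add: v abs_mult mult.commute)
    also have "\<dots> \<le> c * C * dist u v" by (rule vary[OF True])
    also have "\<dots> \<le> (1 + c) * C * dist u v" using C by (intro mult_right_mono) auto
    finally show ?thesis .
  next
    case False
    then have "h u = 0" using supp by blast
    then show ?thesis using v C c by simp
  qed
  show "(\<Sum>n<k. \<bar>h x * f n x - h y * f n y\<bar>) \<le> (1 + c) * C * dist x y"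
  proof (cases "h x = 0 \<or> h y = 0")
    case True
    then show ?thesis using outside[of x y] outside[of y x] by (auto simp: abs_minus_commute dist_commute)
  next
    case False
    then have xy: "x \<in> N" "y \<in> N" using supp by auto
    have "(\<Sum>n<k. \<bar>h x * f n x - h y * f n y\<bar>) \<le> (\<Sum>n<k. \<bar>f n x\<bar> * \<bar>h x - h y\<bar> + \<bar>f n x - f n y\<bar>)"
    proof (rule sum_mono)
      fix n
      have "\<bar>h x * f n x - h y * f n y\<bar> = \<bar>f n x * (h x - h y) + h y * (f n x - f n y)\<bar>"
        by (simp add: algebra_simps)
      also have "\<dots> \<le> \<bar>f n x\<bar> * \<bar>h x - h y\<bar> + h y * \<bar>f n x - f n y\<bar>"
        using multiplierD(1)[OF h] by (intro order_trans[OF abs_triangle_ineq]) (simp add: abs_mult)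
      also have "h y * \<bar>f n x - f n y\<bar> \<le> 1 * \<bar>f n x - f n y\<bar>"
        using multiplierD(2)[OF h] by (intro mult_right_mono) auto
      finally show "\<bar>h x * f n x - h y * f n y\<bar> \<le> \<bar>f n x\<bar> * \<bar>h x - h y\<bar> + \<bar>f n x - f n y\<bar>" by simp
    qed
    also have "\<dots> = (\<Sum>n<k. \<bar>f n x\<bar> * \<bar>h x - h y\<bar>) + (\<Sum>n<k. \<bar>f n x - f n y\<bar>)" by (rule sum.distrib)
    also have "\<dots> \<le> c * C * dist x y + C * dist x y"
      using vary[OF xy(1)] f xy unfolding unconditionally_lipschitz_def by (intro add_mono) auto
    finally show ?thesis by (simp add: algebra_simps)
  qed
qed

text \<open>
  The element \<open>T \<gamma>\<close> is obtained from \<open>\<gamma>\<close> by cutting off successively around finite sets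
  \<open>A 0, A 1, \<dots>\<close> with widths \<open>\<delta> i\<close> decreasing to \<open>0\<close>. The tolerance with which \<open>\<Gamma>\<close> is concentrated near \<open>A i\<close> is
  chosen so small, compared with the norms of the multiplications up to step \<open>i\<close>, that the changes are
  summable with sum at most \<open>\<epsilon>\<close>.

  The last property transports smallness from \<open>\<Gamma>\<close> to its image. A sequence on \<open>closure U\<close> becomes one on the whole
  space after multiplication by \<open>H k\<close>, as soon as the support of \<open>H k\<close> lies in \<open>U\<close>, and \<open>T\<close> is the uniform limit
  on \<open>\<Gamma>\<close> of the adjoints of these multiplications.
\<close>

theorem compact_reduction:
  fixes z :: "'a::complete_space"
  assumes V: "Vstar_set (free_space z UNIV) \<Gamma>" and \<epsilon>: "0 < \<epsilon>"
  obtains K T where "compact K" "z \<in> K"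
    "\<And>\<gamma>. \<gamma> \<in> \<Gamma> \<Longrightarrow> T \<gamma> \<in> vecs (free_space z UNIV)"
    "\<And>\<gamma> L f. \<gamma> \<in> \<Gamma> \<Longrightarrow> lip_fn z UNIV L f \<Longrightarrow> \<bar>\<gamma> f - T \<gamma> f\<bar> \<le> \<epsilon> * L"
    "\<And>\<gamma> f. \<gamma> \<in> \<Gamma> \<Longrightarrow> f \<in> vecs (Lip0 z UNIV) \<Longrightarrow> (\<And>x. x \<in> K \<Longrightarrow> f x = 0) \<Longrightarrow> T \<gamma> f = 0"
    "\<And>U C f e. open U \<Longrightarrow> K \<subseteq> U \<Longrightarrow> unconditionally_lipschitz z (closure U) C f \<Longrightarrow> 0 < e \<Longrightarrow>
      \<exists>n\<^sub>0. \<forall>n\<ge>n\<^sub>0. \<forall>\<gamma>\<in>\<Gamma>. \<forall>g. g \<in> vecs (Lip0 z UNIV) \<longrightarrow> (\<forall>x\<in>K. g x = f n x) \<longrightarrow> \<bar>T \<gamma> g\<bar> \<le> e"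
proof -
  have \<Gamma>: "\<gamma> \<in> vecs (free_space z UNIV)" if "\<gamma> \<in> \<Gamma>" for \<gamma>
    using V that unfolding Vstar_set_free_space_iff[OF UNIV_I] by blast
  define \<delta> :: "nat \<Rightarrow> real" where "\<delta> i = 1 / (16 * 2 ^ i)" for i
  have \<delta>: "0 < \<delta> i" for i by (simp add: \<delta>_def)
  define c where "c k = (\<Sum>i<k. 1 / \<delta> i)" for k
  have c: "0 \<le> c k" for k unfolding c_def using \<delta> by (intro sum_nonneg) (simp add: less_imp_le)
  \<comment> \<open>The denominator bounds the Lipschitz constant of \<open>(H (k + 1) - H k) f\<close> for a \<open>1\<close>-Lipschitz function \<open>f\<close>.\<close>
  define \<epsilon>' where "\<epsilon>' k = \<epsilon> / 2 ^ Suc k / ((1 + c (Suc k)) + (1 + c k))" for k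
  have den: "0 < (1 + c (Suc k)) + (1 + c k)" for k using c[of k] c[of "Suc k"] by linarith
  have \<epsilon>': "0 < \<epsilon>' k" for k unfolding \<epsilon>'_def using den \<epsilon> by (intro divide_pos_pos) auto
  have "\<exists>A. finite A \<and> z \<in> A \<and> (\<forall>\<gamma>\<in>\<Gamma>. \<forall>L f. lip_fn z UNIV L f \<longrightarrow>
    (\<forall>x. bump z A (\<delta> i) x \<noteq> 0 \<longrightarrow> f x = 0) \<longrightarrow> \<bar>\<gamma> f\<bar> \<le> \<epsilon>' i * L)" for i
    by (rule Vstar_set_almost_supported_near_finite[OF V \<epsilon>' \<delta>])
  then obtain A where A: "\<And>i. finite (A i)" "\<And>i. z \<in> A i"
    and small: "\<And>i \<gamma> L f. \<gamma> \<in> \<Gamma> \<Longrightarrow> lip_fn z UNIV L f \<Longrightarrow>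
      (\<And>x. bump z (A i) (\<delta> i) x \<noteq> 0 \<Longrightarrow> f x = 0) \<Longrightarrow> \<bar>\<gamma> f\<bar> \<le> \<epsilon>' i * L"
    by metis
  \<comment> \<open>Doubling the width makes the multiplier equal to \<open>1\<close> wherever the bump of width \<open>\<delta> i\<close> is nonzero, so the
    change from \<open>H i\<close> to \<open>H (i + 1)\<close> is seen by \<open>\<Gamma>\<close> only up to the tolerance.\<close>
  define h where "h i = bump z (A i) (2 * \<delta> i)" for i
  define H where "H k x = (\<Prod>i<k. h i x)" for k x
  have mult: "multiplier z (c k) (H k)" for k
    unfolding c_def H_def[abs_def] h_def
    by (rule multiplier_prod) (use multiplier_bump[OF A(2), of "2 * \<delta> _"] \<delta> in simp)
  have Hf: "lip_fn z UNIV ((1 + c k) * L) (\<lambda>x. H k x * f x)" if "lip_fn z UNIV L f" for k L f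
    by (rule lip_fn_multiplier[OF mult c that])
  have inc: "\<bar>\<gamma> (\<lambda>x. H (Suc k) x * f x) - \<gamma> (\<lambda>x. H k x * f x)\<bar> \<le> \<epsilon> * L / 2 ^ Suc k"
    if \<gamma>: "\<gamma> \<in> \<Gamma>" and f: "lip_fn z UNIV L f" for \<gamma> k L f
  proof -
    let ?d = "(\<lambda>x. H (Suc k) x * f x) - (\<lambda>x. H k x * f x)"
    have d: "lip_fn z UNIV ((1 + c (Suc k)) * L + (1 + c k) * L) ?d"
      by (rule lip_fn_diff[OF Hf[OF f] Hf[OF f]])
    have "?d x = 0" if "bump z (A k) (\<delta> k) x \<noteq> 0" for x
    proof -
      have "h k x = 1"
        using that \<delta>[of k] unfolding h_def bump_nonzero[OF \<delta>] by (intro bump_eq_one) auto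
      then show ?thesis by (simp add: H_def)
    qed
    then have "\<bar>\<gamma> ?d\<bar> \<le> \<epsilon>' k * ((1 + c (Suc k)) * L + (1 + c k) * L)" by (rule small[OF \<gamma> d])
    also have "\<dots> = \<epsilon>' k * ((1 + c (Suc k)) + (1 + c k)) * L" by (simp add: algebra_simps)
    also have "\<epsilon>' k * ((1 + c (Suc k)) + (1 + c k)) = \<epsilon> / 2 ^ Suc k"
      unfolding \<epsilon>'_def using den[of k] by simp
    finally have "\<bar>\<gamma> ?d\<bar> \<le> \<epsilon> / 2 ^ Suc k * L" .
    then show ?thesis
      unfolding free_diff[OF \<Gamma>[OF \<gamma>] lip_fnD(5)[OF Hf[OF f]] lip_fnD(5)[OF Hf[OF f]]] by simp
  qed
  define T where "T = cutoff_limit z H"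
  define K where "K = {x. \<forall>i. infdist x (A i) \<le> (1 + dist x z) / (4 * 2 ^ i)}"
  note K = nested_neighbourhoods_compact[where A = A and z = z, OF A, folded K_def]
  have supp: "\<exists>k\<^sub>0. \<forall>k\<ge>k\<^sub>0. {x. H k x \<noteq> 0} \<subseteq> U" if U: "open U" "K \<subseteq> U" for U
  proof -
    have "{x. H k x \<noteq> 0} \<subseteq> {x. \<forall>i<k. infdist x (A i) \<le> (1 + dist x z) / (4 * 2 ^ i)}" for k
    proof (intro subsetI CollectI allI impI)
      fix x i assume x: "x \<in> {x. H k x \<noteq> 0}" and i: "i < k"
      then have "bump z (A i) (2 * \<delta> i) x \<noteq> 0" by (simp add: H_def h_def)
      then have "infdist x (A i) < 2 * (2 * \<delta> i) * (1 + dist x z)"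
        using \<delta>[of i] by (subst (asm) bump_nonzero) auto
      then show "infdist x (A i) \<le> (1 + dist x z) / (4 * 2 ^ i)" by (simp add: \<delta>_def field_simps)
    qed
    then show ?thesis using K(3)[OF U] by (meson order_trans)
  qed
  have T: "T \<gamma> \<in> vecs (free_space z UNIV)" if "\<gamma> \<in> \<Gamma>" for \<gamma>
    unfolding T_def by (rule cutoff_limit_free[OF \<Gamma>[OF that] mult c inc[OF that]])
  have near: "\<bar>T \<gamma> f - \<gamma> (\<lambda>x. H k x * f x)\<bar> \<le> \<epsilon> * L / 2 ^ k"
    if "\<gamma> \<in> \<Gamma>" "lip_fn z UNIV L f" for \<gamma> k L f
    unfolding T_def by (rule cutoff_limit_le[OF that(2) inc[OF that]])
  have ann: "T \<gamma> f = 0" if "\<gamma> \<in> \<Gamma>" "f \<in> vecs (Lip0 z UNIV)" "\<And>x. x \<in> K \<Longrightarrow> f x = 0" for \<gamma> f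
    unfolding T_def
    by (rule cutoff_limit_annihilates[where K = K and \<epsilon> = \<epsilon>, OF \<Gamma>[OF that(1)] _ inc[OF that(1)] supp])
      (use T that in \<open>auto simp: T_def\<close>)
  have dist: "\<bar>\<gamma> f - T \<gamma> f\<bar> \<le> \<epsilon> * L" if "\<gamma> \<in> \<Gamma>" "lip_fn z UNIV L f" for \<gamma> L f
    using near[OF that, of 0] by (simp add: H_def abs_minus_commute)
  have Vstar: "\<exists>n\<^sub>0. \<forall>n\<ge>n\<^sub>0. \<forall>\<gamma>\<in>\<Gamma>. \<forall>g. g \<in> vecs (Lip0 z UNIV) \<longrightarrow> (\<forall>x\<in>K. g x = f n x) \<longrightarrow> \<bar>T \<gamma> g\<bar> \<le> e"
    if U: "open U" "K \<subseteq> U" and f: "unconditionally_lipschitz z (closure U) C f" and e: "0 < e" for U C f e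
  proof -
    have UU: "U \<subseteq> closure U" by (rule closure_subset)
    have zU: "z \<in> closure U" using K(2) U(2) UU by blast
    obtain k\<^sub>0 where k\<^sub>0: "\<And>k. k\<^sub>0 \<le> k \<Longrightarrow> {x. H k x \<noteq> 0} \<subseteq> U" using supp[OF U] by blast
    have "(\<lambda>k. \<epsilon> * C / 2 ^ k) \<longlonglongrightarrow> 0" by (rule LIMSEQ_divide_realpow_zero) simp
    then have "\<forall>\<^sub>F k in sequentially. \<epsilon> * C / 2 ^ k < e / 2" using e by (intro order_tendstoD) auto
    then obtain k where k: "k\<^sub>0 \<le> k" "\<epsilon> * C / 2 ^ k < e / 2"
      unfolding eventually_sequentially by (meson nle_le)
    have Hk: "{x. H k x \<noteq> 0} \<subseteq> closure U" using k\<^sub>0[OF k(1)] UU by blast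
    have "unconditionally_lipschitz z UNIV ((1 + c k) * C) (\<lambda>n x. H k x * f n x)"
      by (rule unconditionally_lipschitz_multiplier[OF f zU mult c Hk])
    then obtain n\<^sub>0 where n\<^sub>0: "\<And>n \<gamma>. n\<^sub>0 \<le> n \<Longrightarrow> \<gamma> \<in> \<Gamma> \<Longrightarrow> \<bar>\<gamma> (\<lambda>x. H k x * f n x)\<bar> \<le> e / 2"
      using V half_gt_zero[OF e] unfolding Vstar_set_free_space_iff[OF UNIV_I] by meson
    have "\<bar>T \<gamma> g\<bar> \<le> e"
      if n: "n\<^sub>0 \<le> n" and \<gamma>: "\<gamma> \<in> \<Gamma>" and g: "g \<in> vecs (Lip0 z UNIV)" "\<forall>x\<in>K. g x = f n x" for n \<gamma> g
    proof -
      obtain g' where g': "lip_fn z UNIV C g'" "\<And>x. x \<in> closure U \<Longrightarrow> g' x = f n x"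
        using McShane_extension[OF unconditionally_lipschitz_lip_fn[OF f] zU] by blast
      have "T \<gamma> (g - g') = 0"
        by (rule ann[OF \<gamma>]) (use g g' U(2) UU lip_fnD(5)[OF g'(1)] subspace_diff[OF subspace_Lip0] in auto)
      then have "T \<gamma> g = T \<gamma> g'" using free_diff[OF T[OF \<gamma>] g(1) lip_fnD(5)[OF g'(1)]] by simp
      moreover have eq: "(\<lambda>x. H k x * f n x) = (\<lambda>x. H k x * g' x)" using Hk g'(2) by fastforce
      have "\<bar>T \<gamma> g' - \<gamma> (\<lambda>x. H k x * f n x)\<bar> \<le> e / 2"
        unfolding eq by (rule order_trans[OF near[OF \<gamma> g'(1)] less_imp_le[OF k(2)]])
      ultimately show ?thesis using n\<^sub>0[OF n \<gamma>] by linarith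
    qed
    then show ?thesis by blast
  qed
  show ?thesis by (rule that[OF K(1,2) T dist ann Vstar])
qed

section \<open>Compact determination of property (V*)\<close>

lemma compact_box_fun:
  fixes b :: "'b \<Rightarrow> real"
  shows "compact {d. \<forall>f. \<bar>d f\<bar> \<le> b f}"
proof -
  have "compactin (product_topology (\<lambda>_. euclidean) UNIV) (\<Pi>\<^sub>E f\<in>UNIV. {- b f..b f})"
    by (simp add: compactin_PiE)
  moreover have "(\<Pi>\<^sub>E f\<in>UNIV. {- b f..b f}) = {d. \<forall>f. \<bar>d f\<bar> \<le> b f}"
    by (auto simp: PiE_UNIV_domain abs_le_iff Pi_iff minus_le_iff)
  ultimately show ?thesis unfolding euclidean_product_topology by simp
qed

lemma compact_plus_fun:
  fixes W D :: "('b \<Rightarrow> real) set"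
  assumes "compact W" "compact D"
  shows "compact ((\<lambda>(w, d). w + d) ` (W \<times> D))"
proof (rule compact_continuous_image[OF _ compact_Times[OF assms]])
  have "continuous_on (W \<times> D) (\<lambda>p. fst p f)" "continuous_on (W \<times> D) (\<lambda>p. snd p f)" for f
    by (rule continuous_on_product_then_coordinatewise, rule continuous_on_fst continuous_on_snd, rule continuous_on_id)+
  then show "continuous_on (W \<times> D) (\<lambda>(w, d). w + d)"
    unfolding case_prod_beta plus_fun_def
    by (intro continuous_on_coordinatewise_then_product continuous_on_add)
qed

text \<open>
  A set that is approximated up to every \<open>e\<close> by weakly compact sets is relatively weakly compact (Grothendieck).
  Working with pointwise convergence, the closure of \<open>\<Gamma>\<close> is contained in \<open>W + D e\<close>, where \<open>D e\<close> is a ball in a space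
  of functions on \<open>Lip0\<close> and compact by Tychonoff's theorem. Thus the closure is compact, and as its members are
  norm limits of elements of the free space, they belong to it.
\<close>

lemma relatively_weakly_compact_if_approximable:
  assumes z: "z \<in> N" and \<Gamma>: "\<Gamma> \<subseteq> vecs (free_space z N)"
    and app: "\<And>e. 0 < e \<Longrightarrow> \<exists>W. compact W \<and> W \<subseteq> vecs (free_space z N) \<and>
      (\<forall>\<gamma>\<in>\<Gamma>. \<exists>w\<in>W. \<forall>L f. lip_fn z N L f \<longrightarrow> \<bar>\<gamma> f - w f\<bar> \<le> e * L)"
  shows "relatively_weakly_compact (free_space z N) \<Gamma>"
proof -
  let ?F = "vecs (free_space z N)"
  define D where "D e = {d. \<forall>f. \<bar>d f\<bar> \<le> (if f \<in> vecs (Lip0 z N) then e * nrm (Lip0 z N) f else 0)}" for e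
  have split: "\<exists>W. compact W \<and> W \<subseteq> ?F \<and> compact ((\<lambda>(w, d). w + d) ` (W \<times> D e)) \<and>
      closure \<Gamma> \<subseteq> (\<lambda>(w, d). w + d) ` (W \<times> D e)" if e: "0 < e" for e
  proof -
    obtain W where W: "compact W" "W \<subseteq> ?F"
      "\<And>\<gamma>. \<gamma> \<in> \<Gamma> \<Longrightarrow> \<exists>w\<in>W. \<forall>L f. lip_fn z N L f \<longrightarrow> \<bar>\<gamma> f - w f\<bar> \<le> e * L"
      using app[OF e] by blast
    have comp: "compact ((\<lambda>(w, d). w + d) ` (W \<times> D e))"
      unfolding D_def by (intro compact_plus_fun W compact_box_fun)
    have "\<Gamma> \<subseteq> (\<lambda>(w, d). w + d) ` (W \<times> D e)"
    proof
      fix \<gamma> assume \<gamma>: "\<gamma> \<in> \<Gamma>"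
      then obtain w where w: "w \<in> W" "\<And>L f. lip_fn z N L f \<Longrightarrow> \<bar>\<gamma> f - w f\<bar> \<le> e * L" using W(3) by blast
      have "\<gamma> f = 0" "w f = 0" if "f \<notin> vecs (Lip0 z N)" for f
        using dualD(3)[OF free_space_sub_dual that] \<gamma> w(1) \<Gamma> W(2) by blast+
      then have "\<gamma> - w \<in> D e" using w(2)[OF lip_fn_nrm] by (simp add: D_def)
      moreover have "\<gamma> = (\<lambda>(w, d). w + d) (w, \<gamma> - w)" by simp
      ultimately show "\<gamma> \<in> (\<lambda>(w, d). w + d) ` (W \<times> D e)" using w(1) by blast
    qed
    then have "closure \<Gamma> \<subseteq> (\<lambda>(w, d). w + d) ` (W \<times> D e)"
      by (rule closure_minimal) (rule compact_imp_closed_fun[OF comp])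
    with W comp show ?thesis by blast
  qed
  have "closure \<Gamma> \<subseteq> ?F"
  proof
    fix m assume m: "m \<in> closure \<Gamma>"
    have decomp: "\<exists>w\<in>?F. \<forall>f. \<bar>m f - w f\<bar> \<le> (if f \<in> vecs (Lip0 z N) then e * nrm (Lip0 z N) f else 0)"
      if e: "0 < e" for e
    proof -
      obtain W where W: "W \<subseteq> ?F" "closure \<Gamma> \<subseteq> (\<lambda>(w, d). w + d) ` (W \<times> D e)" using split[OF e] by blast
      have "m \<in> (\<lambda>(w, d). w + d) ` (W \<times> D e)" using W(2) m by (rule subsetD)
      then obtain w d where "w \<in> ?F" "d \<in> D e" "m = w + d" using W(1) by auto
      then show ?thesis by (intro bexI[of _ w]) (auto simp: D_def)
    qed
    show "m \<in> ?F" unfolding free_space_iff[OF z]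
    proof (intro conjI allI impI)
      fix f assume f: "f \<notin> vecs (Lip0 z N)"
      obtain w where w: "w \<in> ?F"
        "\<forall>f. \<bar>m f - w f\<bar> \<le> (if f \<in> vecs (Lip0 z N) then 1 * nrm (Lip0 z N) f else 0)"
        using decomp[OF zero_less_one] by blast
      show "m f = 0" using w(2)[rule_format, of f] f dualD(3)[OF free_space_sub_dual[OF w(1)] f] by simp
    next
      fix e :: real assume e: "0 < e"
      obtain w where w: "w \<in> ?F"
        "\<And>f. f \<in> vecs (Lip0 z N) \<Longrightarrow> \<bar>m f - w f\<bar> \<le> e / 2 * nrm (Lip0 z N) f"
        using decomp[OF half_gt_zero[OF e]] by (metis (full_types))
      obtain l where l: "fst ` set l \<subseteq> N" "\<And>L f. lip_fn z N L f \<Longrightarrow> \<bar>w f - atoms z N l f\<bar> \<le> e / 2 * L"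
        using free_approx[OF z w(1) half_gt_zero[OF e]] by blast
      have "\<bar>m f - atoms z N l f\<bar> \<le> e * L" if f: "lip_fn z N L f" for L f
      proof -
        have "\<bar>m f - w f\<bar> \<le> e / 2 * nrm (Lip0 z N) f" by (rule w(2)[OF lip_fnD(5)[OF f]])
        also have "\<dots> \<le> e / 2 * L" using nrm_Lip0_le[OF f] e by (intro mult_left_mono) auto
        finally have "\<bar>m f - w f\<bar> \<le> e / 2 * L" .
        moreover have "e * L = e / 2 * L + e / 2 * L" by simp
        ultimately show ?thesis using l(2)[OF f] by linarith
      qed
      then show "\<exists>l. fst ` set l \<subseteq> N \<and> (\<forall>L f. lip_fn z N L f \<longrightarrow> \<bar>m f - atoms z N l f\<bar> \<le> e * L)"
        using l(1) by blast
    qed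
  qed
  moreover have "compact (closure \<Gamma>)"
  proof -
    obtain C where "compact C" "closure \<Gamma> \<subseteq> C" using split[of 1] by auto
    then show ?thesis using closed_Int_compact[OF closed_closure, of C \<Gamma>] by (simp add: Int_absorb2)
  qed
  ultimately show ?thesis
    using closure_subset by (intro relatively_weakly_compact_free_spaceI[OF z])
qed

lemma free_embedding_free_space:
  assumes K: "K \<subseteq> N" and z: "z \<in> K" and m: "m \<in> vecs (free_space z K)"
  shows "free_embedding z K N m \<in> vecs (free_space z N)"
proof -
  have zN: "z \<in> N" using K z by blast
  have "\<exists>l. fst ` set l \<subseteq> N \<and> (\<forall>L f. lip_fn z N L f \<longrightarrow> \<bar>free_embedding z K N m f - atoms z N l f\<bar> \<le> e * L)"
    if e: "0 < e" for e
  proof -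
    obtain l where l: "fst ` set l \<subseteq> K" "\<And>L f. lip_fn z K L f \<Longrightarrow> \<bar>m f - atoms z K l f\<bar> \<le> e * L"
      using free_approx[OF z m e] by blast
    have "\<bar>free_embedding z K N m f - atoms z N l f\<bar> \<le> e * L" if f: "lip_fn z N L f" for L f
    proof -
      note f' = lip_fn_zero_off[OF f K]
      have "(\<Sum>(x, a)\<leftarrow>l. a * zero_off K f x) = (\<Sum>(x, a)\<leftarrow>l. a * f x)"
        using l(1) by (intro sum_list_weights_cong) (auto simp: zero_off_def)
      then have "atoms z K l (zero_off K f) = atoms z N l f"
        using lip_fnD(5)[OF f] lip_fnD(5)[OF f'] by (simp add: atoms_def)
      then show ?thesis using l(2)[OF f'] lip_fnD(5)[OF f] by (simp add: free_embedding_def)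
    qed
    then show ?thesis using l(1) K by blast
  qed
  moreover have "\<forall>f. f \<notin> vecs (Lip0 z N) \<longrightarrow> free_embedding z K N m f = 0" by (simp add: free_embedding_def)
  ultimately show ?thesis unfolding free_space_iff[OF zN] by blast
qed

lemma continuous_on_free_embedding: "continuous_on A (free_embedding z K N)"
proof (rule continuous_on_coordinatewise_then_product)
  fix f
  show "continuous_on A (\<lambda>m. free_embedding z K N m f)"
    unfolding free_embedding_def
    by (cases "f \<in> vecs (Lip0 z N)")
      (auto intro: continuous_on_subset[OF continuous_on_product_coordinates])
qed

text \<open>
  The common consequence of the extension properties: \<open>L\<close> is \<open>K\<close> itself, or a retract containing it. The members
  of \<open>\<Gamma>\<close> only see the values on \<open>K\<close>, so they take the same values along two sequences that agree there.
\<close>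

lemma Vstar_set_pushforward_if_extension:
  assumes z: "z \<in> K" and KL: "K \<subseteq> L" and \<Gamma>: "\<Gamma> \<subseteq> vecs (free_space z K)"
    and V: "Vstar_set (free_space z UNIV) (free_embedding z K UNIV ` \<Gamma>)"
    and ext: "\<And>C f. unconditionally_lipschitz z L C f \<Longrightarrow>
      \<exists>C' g. unconditionally_lipschitz z UNIV C' g \<and> (\<forall>n. \<forall>x\<in>K. g n x = f n x)"
  shows "Vstar_set (free_space z L) (free_embedding z K L ` \<Gamma>)"
proof -
  have zL: "z \<in> L" using z KL by blast
  have "\<exists>n\<^sub>0. \<forall>n\<ge>n\<^sub>0. \<forall>m\<in>free_embedding z K L ` \<Gamma>. \<bar>m (f n)\<bar> \<le> e"
    if f: "unconditionally_lipschitz z L C f" and e: "0 < e" for C f e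
  proof -
    obtain C' g where g: "unconditionally_lipschitz z UNIV C' g" "\<And>n x. x \<in> K \<Longrightarrow> g n x = f n x"
      using ext[OF f] by blast
    have "free_embedding z K L m (f n) = free_embedding z K UNIV m (g n)" for m n
    proof -
      have "zero_off K (f n) = zero_off K (g n)" using g(2) by (auto simp: zero_off_def)
      then show ?thesis
        using lip_fnD(5)[OF unconditionally_lipschitz_lip_fn[OF f]]
          lip_fnD(5)[OF unconditionally_lipschitz_lip_fn[OF g(1)]] by (simp add: free_embedding_def)
    qed
    moreover have "\<exists>n\<^sub>0. \<forall>n\<ge>n\<^sub>0. \<forall>m\<in>free_embedding z K UNIV ` \<Gamma>. \<bar>m (g n)\<bar> \<le> e"
      using V g(1) e unfolding Vstar_set_free_space_iff[OF UNIV_I] by blast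
    ultimately show ?thesis by simp
  qed
  moreover have "free_embedding z K L ` \<Gamma> \<subseteq> vecs (free_space z L)"
    using free_embedding_free_space[OF KL z] \<Gamma> by blast
  ultimately show ?thesis unfolding Vstar_set_free_space_iff[OF zL] by blast
qed

lemma unconditionally_lipschitz_imp_ell1:
  assumes f: "unconditionally_lipschitz z K C f" and z: "z \<in> K"
  shows "lipschitz_into_ell1 K (\<lambda>x n. f n x)"
proof -
  have bound: "(\<Sum>n<k. \<bar>f n x - f n y\<bar>) \<le> C * dist x y" if "x \<in> K" "y \<in> K" for x y k
    using f that by (simp add: unconditionally_lipschitz_def)
  have diff: "summable (\<lambda>n. \<bar>f n x - f n y\<bar>)" if "x \<in> K" "y \<in> K" for x y
    by (rule summableI_nonneg_bounded) (use bound[OF that] in auto)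
  have "summable (\<lambda>n. \<bar>f n x\<bar>)" if "x \<in> K" for x
    using diff[OF that z] f by (simp add: unconditionally_lipschitz_def)
  moreover have "(\<Sum>n. \<bar>f n x - f n y\<bar>) \<le> C * dist x y" if "x \<in> K" "y \<in> K" for x y
    by (rule suminf_le_const[OF diff[OF that]]) (rule bound[OF that])
  ultimately show ?thesis by (auto simp: lipschitz_into_ell1_def ell1_def)
qed

lemma ell1_imp_unconditionally_lipschitz:
  assumes \<Phi>: "lipschitz_into_ell1 UNIV \<Phi>" and z: "\<And>n. \<Phi> z n = 0"
  obtains C where "unconditionally_lipschitz z UNIV C (\<lambda>n x. \<Phi> x n)"
proof -
  obtain C where C: "\<And>x y. (\<Sum>n. \<bar>\<Phi> x n - \<Phi> y n\<bar>) \<le> C * dist x y"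
    using \<Phi> by (auto simp: lipschitz_into_ell1_def ell1_def)
  have summ: "summable (\<lambda>n. \<bar>\<Phi> x n\<bar>)" for x using \<Phi> by (auto simp: lipschitz_into_ell1_def ell1_def)
  have "(\<Sum>n<k. \<bar>\<Phi> x n - \<Phi> y n\<bar>) \<le> \<bar>C\<bar> * dist x y" for x y k
  proof -
    have "summable (\<lambda>n. \<bar>\<Phi> x n - \<Phi> y n\<bar>)"
      by (rule summable_comparison_test'[OF summable_add[OF summ[of x] summ[of y]], of 0]) simp
    then have "(\<Sum>n<k. \<bar>\<Phi> x n - \<Phi> y n\<bar>) \<le> (\<Sum>n. \<bar>\<Phi> x n - \<Phi> y n\<bar>)" by (intro sum_le_suminf) auto
    also have "\<dots> \<le> C * dist x y" by (rule C)
    also have "\<dots> \<le> \<bar>C\<bar> * dist x y" by (intro mult_right_mono) auto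
    finally show ?thesis .
  qed
  then have "unconditionally_lipschitz z UNIV \<bar>C\<bar> (\<lambda>n x. \<Phi> x n)"
    using z by (simp add: unconditionally_lipschitz_def)
  then show ?thesis by (rule that)
qed

lemma WUC_bounded_linear_image:
  assumes E: "bounded_linear_between X Y E" and nonneg: "\<And>v. v \<in> vecs X \<Longrightarrow> 0 \<le> nrm X v"
    "\<And>v. v \<in> vecs Y \<Longrightarrow> 0 \<le> nrm Y v" and X: "subspace (vecs X)" and f: "WUC X f"
  shows "WUC Y (\<lambda>n. E (f n))"
  unfolding WUC_def
proof (intro conjI ballI)
  have EX: "\<And>v. v \<in> vecs X \<Longrightarrow> E v \<in> vecs Y"
    and add: "\<And>u v. u \<in> vecs X \<Longrightarrow> v \<in> vecs X \<Longrightarrow> E (u + v) = E u + E v"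
    and scale: "\<And>c v. v \<in> vecs X \<Longrightarrow> E (c *\<^sub>R v) = c *\<^sub>R E v"
    using E by (auto simp: bounded_linear_between_def)
  obtain C where C: "\<And>v. v \<in> vecs X \<Longrightarrow> nrm Y (E v) \<le> C * nrm X v"
    using E unfolding bounded_linear_between_def by blast
  have fX: "f n \<in> vecs X" for n using f by (auto simp: WUC_def)
  then show "range (\<lambda>n. E (f n)) \<subseteq> vecs Y" using EX by auto
  fix \<phi> assume \<phi>: "\<phi> \<in> vecs (dual Y)"
  obtain D where D: "\<And>v. v \<in> vecs Y \<Longrightarrow> \<bar>\<phi> v\<bar> \<le> D * nrm Y v" using dualD(4)[OF \<phi>] by blast
  have \<psi>: "(\<lambda>v. if v \<in> vecs X then \<phi> (E v) else 0) \<in> vecs (dual X)"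
  proof (rule dualI)
    fix v assume v: "v \<in> vecs X"
    have "\<bar>\<phi> (E v)\<bar> \<le> D * nrm Y (E v)" by (rule D[OF EX[OF v]])
    also have "\<dots> \<le> \<bar>D\<bar> * nrm Y (E v)" using nonneg(2)[OF EX[OF v]] by (intro mult_right_mono) auto
    also have "\<dots> \<le> \<bar>D\<bar> * (C * nrm X v)" by (intro mult_left_mono C v) auto
    finally show "\<bar>if v \<in> vecs X then \<phi> (E v) else 0\<bar> \<le> (\<bar>D\<bar> * C) * nrm X v" using v by simp
  qed (simp_all add: add scale EX dualD[OF \<phi>] subspace_add[OF X] subspace_scale[OF X])
  have "\<forall>\<psi>\<in>vecs (dual X). summable (\<lambda>n. \<bar>\<psi> (f n)\<bar>)" using f by (simp add: WUC_def)
  from bspec[OF this \<psi>] show "summable (\<lambda>n. \<bar>\<phi> (E (f n))\<bar>)" using fX by simp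
qed

lemma unconditionally_lipschitz_retraction:
  assumes f: "unconditionally_lipschitz z L C f" and z: "z \<in> L"
    and \<pi>: "D-lipschitz_on UNIV \<pi>" "range \<pi> \<subseteq> L" "\<And>x. x \<in> L \<Longrightarrow> \<pi> x = x"
  shows "unconditionally_lipschitz z UNIV (C * D) (\<lambda>n x. f n (\<pi> x))"
  unfolding unconditionally_lipschitz_def
proof (intro conjI allI ballI impI)
  have C: "0 \<le> C" using f by (simp add: unconditionally_lipschitz_def)
  then show "0 \<le> C * D" using lipschitz_on_nonneg[OF \<pi>(1)] by simp
  show "f n (\<pi> z) = 0" for n using f \<pi>(3)[OF z] by (simp add: unconditionally_lipschitz_def)
  fix x y :: 'a and k :: nat
  have "\<pi> x \<in> L" "\<pi> y \<in> L" using \<pi>(2) by auto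
  then have "(\<Sum>n<k. \<bar>f n (\<pi> x) - f n (\<pi> y)\<bar>) \<le> C * dist (\<pi> x) (\<pi> y)"
    using f by (simp add: unconditionally_lipschitz_def)
  also have "\<dots> \<le> C * (D * dist x y)" using lipschitz_onD[OF \<pi>(1)] C by (intro mult_left_mono) auto
  finally show "(\<Sum>n<k. \<bar>f n (\<pi> x) - f n (\<pi> y)\<bar>) \<le> C * D * dist x y" by (simp add: mult.assoc)
qed simp


text \<open>
  For each \<open>e\<close>, compact reduction replaces \<open>\<Gamma>\<close> up to \<open>e\<close> by the image of a set in the free space over a compact
  \<open>K\<close> that is a (V*)-set over the closure of every open set containing \<open>K\<close>. By the lifting hypothesis it is a (V*)-set over
  a compact \<open>L\<close>, where it is relatively weakly compact, and the embedding of free spaces preserves this.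
\<close>

lemma property_Vstar_if_lifting:
  fixes z :: "'a::complete_space"
  assumes lift: "\<And>K \<Gamma>. compact K \<Longrightarrow> z \<in> K \<Longrightarrow> \<Gamma> \<subseteq> vecs (free_space z K) \<Longrightarrow>
      (\<And>U. open U \<Longrightarrow> K \<subseteq> U \<Longrightarrow>
        Vstar_set (free_space z (closure U)) (free_embedding z K (closure U) ` \<Gamma>)) \<Longrightarrow>
      \<exists>L. compact L \<and> K \<subseteq> L \<and> Vstar_set (free_space z L) (free_embedding z K L ` \<Gamma>)"
    and compacts: "\<And>K. compact K \<Longrightarrow> property_Vstar (free_space z (insert z K))"
  shows "property_Vstar (free_space z (UNIV :: 'a set))"
  unfolding property_Vstar_def
proof (intro allI impI)
  fix \<Gamma> assume V: "Vstar_set (free_space z (UNIV :: 'a set)) \<Gamma>"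
  then have \<Gamma>: "\<Gamma> \<subseteq> vecs (free_space z UNIV)" by (simp add: Vstar_set_def)
  show "relatively_weakly_compact (free_space z (UNIV :: 'a set)) \<Gamma>"
  proof (rule relatively_weakly_compact_if_approximable[OF UNIV_I \<Gamma>])
    fix e :: real assume e: "0 < e"
    show "\<exists>W. compact W \<and> W \<subseteq> vecs (free_space z UNIV) \<and>
        (\<forall>\<gamma>\<in>\<Gamma>. \<exists>w\<in>W. \<forall>L f. lip_fn z UNIV L f \<longrightarrow> \<bar>\<gamma> f - w f\<bar> \<le> e * L)"
    proof (rule compact_reduction[OF V e])
      fix K T
      assume K: "compact K" "z \<in> K"
        and T: "\<And>\<gamma>. \<gamma> \<in> \<Gamma> \<Longrightarrow> T \<gamma> \<in> vecs (free_space z UNIV)"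
        and near: "\<And>\<gamma> L f. \<gamma> \<in> \<Gamma> \<Longrightarrow> lip_fn z UNIV L f \<Longrightarrow> \<bar>\<gamma> f - T \<gamma> f\<bar> \<le> e * L"
        and ann: "\<And>\<gamma> f. \<gamma> \<in> \<Gamma> \<Longrightarrow> f \<in> vecs (Lip0 z UNIV) \<Longrightarrow> (\<And>x. x \<in> K \<Longrightarrow> f x = 0) \<Longrightarrow> T \<gamma> f = 0"
        and small: "\<And>U C f d. open U \<Longrightarrow> K \<subseteq> U \<Longrightarrow> unconditionally_lipschitz z (closure U) C f \<Longrightarrow> 0 < d \<Longrightarrow>
          \<exists>n\<^sub>0. \<forall>n\<ge>n\<^sub>0. \<forall>\<gamma>\<in>\<Gamma>. \<forall>g. g \<in> vecs (Lip0 z UNIV) \<longrightarrow> (\<forall>x\<in>K. g x = f n x) \<longrightarrow> \<bar>T \<gamma> g\<bar> \<le> d"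
      have "\<exists>m. m \<in> vecs (free_space z K) \<and> (\<forall>f g. f \<in> vecs (Lip0 z K) \<longrightarrow> g \<in> vecs (Lip0 z UNIV) \<longrightarrow>
          (\<forall>x\<in>K. g x = f x) \<longrightarrow> m f = T \<gamma> g)" if \<gamma>: "\<gamma> \<in> \<Gamma>" for \<gamma>
        by (rule free_space_restrict_support[where m = "T \<gamma>", OF K(2) T[OF \<gamma>] ann[OF \<gamma>]]) blast+
      then obtain r where r: "\<And>\<gamma>. \<gamma> \<in> \<Gamma> \<Longrightarrow> r \<gamma> \<in> vecs (free_space z K)"
        and r_eq: "\<And>\<gamma> f g. \<gamma> \<in> \<Gamma> \<Longrightarrow> f \<in> vecs (Lip0 z K) \<Longrightarrow> g \<in> vecs (Lip0 z UNIV) \<Longrightarrow>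
          (\<And>x. x \<in> K \<Longrightarrow> g x = f x) \<Longrightarrow> r \<gamma> f = T \<gamma> g"
        by metis
      have r_emb: "free_embedding z K N (r \<gamma>) f = T \<gamma> g"
        if \<gamma>: "\<gamma> \<in> \<Gamma>" and KN: "K \<subseteq> N" and f: "f \<in> vecs (Lip0 z N)"
          and g: "g \<in> vecs (Lip0 z UNIV)" "\<And>x. x \<in> K \<Longrightarrow> g x = f x" for \<gamma> N f g
      proof -
        obtain L where "lip_fn z N L f" using f vecs_Lip0 by blast
        then have "zero_off K f \<in> vecs (Lip0 z K)" by (rule lip_fnD(5)[OF lip_fn_zero_off[OF _ KN]])
        then have "r \<gamma> (zero_off K f) = T \<gamma> g" by (rule r_eq[OF \<gamma> _ g(1)]) (simp add: g(2) zero_off_def)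
        then show ?thesis using f by (simp add: free_embedding_def)
      qed
      have "Vstar_set (free_space z (closure U)) (free_embedding z K (closure U) ` r ` \<Gamma>)"
        if U: "open U" "K \<subseteq> U" for U
      proof -
        have KU: "K \<subseteq> closure U" using U(2) closure_subset by blast
        then have zU: "z \<in> closure U" using K(2) by blast
        have "\<exists>n\<^sub>0. \<forall>n\<ge>n\<^sub>0. \<forall>m\<in>free_embedding z K (closure U) ` r ` \<Gamma>. \<bar>m (f n)\<bar> \<le> d"
          if f: "unconditionally_lipschitz z (closure U) C f" and d: "0 < d" for C f d
        proof -
          obtain n\<^sub>0 where n\<^sub>0: "\<And>n \<gamma> g. n\<^sub>0 \<le> n \<Longrightarrow> \<gamma> \<in> \<Gamma> \<Longrightarrow> g \<in> vecs (Lip0 z UNIV) \<Longrightarrow>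
              (\<And>x. x \<in> K \<Longrightarrow> g x = f n x) \<Longrightarrow> \<bar>T \<gamma> g\<bar> \<le> d"
            using small[OF U f d] by blast
          have "\<bar>free_embedding z K (closure U) (r \<gamma>) (f n)\<bar> \<le> d" if n: "n\<^sub>0 \<le> n" and \<gamma>: "\<gamma> \<in> \<Gamma>" for n \<gamma>
          proof -
            note fn = unconditionally_lipschitz_lip_fn[OF f, of n]
            obtain g where g: "lip_fn z UNIV C g" "\<And>x. x \<in> closure U \<Longrightarrow> g x = f n x"
              using McShane_extension[OF fn zU] by blast
            have gK: "g x = f n x" if "x \<in> K" for x using g(2) KU that by blast
            have "free_embedding z K (closure U) (r \<gamma>) (f n) = T \<gamma> g"
              by (rule r_emb[OF \<gamma> KU lip_fnD(5)[OF fn] lip_fnD(5)[OF g(1)]]) (rule gK)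
            moreover have "\<bar>T \<gamma> g\<bar> \<le> d" by (rule n\<^sub>0[OF n \<gamma> lip_fnD(5)[OF g(1)]]) (rule gK)
            ultimately show ?thesis by simp
          qed
          then show ?thesis by blast
        qed
        moreover have "free_embedding z K (closure U) ` r ` \<Gamma> \<subseteq> vecs (free_space z (closure U))"
          using free_embedding_free_space[OF KU K(2) r] by blast
        ultimately show ?thesis unfolding Vstar_set_free_space_iff[OF zU] by blast
      qed
      moreover have "r ` \<Gamma> \<subseteq> vecs (free_space z K)" using r by blast
      ultimately obtain L where L: "compact L" "K \<subseteq> L"
        and VL: "Vstar_set (free_space z L) (free_embedding z K L ` r ` \<Gamma>)"
        using lift[OF K, of "r ` \<Gamma>"] by blast
      have zL: "z \<in> L" using K(2) L(2) by blast
      then have "insert z L = L" by blast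
      then have "property_Vstar (free_space z L)" using compacts[OF L(1)] by simp
      then have "relatively_weakly_compact (free_space z L) (free_embedding z K L ` r ` \<Gamma>)"
        using VL unfolding property_Vstar_def by blast
      then obtain C where C: "compact C" "free_embedding z K L ` r ` \<Gamma> \<subseteq> C" "C \<subseteq> vecs (free_space z L)"
        using relatively_weakly_compact_free_spaceD[OF zL] VL unfolding Vstar_set_def by metis
      let ?W = "free_embedding z L UNIV ` C"
      have "compact ?W" by (rule compact_continuous_image[OF continuous_on_free_embedding C(1)])
      moreover have "?W \<subseteq> vecs (free_space z UNIV)"
        using free_embedding_free_space[OF subset_UNIV zL] C(3) by blast
      moreover have "\<exists>w\<in>?W. \<forall>L f. lip_fn z UNIV L f \<longrightarrow> \<bar>\<gamma> f - w f\<bar> \<le> e * L" if \<gamma>: "\<gamma> \<in> \<Gamma>" for \<gamma>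
      proof
        let ?w = "free_embedding z L UNIV (free_embedding z K L (r \<gamma>))"
        show "?w \<in> ?W" using C(2) \<gamma> by blast
        show "\<forall>L f. lip_fn z UNIV L f \<longrightarrow> \<bar>\<gamma> f - ?w f\<bar> \<le> e * L"
        proof (intro allI impI)
          fix l f assume f: "lip_fn z UNIV l f"
          have "zero_off L f x = f x" if "x \<in> K" for x using L(2) that by (auto simp: zero_off_def)
          then have "free_embedding z K L (r \<gamma>) (zero_off L f) = T \<gamma> f"
            by (intro r_emb[OF \<gamma> L(2) lip_fnD(5)[OF lip_fn_zero_off[OF f subset_UNIV]] lip_fnD(5)[OF f]]) simp
          then have "?w f = T \<gamma> f" using lip_fnD(5)[OF f] by (simp add: free_embedding_def)
          then show "\<bar>\<gamma> f - ?w f\<bar> \<le> e * l" using near[OF \<gamma> f] by simp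
        qed
      qed
      ultimately show "\<exists>W. compact W \<and> W \<subseteq> vecs (free_space z UNIV) \<and>
          (\<forall>\<gamma>\<in>\<Gamma>. \<exists>w\<in>W. \<forall>L f. lip_fn z UNIV L f \<longrightarrow> \<bar>\<gamma> f - w f\<bar> \<le> e * L)"
        by blast
    qed
  qed
qed

lemma extension_if_ell1_extension:
  fixes z :: "'a::metric_space"
  assumes c: "\<forall>(K::'a set) \<phi>. compact K \<and> lipschitz_into_ell1 K \<phi> \<longrightarrow>
        (\<exists>\<Phi>. lipschitz_into_ell1 UNIV \<Phi> \<and> (\<forall>x\<in>K. \<Phi> x = \<phi> x))"
    and K: "compact K" "z \<in> K" and f: "unconditionally_lipschitz z K C f"
  shows "\<exists>C' g. unconditionally_lipschitz z UNIV C' g \<and> (\<forall>n. \<forall>x\<in>K. g n x = f n x)"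
proof -
  obtain \<Phi> where \<Phi>: "lipschitz_into_ell1 UNIV \<Phi>" "\<And>x. x \<in> K \<Longrightarrow> \<Phi> x = (\<lambda>n. f n x)"
    using c unconditionally_lipschitz_imp_ell1[OF f K(2)] K(1) by metis
  have "\<Phi> z n = 0" for n using \<Phi>(2)[OF K(2)] f by (simp add: unconditionally_lipschitz_def)
  then obtain C' where "unconditionally_lipschitz z UNIV C' (\<lambda>n x. \<Phi> x n)"
    using ell1_imp_unconditionally_lipschitz[OF \<Phi>(1)] by blast
  moreover have "\<Phi> x n = f n x" if "x \<in> K" for n x using \<Phi>(2)[OF that] by simp
  ultimately show ?thesis by blast
qed

lemma extension_if_extension_operator:
  assumes K: "z \<in> K" and E: "bounded_linear_between (Lip0 z K) (Lip0 z UNIV) E"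
    "\<forall>f\<in>vecs (Lip0 z K). \<forall>x\<in>K. E f x = f x"
    and f: "unconditionally_lipschitz z K C f"
  shows "\<exists>C' g. unconditionally_lipschitz z UNIV C' g \<and> (\<forall>n. \<forall>x\<in>K. g n x = f n x)"
proof -
  have "WUC (Lip0 z UNIV) (\<lambda>n. E (f n))"
    by (rule WUC_bounded_linear_image[OF E(1) nrm_Lip0_nonneg nrm_Lip0_nonneg subspace_Lip0
          unconditionally_lipschitz_imp_WUC[OF f]])
  then obtain C' where "unconditionally_lipschitz z UNIV C' (\<lambda>n. E (f n))"
    by (rule WUC_imp_unconditionally_lipschitz[OF UNIV_I])
  moreover have "E (f n) x = f n x" if "x \<in> K" for n x
    using E(2) lip_fnD(5)[OF unconditionally_lipschitz_lip_fn[OF f]] that by blast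
  ultimately show ?thesis by blast
qed

theorem proposition2p11:
  fixes z :: "'a::complete_space"
  assumes conditions:
    "(\<comment> \<open>(a)\<close> \<forall>K \<Gamma>. compact K \<and> z \<in> K \<and> \<Gamma> \<subseteq> vecs (free_space z K) \<and>
        (\<forall>U. open U \<and> K \<subseteq> U \<longrightarrow>
          Vstar_set (free_space z (closure U)) (free_embedding z K (closure U) ` \<Gamma>)) \<longrightarrow>
        (\<exists>L. compact L \<and> K \<subseteq> L \<and> Vstar_set (free_space z L) (free_embedding z K L ` \<Gamma>))) \<or>
     (\<comment> \<open>(b)\<close> \<forall>K f. compact K \<and> z \<in> K \<and> WUC (Lip0 z K) f \<longrightarrow>
        (\<exists>g. WUC (Lip0 z UNIV) g \<and> (\<forall>n. \<forall>x\<in>K. g n x = f n x))) \<or>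
     (\<comment> \<open>(c)\<close> \<forall>(K::'a set) \<phi>. compact K \<and> lipschitz_into_ell1 K \<phi> \<longrightarrow>
        (\<exists>\<Phi>. lipschitz_into_ell1 UNIV \<Phi> \<and> (\<forall>x\<in>K. \<Phi> x = \<phi> x))) \<or>
     (\<comment> \<open>(d)\<close> \<forall>K. compact K \<and> z \<in> K \<longrightarrow>
        (\<exists>E. bounded_linear_between (Lip0 z K) (Lip0 z UNIV) E \<and>
             (\<forall>f\<in>vecs (Lip0 z K). \<forall>x\<in>K. E f x = f x))) \<or>
     (\<comment> \<open>(e)\<close> \<forall>K::'a set. compact K \<longrightarrow> (\<exists>L. compact L \<and> K \<subseteq> L \<and> lipschitz_retract L))"
    and compacts: "\<forall>K. compact K \<longrightarrow> property_Vstar (free_space z (insert z K))"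
  shows "property_Vstar (free_space z (UNIV :: 'a set))"
proof (rule property_Vstar_if_lifting)
  show "property_Vstar (free_space z (insert z K))" if "compact K" for K using compacts that by blast
  fix K \<Gamma>
  assume K: "compact K" "z \<in> K" and \<Gamma>: "\<Gamma> \<subseteq> vecs (free_space z K)"
    and V: "\<And>U. open U \<Longrightarrow> K \<subseteq> U \<Longrightarrow>
      Vstar_set (free_space z (closure U)) (free_embedding z K (closure U) ` \<Gamma>)"
  have V_UNIV: "Vstar_set (free_space z UNIV) (free_embedding z K UNIV ` \<Gamma>)"
    using V[OF open_UNIV subset_UNIV] by (simp only: closure_UNIV)
  let ?goal = "\<exists>L. compact L \<and> K \<subseteq> L \<and> Vstar_set (free_space z L) (free_embedding z K L ` \<Gamma>)"
  have goal: ?goal if "compact L" "K \<subseteq> L" "\<And>C f. unconditionally_lipschitz z L C f \<Longrightarrow>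
      \<exists>C' g. unconditionally_lipschitz z UNIV C' g \<and> (\<forall>n. \<forall>x\<in>K. g n x = f n x)" for L
    by (intro exI[of _ L] conjI that(1,2) Vstar_set_pushforward_if_extension[OF K(2) that(2) \<Gamma> V_UNIV])
      (rule that(3))
  from conditions show ?goal
  proof (elim disjE)
    assume a: "\<forall>K \<Gamma>. compact K \<and> z \<in> K \<and> \<Gamma> \<subseteq> vecs (free_space z K) \<and>
        (\<forall>U. open U \<and> K \<subseteq> U \<longrightarrow>
          Vstar_set (free_space z (closure U)) (free_embedding z K (closure U) ` \<Gamma>)) \<longrightarrow>
        (\<exists>L. compact L \<and> K \<subseteq> L \<and> Vstar_set (free_space z L) (free_embedding z K L ` \<Gamma>))"
    show ?goal by (rule a[rule_format]) (use K \<Gamma> V in blast)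
  next
    assume b: "\<forall>K f. compact K \<and> z \<in> K \<and> WUC (Lip0 z K) f \<longrightarrow>
        (\<exists>g. WUC (Lip0 z UNIV) g \<and> (\<forall>n. \<forall>x\<in>K. g n x = f n x))"
    show ?goal
    proof (rule goal[OF K(1) order_refl])
      fix C f assume "unconditionally_lipschitz z K C f"
      then have "WUC (Lip0 z K) f" by (rule unconditionally_lipschitz_imp_WUC)
      then obtain g where g: "WUC (Lip0 z UNIV) g" "\<forall>n. \<forall>x\<in>K. g n x = f n x"
        using b[THEN spec, THEN spec, THEN mp, OF conjI[OF K(1) conjI[OF K(2)]]] by metis
      obtain C' where "unconditionally_lipschitz z UNIV C' g"
        by (rule WUC_imp_unconditionally_lipschitz[OF UNIV_I g(1)])
      with g(2) show "\<exists>C' g. unconditionally_lipschitz z UNIV C' g \<and> (\<forall>n. \<forall>x\<in>K. g n x = f n x)" by blast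
    qed
  next
    assume c: "\<forall>(K::'a set) \<phi>. compact K \<and> lipschitz_into_ell1 K \<phi> \<longrightarrow>
        (\<exists>\<Phi>. lipschitz_into_ell1 UNIV \<Phi> \<and> (\<forall>x\<in>K. \<Phi> x = \<phi> x))"
    show ?goal
      by (rule goal[OF K(1) order_refl]) (rule extension_if_ell1_extension[OF c K])
  next
    assume d: "\<forall>K. compact K \<and> z \<in> K \<longrightarrow>
        (\<exists>E. bounded_linear_between (Lip0 z K) (Lip0 z UNIV) E \<and>
             (\<forall>f\<in>vecs (Lip0 z K). \<forall>x\<in>K. E f x = f x))"
    obtain E where E: "bounded_linear_between (Lip0 z K) (Lip0 z UNIV) E"
      and E_ext: "\<forall>f\<in>vecs (Lip0 z K). \<forall>x\<in>K. E f x = f x"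
      using d[THEN spec, THEN mp, OF conjI[OF K]] by (elim exE conjE)
    show ?goal
      by (rule goal[OF K(1) order_refl]) (rule extension_if_extension_operator[OF K(2) E E_ext])
  next
    assume "\<forall>K::'a set. compact K \<longrightarrow> (\<exists>L. compact L \<and> K \<subseteq> L \<and> lipschitz_retract L)"
    then obtain L where L: "compact L" "K \<subseteq> L" "lipschitz_retract L" using K(1) by blast
    then obtain \<pi> D where \<pi>: "D-lipschitz_on UNIV \<pi>" "range \<pi> \<subseteq> L" "\<And>x. x \<in> L \<Longrightarrow> \<pi> x = x"
      unfolding lipschitz_retract_def by blast
    have zL: "z \<in> L" using K(2) L(2) by blast
    show ?goal
    proof (rule goal[OF L(1,2)])
      fix C f assume "unconditionally_lipschitz z L C f"
      then have "unconditionally_lipschitz z UNIV (C * D) (\<lambda>n x. f n (\<pi> x))"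
        using zL \<pi> by (rule unconditionally_lipschitz_retraction)
      moreover have "f n (\<pi> x) = f n x" if "x \<in> K" for n x using \<pi>(3) L(2) that by auto
      ultimately show "\<exists>C' g. unconditionally_lipschitz z UNIV C' g \<and> (\<forall>n. \<forall>x\<in>K. g n x = f n x)" by blast
    qed
  qed
qed

end
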